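(* Assume there exist $\lambda_0>0$ and strictly positive functions $\psi_0\in\mathrm{Dom}(L)$, $\phi_0\in\mathrm{Dom}(L^* )$ with $\int_D\psi_0\,dx=\int_D\phi_0\,dx=1$ such that, for all $t\ge0$, $P^D_t\psi_0=e^{-\lambda_0t}\psi_0$, $(P^D)^*_t\phi_0=e^{-\lambda_0t}\phi_0$, hence $(L+\lambda_0)\psi_0=(L^*+\lambda_0)\phi_0=0$. Assume that $B^H_t=\int_0^tK^H(t,s)\,dB_s$, where $B$ is the same Brownian motion that appears in $N$. Let $g(z)\ge Cz^{1+\beta}$ for all $z>0$, where $C>0$, $\beta>0$ are given constants, and let $$\tau^*=\inf\Big\{t>0:\int_0^t\exp\big[-\beta(\lambda_0K(r)+A(r))+\beta N_r\big]\,dr\ \ge\ \frac1{C\beta}\langle\varphi,\phi_0\rangle_D^{-\beta}\Big\},$$ $$\mu(T)=\int_0^T\exp[-\beta(\lambda_0K(t)+A(t))]\;\mathbb E[\exp(\beta N_t)]\,dt .$$ Then for any $T>0$ such that $\frac1{C\beta}\langle\varphi,\phi_0\rangle_D^{-\beta}>\mu(T)$, $$\mathbb P\{\tau^*\le T\}\le 2\exp\left(-\frac{\ln^2\big[C\beta\,\langle\varphi,\phi_0\rangle_D^{\beta}\,\mu(T)\big]}{2M(T)}\right),$$ where $$M(T)=2\beta^2\int_0^Ta^2(r)\,dr+4\beta^2HT^{2H-1}\int_0^Tb^2(u)\,du.$$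
   Context: $D\subset\mathbb{R}^d$ is a bounded Lipschitz domain, $\langle\cdot,\cdot\rangle_D$ the scalar product of $L^2(D)$. $L$ is the infinitesimal generator of a strongly continuous semigroup of contractions $(P^D_t)_{t\ge0}$ on $L^2(D)$ with adjoint $L^*$ generating $((P^D)^*_t)_{t\ge0}$; the associated transition functions admit continuous densities on $D\times D$ for $t>0$. $\varphi\in L^\infty(D)$, $\varphi\ge0$; $g:\mathbb{R}\to[0,\infty)$ is locally Lipschitz. On a filtered probability space $(\Omega,\mathcal F,(\mathcal F_t)_{t\ge0},\mathbb P)$, $B$ is a Brownian motion and $B^H$ a fractional Brownian motion with Hurst parameter $H\in(1/2,1)$, both adapted. $a$ is continuous, $b$ is Hölder continuous of order $\alpha>1-H$, $k$ is a real function on $[0,\infty)$ with $\int_0^tk^2(r)\,dr<\infty$ for all $t$, and $N_t=\int_0^t a(s)\,dB_s+\int_0^t b(s)\,dB^H_s$ (Itô integral plus fractional, i.e. generalized Riemann–Stieltjes, integral). $K(t)=\frac12\int_0^tk^2(r)\,dr$, $A(t)=\frac12\int_0^ta^2(r)\,dr$. The kernel is $K^H(t,s)=C_Hs^{1/2-H}\int_s^t(\sigma-s)^{H-3/2}\sigma^{H-1/2}\,d\sigma$ if $t>s$, and $K^H(t,s)=0$ if $t\le s$, where $C_H=\big[\frac{H(2H-1)}{\mathcal B(2-2H,H-1/2)}\big]^{1/2}$ and $\mathcal B$ is the beta function. Background: $\tau^*$ is the upper bound for the blowup time of the weak solution of $du(x,t)=[\frac12k^2(t)Lu(x,t)+g(u(x,t))]dt+u(x,t)\,dN_t$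 on $D$ with $u(\cdot,0)=\varphi$ and $u=0$ on $\partial D$. Conventions: $\inf\emptyset=+\infty$, $0^{-\beta}=+\infty$, and the right-hand side of the bound is $0$ when $\langle\varphi,\phi_0\rangle_D=0$. *)

theory Defs
  imports "HOL-Probability.Probability"
begin

section \<open>Lipschitz domains and operators on L2\<close>

text \<open>Near every boundary point \<open>p\<close> the domain is, in coordinates with a vertical unit vector
  \<open>e\<close>, the part of a cylinder lying strictly above the graph of a Lipschitz function.\<close>

definition lipschitz_domain :: "'a::euclidean_space set \<Rightarrow> bool" where
  "lipschitz_domain D \<longleftrightarrow> open D \<and> connected D \<and> D \<noteq> {} \<and>
    (\<forall>p\<in>frontier D. \<exists>e r h \<gamma> c.
       norm e = 1 \<and> 0 < r \<and> 0 < h \<and> c-lipschitz_on {y. y \<bullet> e = 0} \<gamma> \<and>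
       (\<forall>y. y \<bullet> e = 0 \<and> norm y < r \<longrightarrow> \<bar>\<gamma> y\<bar> < h) \<and>
       (\<forall>y s. y \<bullet> e = 0 \<and> norm y < r \<and> \<bar>s\<bar> < h \<longrightarrow>
          (p + y + s *\<^sub>R e \<in> D \<longleftrightarrow> \<gamma> y < s) \<and>
          (p + y + s *\<^sub>R e \<in> frontier D \<longleftrightarrow> s = \<gamma> y)))"

text \<open>Elements of L2(D) are handled through representatives; identities between them are
  stated almost everywhere on \<open>D\<close>.\<close>

definition L2_fun :: "'a::euclidean_space set \<Rightarrow> ('a \<Rightarrow> real) set" where
  "L2_fun D = {f \<in> borel_measurable (lebesgue_on D). integrable (lebesgue_on D) (\<lambda>x. (f x)\<^sup>2)}"

definition inner_D :: "'a::euclidean_space set \<Rightarrow> ('a \<Rightarrow> real) \<Rightarrow> ('a \<Rightarrow> real) \<Rightarrow> real" where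
  "inner_D D f h = (LINT x|lebesgue_on D. f x * h x)"

definition norm_D :: "'a::euclidean_space set \<Rightarrow> ('a \<Rightarrow> real) \<Rightarrow> real" where
  "norm_D D f = sqrt (inner_D D f f)"

text \<open>Linearity together with contractivity makes every \<open>P t\<close> compatible with almost everywhere
  equality.\<close>

definition contraction_semigroup ::
  "'a::euclidean_space set \<Rightarrow> (real \<Rightarrow> ('a \<Rightarrow> real) \<Rightarrow> ('a \<Rightarrow> real)) \<Rightarrow> bool" where
  "contraction_semigroup D P \<longleftrightarrow>
    (\<forall>t\<ge>0. \<forall>f\<in>L2_fun D. P t f \<in> L2_fun D \<and> norm_D D (P t f) \<le> norm_D D f) \<and>
    (\<forall>t\<ge>0. \<forall>f\<in>L2_fun D. \<forall>h\<in>L2_fun D. \<forall>c d.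
       AE x in lebesgue_on D. P t (\<lambda>y. c * f y + d * h y) x = c * P t f x + d * P t h x) \<and>
    (\<forall>f\<in>L2_fun D. AE x in lebesgue_on D. P 0 f x = f x) \<and>
    (\<forall>s\<ge>0. \<forall>t\<ge>0. \<forall>f\<in>L2_fun D. AE x in lebesgue_on D. P (s + t) f x = P s (P t f) x) \<and>
    (\<forall>f\<in>L2_fun D. ((\<lambda>t. norm_D D (\<lambda>x. P t f x - f x)) \<longlongrightarrow> 0) (at_right 0))"

definition generator_limit ::
  "'a::euclidean_space set \<Rightarrow> (real \<Rightarrow> ('a \<Rightarrow> real) \<Rightarrow> ('a \<Rightarrow> real)) \<Rightarrow> ('a \<Rightarrow> real) \<Rightarrow> ('a \<Rightarrow> real) \<Rightarrow> bool"
where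
  "generator_limit D P f h \<longleftrightarrow>
    ((\<lambda>t. norm_D D (\<lambda>x. (P t f x - f x) / t - h x)) \<longlongrightarrow> 0) (at_right 0)"

text \<open>An unbounded operator is given by its domain \<open>U\<close> and its values \<open>L\<close> on that domain.\<close>

definition infinitesimal_generator ::
  "'a::euclidean_space set \<Rightarrow> (real \<Rightarrow> ('a \<Rightarrow> real) \<Rightarrow> ('a \<Rightarrow> real)) \<Rightarrow>
    ('a \<Rightarrow> real) set \<Rightarrow> (('a \<Rightarrow> real) \<Rightarrow> ('a \<Rightarrow> real)) \<Rightarrow> bool" where
  "infinitesimal_generator D P U L \<longleftrightarrow>
    U = {f \<in> L2_fun D. \<exists>h\<in>L2_fun D. generator_limit D P f h} \<and>
    (\<forall>f\<in>U. L f \<in> L2_fun D \<and> generator_limit D P f (L f))"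

definition adjoint_operator ::
  "'a::euclidean_space set \<Rightarrow> ('a \<Rightarrow> real) set \<Rightarrow> (('a \<Rightarrow> real) \<Rightarrow> ('a \<Rightarrow> real)) \<Rightarrow>
    ('a \<Rightarrow> real) set \<Rightarrow> (('a \<Rightarrow> real) \<Rightarrow> ('a \<Rightarrow> real)) \<Rightarrow> bool" where
  "adjoint_operator D U L U' L' \<longleftrightarrow>
    U' = {h \<in> L2_fun D. \<exists>h'\<in>L2_fun D. \<forall>f\<in>U. inner_D D (L f) h = inner_D D f h'} \<and>
    (\<forall>h\<in>U'. L' h \<in> L2_fun D \<and> (\<forall>f\<in>U. inner_D D (L f) h = inner_D D f (L' h)))"

text \<open>The transition functions are the sub-Markovian kernels \<open>p t x y dy\<close>.\<close>

definition continuous_transition_densities ::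
  "'a::euclidean_space set \<Rightarrow> (real \<Rightarrow> ('a \<Rightarrow> real) \<Rightarrow> ('a \<Rightarrow> real)) \<Rightarrow> (real \<Rightarrow> 'a \<Rightarrow> 'a \<Rightarrow> real) \<Rightarrow> bool"
where
  "continuous_transition_densities D P p \<longleftrightarrow>
    (\<forall>t>0. continuous_on (D \<times> D) (\<lambda>(x, y). p t x y) \<and>
       (\<forall>x\<in>D. \<forall>y\<in>D. 0 \<le> p t x y) \<and>
       (\<forall>x\<in>D. (\<integral>\<^sup>+y. ennreal (p t x y) \<partial>lebesgue_on D) \<le> 1) \<and>
       (\<forall>f\<in>L2_fun D. AE x in lebesgue_on D.
          integrable (lebesgue_on D) (\<lambda>y. p t x y * f y) \<and>
          P t f x = (LINT y|lebesgue_on D. p t x y * f y)))"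

section \<open>Brownian and fractional Brownian motion\<close>

definition brownian_motion :: "'w measure \<Rightarrow> (real \<Rightarrow> 'w \<Rightarrow> real) \<Rightarrow> bool" where
  "brownian_motion M B \<longleftrightarrow>
    (\<forall>t\<ge>0. B t \<in> borel_measurable M) \<and>
    (AE \<omega> in M. B 0 \<omega> = 0) \<and>
    (\<forall>s t. 0 \<le> s \<and> s < t \<longrightarrow>
       distributed M lborel (\<lambda>\<omega>. B t \<omega> - B s \<omega>) (normal_density 0 (sqrt (t - s)))) \<and>
    (\<forall>n (u::nat \<Rightarrow> real). 0 \<le> u 0 \<and> (\<forall>i<n. u i < u (Suc i)) \<longrightarrow>
       prob_space.indep_vars M (\<lambda>_. borel) (\<lambda>i \<omega>. B (u (Suc i)) \<omega> - B (u i) \<omega>) {..<n}) \<and>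
    (AE \<omega> in M. continuous_on {0..} (\<lambda>t. B t \<omega>))"

definition centered_gaussian :: "'w measure \<Rightarrow> ('w \<Rightarrow> real) \<Rightarrow> bool" where
  "centered_gaussian M X \<longleftrightarrow> X \<in> borel_measurable M \<and>
    ((AE \<omega> in M. X \<omega> = 0) \<or> (\<exists>\<sigma>>0. distributed M lborel X (normal_density 0 \<sigma>)))"

definition fractional_brownian_motion ::
  "real \<Rightarrow> 'w measure \<Rightarrow> (real \<Rightarrow> 'w \<Rightarrow> real) \<Rightarrow> bool" where
  "fractional_brownian_motion H M X \<longleftrightarrow>
    (\<forall>I c. finite I \<and> I \<subseteq> {0..} \<longrightarrow> centered_gaussian M (\<lambda>\<omega>. \<Sum>t\<in>I. c t * X t \<omega>)) \<and>
    (\<forall>s\<ge>0. \<forall>t\<ge>0. (LINT \<omega>|M. X s \<omega> * X t \<omega>) =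
       (s powr (2 * H) + t powr (2 * H) - \<bar>t - s\<bar> powr (2 * H)) / 2) \<and>
    (AE \<omega> in M. continuous_on {0..} (\<lambda>t. X t \<omega>))"

definition C_H :: "real \<Rightarrow> real" where
  "C_H H = sqrt (H * (2 * H - 1) / Beta (2 - 2 * H) (H - 1/2))"

definition K_H :: "real \<Rightarrow> real \<Rightarrow> real \<Rightarrow> real" where
  "K_H H t s = (if s < t
     then C_H H * s powr (1/2 - H) *
       (LINT \<sigma>|lebesgue_on {s..t}. (\<sigma> - s) powr (H - 3/2) * \<sigma> powr (H - 1/2))
     else 0)"

section \<open>Stochastic integrals\<close>

text \<open>A list of triples \<open>(c, u, v)\<close> stands for the step function that is the sum of the
  functions \<open>c\<close> times the indicator of the interval from \<open>u\<close> (excluded) to \<open>v\<close> (included).\<close>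

definition step_fun :: "(real \<times> real \<times> real) list \<Rightarrow> real \<Rightarrow> real" where
  "step_fun xs s = (\<Sum>(c, u, v)\<leftarrow>xs. c * indicator {u<..v} s)"

definition step_ito :: "(real \<Rightarrow> 'w \<Rightarrow> real) \<Rightarrow> (real \<times> real \<times> real) list \<Rightarrow> 'w \<Rightarrow> real" where
  "step_ito B xs \<omega> = (\<Sum>(c, u, v)\<leftarrow>xs. c * (B v \<omega> - B u \<omega>))"

text \<open>The Ito integral over \<open>[0,t]\<close> of a deterministic square integrable \<open>f\<close>: the limit in
  mean square of integrals of step functions converging to \<open>f\<close> in L2.  It is determined
  up to almost sure equality, hence a relation.\<close>

definition has_ito_integral ::
  "'w measure \<Rightarrow> (real \<Rightarrow> 'w \<Rightarrow> real) \<Rightarrow> real \<Rightarrow> (real \<Rightarrow> real) \<Rightarrow> ('w \<Rightarrow> real) \<Rightarrow> bool" where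
  "has_ito_integral M B t f I \<longleftrightarrow>
    f \<in> borel_measurable (lebesgue_on {0..t}) \<and> I \<in> borel_measurable M \<and>
    (\<exists>xs :: nat \<Rightarrow> (real \<times> real \<times> real) list.
       (\<forall>n. \<forall>(c, u, v)\<in>set (xs n). 0 \<le> u \<and> u \<le> v \<and> v \<le> t) \<and>
       (\<lambda>n. \<integral>\<^sup>+s. ennreal ((step_fun (xs n) s - f s)\<^sup>2) \<partial>lebesgue_on {0..t}) \<longlonglongrightarrow> 0 \<and>
       (\<lambda>n. \<integral>\<^sup>+\<omega>. ennreal ((step_ito B (xs n) \<omega> - I \<omega>)\<^sup>2) \<partial>M) \<longlonglongrightarrow> 0)"

text \<open>Fractional (Weyl) derivatives of order \<open>\<delta>\<close> on \<open>[0,t]\<close>, left-sided at \<open>0\<close> and right-sided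
  at \<open>t\<close>; the latter without the customary factor \<open>(-1)\<close> to the power \<open>\<delta>\<close>.\<close>

definition weyl_deriv_left :: "real \<Rightarrow> (real \<Rightarrow> real) \<Rightarrow> real \<Rightarrow> real" where
  "weyl_deriv_left \<delta> f x = 1 / Gamma (1 - \<delta>) *
    (f x / x powr \<delta> + \<delta> * (LINT y|lebesgue_on {0..x}. (f x - f y) / (x - y) powr (\<delta> + 1)))"

definition weyl_deriv_right :: "real \<Rightarrow> real \<Rightarrow> (real \<Rightarrow> real) \<Rightarrow> real \<Rightarrow> real" where
  "weyl_deriv_right \<delta> t f x = 1 / Gamma (1 - \<delta>) *
    (f x / (t - x) powr \<delta> + \<delta> * (LINT y|lebesgue_on {x..t}. (f x - f y) / (y - x) powr (\<delta> + 1)))"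

text \<open>Zaehle's generalized Riemann-Stieltjes integral of \<open>f\<close> against a continuous \<open>h\<close> over
  \<open>[0,t]\<close>.  The minus sign is the product of the factors \<open>(-1)\<close> to the powers \<open>\<epsilon>\<close> (in front of
  the integral) and \<open>1 - \<epsilon>\<close> (from the right-sided derivative).  If \<open>f\<close> and \<open>h\<close> are Hoelder of
  orders greater than \<open>\<epsilon>\<close> and \<open>1 - \<epsilon>\<close>, respectively, all integrals converge absolutely and the
  value does not depend on \<open>\<epsilon>\<close>.\<close>

definition fractional_integral ::
  "real \<Rightarrow> (real \<Rightarrow> real) \<Rightarrow> (real \<Rightarrow> real) \<Rightarrow> real \<Rightarrow> real" where
  "fractional_integral \<epsilon> f h t = f 0 * (h t - h 0) -
    (LINT x|lebesgue_on {0..t}.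
       weyl_deriv_left \<epsilon> (\<lambda>s. f s - f 0) x * weyl_deriv_right (1 - \<epsilon>) t (\<lambda>s. h s - h t) x)"

section \<open>The bound for the blowup time\<close>

definition half_energy :: "(real \<Rightarrow> real) \<Rightarrow> real \<Rightarrow> real" where
  "half_energy f t = 1/2 * (LINT r|lebesgue_on {0..t}. (f r)\<^sup>2)"

definition exp_functional ::
  "real \<Rightarrow> real \<Rightarrow> (real \<Rightarrow> real) \<Rightarrow> (real \<Rightarrow> real) \<Rightarrow> (real \<Rightarrow> real) \<Rightarrow> real \<Rightarrow> real" where
  "exp_functional \<beta> lam\<^sub>0 k a n t =
    (LINT r|lebesgue_on {0..t}.
       exp (- \<beta> * (lam\<^sub>0 * half_energy k r + half_energy a r) + \<beta> * n r))"

definition threshold :: "real \<Rightarrow> real \<Rightarrow> real \<Rightarrow> ereal" where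
  "threshold C \<beta> q = (if q = 0 then \<infinity> else ereal (1 / (C * \<beta>) * q powr (- \<beta>)))"

definition tau_star ::
  "real \<Rightarrow> real \<Rightarrow> real \<Rightarrow> (real \<Rightarrow> real) \<Rightarrow> (real \<Rightarrow> real) \<Rightarrow> real \<Rightarrow> (real \<Rightarrow> real) \<Rightarrow> ereal" where
  "tau_star C \<beta> lam\<^sub>0 k a q n =
    Inf {ereal t | t. 0 < t \<and> ereal (exp_functional \<beta> lam\<^sub>0 k a n t) \<ge> threshold C \<beta> q}"

definition mu_T ::
  "'w measure \<Rightarrow> real \<Rightarrow> real \<Rightarrow> (real \<Rightarrow> real) \<Rightarrow> (real \<Rightarrow> real) \<Rightarrow> (real \<Rightarrow> 'w \<Rightarrow> real) \<Rightarrow> real \<Rightarrow> real"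
where
  "mu_T M \<beta> lam\<^sub>0 k a N T =
    (LINT t|lebesgue_on {0..T}.
       exp (- \<beta> * (lam\<^sub>0 * half_energy k t + half_energy a t)) * (LINT \<omega>|M. exp (\<beta> * N t \<omega>)))"

definition M_T :: "real \<Rightarrow> real \<Rightarrow> (real \<Rightarrow> real) \<Rightarrow> (real \<Rightarrow> real) \<Rightarrow> real \<Rightarrow> real" where
  "M_T \<beta> H a b T = 2 * \<beta>\<^sup>2 * (LINT r|lebesgue_on {0..T}. (a r)\<^sup>2) +
     4 * \<beta>\<^sup>2 * H * T powr (2 * H - 1) * (LINT u|lebesgue_on {0..T}. (b u)\<^sup>2)"

text \<open>For \<open>m = 0\<close> the exponent is read as minus infinity (the logarithm is nonzero whenever
  \<open>\<mu>\<close> is below the threshold).\<close>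

definition tail_bound :: "real \<Rightarrow> real \<Rightarrow> real \<Rightarrow> real \<Rightarrow> real \<Rightarrow> real" where
  "tail_bound C \<beta> q \<mu> m = (if q = 0 \<or> m = 0 then 0
     else 2 * exp (- ((ln (C * \<beta> * q powr \<beta> * \<mu>))\<^sup>2 / (2 * m))))"

end

theory Submission
  imports Defs
begin

text \<open>The functional \<open>X\<close>, the integral over \<open>[0,T]\<close> of \<open>w(r) exp(\<beta> N(r))\<close> with the deterministic weight
\<open>w = exp(-\<beta> (\<lambda>\<^sub>0 K + A))\<close>, is continuous and nondecreasing in the upper limit.  Hence the blowup
bound is at most \<open>T\<close> exactly if \<open>X\<close> reaches the threshold \<open>x\<close>
(\<open>tau_star_le_iff\<close>; for an infinite threshold the event is empty), and the claim is a tail estimate for \<open>X\<close> above its mean \<open>\<mu> < x\<close>.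

Tail estimate.  Every \<open>N(r)\<close> is centered Gaussian, and \<open>\<beta>\<^sup>2 Var N(r) \<le> m\<close>, where \<open>m\<close> stands for
\<open>M(T)\<close>.  So \<open>G(r) = exp(\<beta> N(r)) / E exp(\<beta> N(r))\<close> has \<open>p\<close>-th moment at most \<open>exp((p\<^sup>2 - p) m / 2)\<close>
for all \<open>p \<ge> 1\<close>.  The quotient \<open>X / \<mu>\<close> is an average of \<open>G\<close> over \<open>r\<close> with respect to a probability
density, and convexity and Markov's inequality give
\<open>P(X \<ge> x) \<le> exp((p\<^sup>2 - p) m / 2 - p y)\<close> with \<open>y = ln(x / \<mu>)\<close> (\<open>tail_exponent\<close>).
The choice \<open>p = 1 + y / m\<close> turns the exponent into \<open>- y / 2 - y\<^sup>2 / (2 m)\<close>; if \<open>m = 0\<close>, let \<open>p\<close> tend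
to infinity.

Gaussianity.  All random variables that are limits in mean of step integrals against the same Brownian
motion form a linear space of centered Gaussian variables (\<open>brownian_space\<close>).  It contains the
Ito integral of \<open>a\<close> and, by the representation of \<open>B\<^sup>H\<close> as an Ito integral, every \<open>B\<^sup>H(s)\<close>.  It remains
to place the fractional integral of \<open>b\<close> there and to bound its variance.

The fractional integral is defined path by path.  Interpolate a path of \<open>B\<^sup>H\<close> linearly on a grid.
For the interpolated path the fractional integral is the finite sum of the cell means of \<open>b\<close> times the
increments of \<open>B\<^sup>H\<close> (\<open>fractional_integral_interp\<close>, which rests on Euler's Beta integral).
The error is controlled by a double integral of the increments of the interpolation error against the
kernel \<open>z powr (-2 + \<epsilon>)\<close> (\<open>fractional_integral_stability\<close>).  Its expectation tends to \<open>0\<close> by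
dominated convergence, as \<open>E \<bar>B\<^sup>H(u) - B\<^sup>H(v)\<bar> \<le> \<bar>u - v\<bar> powr H\<close> and \<open>H > 1 - \<epsilon>\<close>
(\<open>riemann_L1_limit\<close>).

Variance.  For \<open>H > 1/2\<close> the increments of \<open>B\<^sup>H\<close> are nonnegatively correlated.  A quadratic form with
nonnegative symmetric coefficients is bounded by its row sums, and each row sum is the covariance of one
increment with \<open>B\<^sup>H(t)\<close>, hence at most \<open>2 H t powr (2 H - 1)\<close> times the length of the cell.  This gives
the variance bound \<open>2 H t powr (2 H - 1)\<close> times the integral of \<open>b\<^sup>2\<close>.  Together with
\<open>Var(I + Y) \<le> 2 Var I + 2 Var Y\<close> it produces the constant \<open>M(T)\<close>.\<close>

section \<open>Gaussian random variables\<close>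

text \<open>The characteristic function is used instead of a density, so that constant variables (\<open>s = 0\<close>) are
included and limits are easy to take.\<close>

definition gaussian_rv :: "'w measure \<Rightarrow> ('w \<Rightarrow> real) \<Rightarrow> real \<Rightarrow> bool" where
  "gaussian_rv M X s \<longleftrightarrow> X \<in> borel_measurable M \<and> 0 \<le> s \<and>
     (\<forall>r. char (distr M borel X) r = exp (- (s * r\<^sup>2 / 2)))"

lemma gaussian_rv_measurable [measurable_dest]: "gaussian_rv M X s \<Longrightarrow> X \<in> borel_measurable M"
  by (simp add: gaussian_rv_def)

lemma char_distr_eq:
  assumes "X \<in> borel_measurable M"
  shows "char (distr M borel X) r = (LINT \<omega>|M. iexp (r * X \<omega>))"
  unfolding char_def using assms by (subst integral_distr) auto

context prob_space
begin

text \<open>By uniqueness of characteristic functions the variable is distributed like a multiple of a standard normal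
one; this reduces all moments to Gaussian integrals, also in the degenerate case.\<close>

lemma distr_gaussian_rv:
  assumes "gaussian_rv M X s"
  shows "distr M borel X = distr std_normal_distribution borel (\<lambda>x. sqrt s * x)"
proof (rule Levy_uniqueness)
  interpret S: real_distribution std_normal_distribution by (rule real_dist_normal_dist)
  have [measurable]: "X \<in> borel_measurable M" and s: "0 \<le> s"
    using assms by (auto simp: gaussian_rv_def)
  show "real_distribution (distr M borel X)" by simp
  show "real_distribution (distr std_normal_distribution borel (\<lambda>x. sqrt s * x))"
    by (rule S.real_distribution_distr) measurable
  show "char (distr M borel X) = char (distr std_normal_distribution borel (\<lambda>x. sqrt s * x))"
  proof
    fix r
    have "char (distr std_normal_distribution borel (\<lambda>x. sqrt s * x)) r
      = char std_normal_distribution (r * sqrt s)"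
      by (subst char_distr_eq) (auto simp: char_def ac_simps)
    also have "\<dots> = exp (- (s * r\<^sup>2 / 2))"
      using s by (simp add: char_std_normal_distribution power_mult_distrib ac_simps)
    finally show "char (distr M borel X) r = char (distr std_normal_distribution borel (\<lambda>x. sqrt s * x)) r"
      using assms by (simp add: gaussian_rv_def)
  qed
qed

lemma nn_integral_gaussian_rv:
  assumes X: "gaussian_rv M X s" and [measurable]: "h \<in> borel_measurable borel"
  shows "(\<integral>\<^sup>+\<omega>. h (X \<omega>) \<partial>M) = (\<integral>\<^sup>+x. ennreal (std_normal_density x) * h (sqrt s * x) \<partial>lborel)"
proof -
  have [measurable]: "X \<in> borel_measurable M" using X by (auto simp: gaussian_rv_def)
  have "(\<integral>\<^sup>+\<omega>. h (X \<omega>) \<partial>M) = (\<integral>\<^sup>+x. h x \<partial>distr M borel X)"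
    by (subst nn_integral_distr) auto
  also have "\<dots> = (\<integral>\<^sup>+x. h (sqrt s * x) \<partial>std_normal_distribution)"
    unfolding distr_gaussian_rv[OF X] by (subst nn_integral_distr) auto
  also have "\<dots> = (\<integral>\<^sup>+x. ennreal (std_normal_density x) * h (sqrt s * x) \<partial>lborel)"
    by (subst nn_integral_density) auto
  finally show ?thesis .
qed

lemma gaussian_rv_exp_moment:
  assumes X: "gaussian_rv M X s"
  shows "(\<integral>\<^sup>+\<omega>. ennreal (exp (c * X \<omega>)) \<partial>M) = ennreal (exp (c\<^sup>2 * s / 2))"
proof -
  have s: "0 \<le> s" using X by (auto simp: gaussian_rv_def)
  have eq: "std_normal_density x * exp (c * (sqrt s * x))
      = exp (c\<^sup>2 * s / 2) * normal_density (c * sqrt s) 1 x" for x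
  proof -
    have "- x\<^sup>2 / 2 + c * (sqrt s * x) = c\<^sup>2 * s / 2 + (- (x - c * sqrt s)\<^sup>2 / 2)"
      using s by (simp add: power2_diff power_mult_distrib field_simps)
    then show ?thesis
      by (simp add: std_normal_density_def normal_density_def mult_exp_exp flip: exp_add)
  qed
  have "(\<integral>\<^sup>+\<omega>. ennreal (exp (c * X \<omega>)) \<partial>M)
      = (\<integral>\<^sup>+x. ennreal (std_normal_density x) * ennreal (exp (c * (sqrt s * x))) \<partial>lborel)"
    by (rule nn_integral_gaussian_rv[OF X]) measurable
  also have "\<dots> = (\<integral>\<^sup>+x. ennreal (exp (c\<^sup>2 * s / 2)) * ennreal (normal_density (c * sqrt s) 1 x) \<partial>lborel)"
    by (simp add: eq flip: ennreal_mult)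
  also have "\<dots> = ennreal (exp (c\<^sup>2 * s / 2))"
    by (subst nn_integral_cmult) (auto simp: nn_integral_eq_integral)
  finally show ?thesis .
qed

lemma gaussian_rv_second_moment:
  assumes X: "gaussian_rv M X s"
  shows "(\<integral>\<^sup>+\<omega>. ennreal ((X \<omega>)\<^sup>2) \<partial>M) = ennreal s"
proof -
  have s: "0 \<le> s" using X by (auto simp: gaussian_rv_def)
  have m: "(\<integral>\<^sup>+x. ennreal (std_normal_density x * x\<^sup>2) \<partial>lborel) = ennreal 1"
    using std_normal_moment_even[of 1]
    by (subst nn_integral_eq_integral) (auto simp: has_bochner_integral_iff power2_eq_square)
  have "(\<integral>\<^sup>+\<omega>. ennreal ((X \<omega>)\<^sup>2) \<partial>M)
      = (\<integral>\<^sup>+x. ennreal (std_normal_density x) * ennreal ((sqrt s * x)\<^sup>2) \<partial>lborel)"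
    by (rule nn_integral_gaussian_rv[OF X]) measurable
  also have "\<dots> = (\<integral>\<^sup>+x. ennreal s * ennreal (std_normal_density x * x\<^sup>2) \<partial>lborel)"
    using s by (simp add: power_mult_distrib ac_simps flip: ennreal_mult)
  also have "\<dots> = ennreal s"
    by (subst nn_integral_cmult) (auto simp: m)
  finally show ?thesis .
qed

text \<open>The variance of \<open>\<bar>X\<bar>\<close> is nonnegative.\<close>

lemma nn_integral_abs_le_sqrt:
  assumes [measurable]: "X \<in> borel_measurable M" and V: "(\<integral>\<^sup>+\<omega>. ennreal ((X \<omega>)\<^sup>2) \<partial>M) \<le> ennreal V"
    and "0 \<le> V"
  shows "(\<integral>\<^sup>+\<omega>. ennreal \<bar>X \<omega>\<bar> \<partial>M) \<le> ennreal (sqrt V)"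
proof -
  have i2: "integrable M (\<lambda>\<omega>. (X \<omega>)\<^sup>2)"
    using V by (intro integrableI_bounded) (auto simp: ennreal_mult_less_top top.extremum_strict intro: le_less_trans)
  have i1: "integrable M X" using i2 by (rule square_integrable_imp_integrable[rotated]) measurable
  have "(expectation (\<lambda>\<omega>. \<bar>X \<omega>\<bar>))\<^sup>2 \<le> expectation (\<lambda>\<omega>. \<bar>X \<omega>\<bar>\<^sup>2)"
    using i1 i2 variance_positive[of "\<lambda>\<omega>. \<bar>X \<omega>\<bar>"] by (subst (asm) variance_eq) auto
  also have "\<dots> \<le> V"
    using V \<open>0 \<le> V\<close> i2 by (subst (asm) nn_integral_eq_integral) auto
  finally have "expectation (\<lambda>\<omega>. \<bar>X \<omega>\<bar>) \<le> sqrt V" by (rule real_le_rsqrt)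
  then show ?thesis using i1 by (subst nn_integral_eq_integral) (auto intro: ennreal_leI)
qed

lemma char_diff_le:
  assumes [measurable]: "X \<in> borel_measurable M" "Y \<in> borel_measurable M"
  shows "ennreal (cmod (char (distr M borel X) r - char (distr M borel Y) r))
     \<le> ennreal \<bar>r\<bar> * (\<integral>\<^sup>+\<omega>. ennreal \<bar>X \<omega> - Y \<omega>\<bar> \<partial>M)"
proof -
  have le: "cmod (iexp (r * x) - iexp (r * y)) \<le> \<bar>r\<bar> * \<bar>x - y\<bar>" for x y :: real
  proof -
    have "iexp (r * x) - iexp (r * y) = iexp (r * y) * (iexp (r * (x - y)) - 1)"
      by (simp add: algebra_simps flip: exp_add)
    also have "cmod \<dots> = cmod (iexp (r * (x - y)) - 1)"
      by (simp add: norm_mult del: of_real_mult of_real_diff)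
    also have "\<dots> \<le> \<bar>r * (x - y)\<bar>"
      using iexp_approx1[of "r * (x - y)" 0] by simp
    finally show ?thesis by (simp add: abs_mult)
  qed
  have i: "integrable M (\<lambda>\<omega>. iexp (r * X \<omega>))" "integrable M (\<lambda>\<omega>. iexp (r * Y \<omega>))"
    by (intro integrable_iexp; simp)+
  have "ennreal (cmod (char (distr M borel X) r - char (distr M borel Y) r))
      = ennreal (cmod (LINT \<omega>|M. iexp (r * X \<omega>) - iexp (r * Y \<omega>)))"
    using i by (simp add: char_distr_eq)
  also have "\<dots> \<le> (\<integral>\<^sup>+\<omega>. ennreal (cmod (iexp (r * X \<omega>) - iexp (r * Y \<omega>))) \<partial>M)"
    using i by (intro integral_norm_bound_ennreal) auto
  also have "\<dots> \<le> (\<integral>\<^sup>+\<omega>. ennreal \<bar>r\<bar> * ennreal \<bar>X \<omega> - Y \<omega>\<bar> \<partial>M)"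
    using le by (intro nn_integral_mono) (simp flip: ennreal_mult)
  also have "\<dots> = ennreal \<bar>r\<bar> * (\<integral>\<^sup>+\<omega>. ennreal \<bar>X \<omega> - Y \<omega>\<bar> \<partial>M)"
    by (rule nn_integral_cmult) measurable
  finally show ?thesis .
qed

text \<open>The characteristic functions converge pointwise.  The limit is a characteristic function, so it is close to
\<open>1\<close> near \<open>0\<close>; taking logarithms at one such point shows that the variances converge.\<close>

lemma gaussian_rv_limit:
  assumes X: "\<And>n. gaussian_rv M (X n) (s n)" and Y [measurable]: "Y \<in> borel_measurable M"
    and lim: "(\<lambda>n. \<integral>\<^sup>+\<omega>. ennreal \<bar>X n \<omega> - Y \<omega>\<bar> \<partial>M) \<longlonglongrightarrow> 0"
  shows "\<exists>v. s \<longlonglongrightarrow> v \<and> gaussian_rv M Y v"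
proof -
  have [measurable]: "X n \<in> borel_measurable M" for n using X by (auto simp: gaussian_rv_def)
  have s0: "0 \<le> s n" for n using X by (auto simp: gaussian_rv_def)
  interpret Y: real_distribution "distr M borel Y" by simp
  have conv: "(\<lambda>n. exp (- (s n * r\<^sup>2 / 2)) :: complex) \<longlonglongrightarrow> char (distr M borel Y) r" for r
  proof -
    have "(\<lambda>n. ennreal (cmod (char (distr M borel (X n)) r - char (distr M borel Y) r))) \<longlonglongrightarrow> 0"
    proof (rule tendsto_sandwich[OF _ _ tendsto_const])
      show "(\<lambda>n. ennreal \<bar>r\<bar> * (\<integral>\<^sup>+\<omega>. ennreal \<bar>X n \<omega> - Y \<omega>\<bar> \<partial>M)) \<longlonglongrightarrow> 0"
        using ennreal_tendsto_cmult[OF _ lim, of "ennreal \<bar>r\<bar>"] by simp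
    qed (auto intro!: always_eventually char_diff_le)
    then have "(\<lambda>n. char (distr M borel (X n)) r - char (distr M borel Y) r) \<longlonglongrightarrow> 0"
      by (subst (asm) ennreal_0[symmetric], subst (asm) tendsto_ennreal_iff) (auto simp: tendsto_norm_zero_iff)
    then show ?thesis using X by (simp add: LIM_zero_iff gaussian_rv_def)
  qed
  \<comment> \<open>a point where the limit does not vanish, so that logarithms are available\<close>
  have "(char (distr M borel Y) \<longlongrightarrow> char (distr M borel Y) 0) (at 0)"
    using Y.isCont_char[of 0] by (simp add: isCont_def)
  then have "((\<lambda>r. Re (char (distr M borel Y) r)) \<longlongrightarrow> 1) (at 0)"
    using tendsto_Re[of _ "char (distr M borel Y) 0"] by (simp add: Y.char_zero)
  then have "\<forall>\<^sub>F r in at 0. 1/2 < Re (char (distr M borel Y) r)"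
    by (rule order_tendstoD) simp
  then have "\<forall>\<^sub>F r in at 0. 1/2 < Re (char (distr M borel Y) r) \<and> r \<noteq> 0"
    by (intro eventually_conj) (auto simp: eventually_at_filter)
  then obtain r where r: "1/2 < Re (char (distr M borel Y) r)" "r \<noteq> 0"
    using eventually_happens[of _ "at (0::real)"] by (auto simp: trivial_limit_at)
  define c where "c = Re (char (distr M borel Y) r)"
  have "(\<lambda>n. exp (- (s n * r\<^sup>2 / 2))) \<longlonglongrightarrow> c"
    using tendsto_Re[OF conv[of r]] by (simp add: c_def)
  then have "(\<lambda>n. ln (exp (- (s n * r\<^sup>2 / 2)))) \<longlonglongrightarrow> ln c"
    using r by (intro tendsto_ln) (auto simp: c_def)
  then have "(\<lambda>n. - (s n * r\<^sup>2 / 2) * (- 2 / r\<^sup>2)) \<longlonglongrightarrow> ln c * (- 2 / r\<^sup>2)"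
    by (intro tendsto_mult) auto
  then obtain v where v: "s \<longlonglongrightarrow> v"
    using r by (auto simp: field_simps)
  have "0 \<le> v" using LIMSEQ_le_const[OF v] s0 by auto
  have "(\<lambda>n. exp (- (s n * r\<^sup>2 / 2)) :: complex) \<longlonglongrightarrow> exp (- (v * r\<^sup>2 / 2))" for r
    by (intro tendsto_intros v) auto
  then have "char (distr M borel Y) r = exp (- (v * r\<^sup>2 / 2))" for r
    using LIMSEQ_unique[OF conv[of r]] by (metis)
  then show ?thesis using v \<open>0 \<le> v\<close> by (auto simp: gaussian_rv_def)
qed

end

section \<open>Stochastic integrals of step functions\<close>

lemma step_fun_Nil [simp]: "step_fun [] s = 0" by (simp add: step_fun_def)
lemma step_fun_Cons: "step_fun ((c, u, v) # xs) s = c * indicator {u<..v} s + step_fun xs s"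
  by (simp add: step_fun_def)
lemma step_ito_Nil [simp]: "step_ito B [] = (\<lambda>_. 0)" by (simp add: step_ito_def fun_eq_iff)
lemma step_ito_Cons: "step_ito B ((c, u, v) # xs) \<omega> = c * (B v \<omega> - B u \<omega>) + step_ito B xs \<omega>"
  by (simp add: step_ito_def)
lemma step_ito_append: "step_ito B (xs @ ys) \<omega> = step_ito B xs \<omega> + step_ito B ys \<omega>"
  by (simp add: step_ito_def)
lemma step_ito_scale: "step_ito B (map (\<lambda>(c, u, v). (k * c, u, v)) xs) \<omega> = k * step_ito B xs \<omega>"
  by (induction xs) (auto simp: step_ito_Cons algebra_simps)

lemma borel_measurable_step_fun [measurable]: "step_fun xs \<in> borel_measurable borel"
proof -
  have "(\<lambda>s. step_fun xs s) \<in> borel_measurable borel"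
  proof (induction xs)
    case (Cons x xs)
    then show ?case by (cases x) (simp add: step_fun_Cons)
  qed simp
  then show ?thesis by simp
qed

lemma borel_measurable_step_ito:
  assumes "\<And>t. 0 \<le> t \<Longrightarrow> B t \<in> borel_measurable M" and "\<And>c u v. (c, u, v) \<in> set xs \<Longrightarrow> 0 \<le> u \<and> u \<le> v"
  shows "step_ito B xs \<in> borel_measurable M"
proof -
  have "(\<lambda>\<omega>. step_ito B xs \<omega>) \<in> borel_measurable M"
    using assms(2)
  proof (induction xs)
    case (Cons x xs)
    obtain c u v where x: "x = (c, u, v)" by (cases x)
    have [measurable]: "B u \<in> borel_measurable M" "B v \<in> borel_measurable M"
      using Cons.prems[of c u v] by (auto simp: x intro: assms(1))
    have [measurable]: "(\<lambda>\<omega>. step_ito B xs \<omega>) \<in> borel_measurable M" using Cons by auto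
    show ?case by (simp add: x step_ito_Cons)
  qed simp
  then show ?thesis by simp
qed

definition on_grid :: "nat \<Rightarrow> (nat \<Rightarrow> real) \<Rightarrow> (real \<times> real \<times> real) list \<Rightarrow> bool" where
  "on_grid n w xs \<longleftrightarrow> (\<forall>(c, u, v)\<in>set xs. \<exists>i j. i \<le> j \<and> j \<le> n \<and> u = w i \<and> v = w j)"

text \<open>Sorting the finitely many endpoints produces a strictly increasing grid; this reduces step functions with
overlapping intervals to sums over disjoint cells, where increments of a Brownian motion are independent.\<close>

lemma common_grid:
  fixes xs :: "(real \<times> real \<times> real) list"
  assumes "\<And>c u v. (c, u, v) \<in> set xs \<Longrightarrow> 0 \<le> u \<and> u \<le> v \<and> v \<le> t"
  shows "\<exists>n w. (n = 0 \<or> 0 \<le> w 0) \<and> (n = 0 \<or> w n \<le> t) \<and> (\<forall>i<n. w i < w (Suc i)) \<and> on_grid n w xs"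
proof -
  define P where "P = (\<Union>(c, u, v)\<in>set xs. {u, v})"
  define l where "l = sorted_list_of_set P"
  have fin: "finite P" by (auto simp: P_def)
  have l: "set l = P" "sorted_wrt (<) l" "distinct l"
    using fin by (auto simp: l_def)
  have P: "x \<in> P \<Longrightarrow> 0 \<le> x \<and> x \<le> t" for x
    using assms unfolding P_def by fastforce
  define n where "n = length l - 1"
  show ?thesis
  proof (intro exI[of _ n] exI[of _ "(!) l"] conjI)
    have lp: "k \<le> n \<Longrightarrow> n \<noteq> 0 \<Longrightarrow> l ! k \<in> P" for k
      unfolding l(1)[symmetric] by (rule nth_mem) (auto simp: n_def)
    show "n = 0 \<or> 0 \<le> l ! 0" "n = 0 \<or> l ! n \<le> t" using lp P by auto
    show "\<forall>i<n. l ! i < l ! Suc i"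
      using l(2) by (auto simp: n_def sorted_wrt_iff_nth_less)
    show "on_grid n ((!) l) xs"
      unfolding on_grid_def
    proof safe
      fix c u v assume x: "(c, u, v) \<in> set xs"
      then have "u \<in> set l" "v \<in> set l" by (auto simp: l P_def intro!: bexI[of _ "(c, u, v)"])
      then obtain i j where ij: "i < length l" "j < length l" "u = l ! i" "v = l ! j"
        by (metis in_set_conv_nth)
      have "i \<le> j"
      proof (rule ccontr)
        assume "\<not> i \<le> j"
        then have "v < u" using ij l(2) by (auto simp: sorted_wrt_iff_nth_less)
        then show False using assms[OF x] by auto
      qed
      then show "\<exists>i j. i \<le> j \<and> j \<le> n \<and> u = l ! i \<and> v = l ! j"
        using ij by (intro exI[of _ i] exI[of _ j]) (auto simp: n_def)
    qed
  qed
qed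

lemma grid_mono:
  fixes w :: "nat \<Rightarrow> real"
  assumes w: "\<forall>i<n. w i < w (Suc i)" and "a \<le> b" "b \<le> n"
  shows "w a \<le> w b"
  using assms(2,3)
proof (induction b rule: dec_induct)
  case (step m)
  then have "w a \<le> w m" "w m < w (Suc m)" using w by auto
  then show ?case by linarith
qed simp

lemma indicator_grid:
  fixes w :: "nat \<Rightarrow> real"
  assumes w: "\<forall>i<n. w i < w (Suc i)" and "i \<le> j" "j \<le> n"
  shows "indicator {w i<..w j} s = (\<Sum>k<n. indicator {w i<..w j} (w (Suc k)) * indicator {w k<..w (Suc k)} s :: real)"
    and "f (w j) - f (w i) = (\<Sum>k<n. indicator {w i<..w j} (w (Suc k)) * (f (w (Suc k)) - f (w k)) :: real)"
proof -
  have mono: "w a \<le> w b" if "a \<le> b" "b \<le> n" for a b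
    using grid_mono[OF w that] .
  have mono': "w a < w b" if "a < b" "b \<le> n" for a b
  proof -
    have "w a < w (Suc a)" using w that by auto
    also have "\<dots> \<le> w b" using mono[of "Suc a" b] that by auto
    finally show ?thesis .
  qed
  have ind: "indicator {w i<..w j} (w (Suc k)) = (indicator {i..<j} k :: real)" if "k < n" for k
  proof -
    have "w i < w (Suc k) \<longleftrightarrow> i \<le> k"
      using mono'[of i "Suc k"] mono[of "Suc k" i] that assms by (cases "i \<le> k") auto
    moreover have "w (Suc k) \<le> w j \<longleftrightarrow> k < j"
      using mono[of "Suc k" j] mono'[of j "Suc k"] that assms by (cases "k < j") auto
    ultimately show ?thesis by (auto simp: indicator_def)
  qed
  have restrict: "(\<Sum>k<n. indicator {w i<..w j} (w (Suc k)) * g k) = (\<Sum>k=i..<j. g k)" for g :: "nat \<Rightarrow> real"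
  proof -
    have "(\<Sum>k<n. indicator {w i<..w j} (w (Suc k)) * g k) = (\<Sum>k<n. indicator {i..<j} k * g k)"
      by (rule sum.cong) (auto simp: ind)
    also have "\<dots> = (\<Sum>k\<in>{i..<j}. indicator {i..<j} k * g k)"
      using assms by (intro sum.mono_neutral_right) auto
    also have "\<dots> = (\<Sum>k=i..<j. g k)" by (rule sum.cong) auto
    finally show ?thesis .
  qed
  show "f (w j) - f (w i) = (\<Sum>k<n. indicator {w i<..w j} (w (Suc k)) * (f (w (Suc k)) - f (w k)) :: real)"
    unfolding restrict using sum_Suc_diff'[OF \<open>i \<le> j\<close>, of "\<lambda>k. f (w k)"] by simp
  have "(\<Sum>k=i..<j. indicator {w k<..w (Suc k)} s :: real) = indicator {w i<..w j} s"
    using \<open>i \<le> j\<close> \<open>j \<le> n\<close>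
  proof (induction j rule: dec_induct)
    case (step m)
    then have "w i \<le> w m" "w m \<le> w (Suc m)" using mono by auto
    then show ?case using step by (auto simp: indicator_def)
  qed simp
  then show "indicator {w i<..w j} s = (\<Sum>k<n. indicator {w i<..w j} (w (Suc k)) * indicator {w k<..w (Suc k)} s :: real)"
    unfolding restrict ..
qed

text \<open>On the cell from \<open>w k\<close> (excluded) to \<open>w (Suc k)\<close> (included) a step function on the grid has the value that it
takes at the right endpoint.\<close>

lemma step_grid:
  fixes w :: "nat \<Rightarrow> real"
  assumes w: "\<forall>i<n. w i < w (Suc i)"
    and xs: "on_grid n w xs"
  shows "step_fun xs s = (\<Sum>k<n. step_fun xs (w (Suc k)) * indicator {w k<..w (Suc k)} s)"
    and "step_ito B xs \<omega> = (\<Sum>k<n. step_fun xs (w (Suc k)) * (B (w (Suc k)) \<omega> - B (w k) \<omega>))"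
proof -
  have "step_fun xs s = (\<Sum>k<n. step_fun xs (w (Suc k)) * indicator {w k<..w (Suc k)} s) \<and>
    step_ito B xs \<omega> = (\<Sum>k<n. step_fun xs (w (Suc k)) * (B (w (Suc k)) \<omega> - B (w k) \<omega>))"
    using xs
  proof (induction xs)
    case (Cons x xs)
    obtain c u v where x: "x = (c, u, v)" by (cases x)
    from Cons.prems obtain i j where ij: "i \<le> j" "j \<le> n" "u = w i" "v = w j" by (auto simp: x on_grid_def)
    have IH: "step_fun xs s = (\<Sum>k<n. step_fun xs (w (Suc k)) * indicator {w k<..w (Suc k)} s)"
      "step_ito B xs \<omega> = (\<Sum>k<n. step_fun xs (w (Suc k)) * (B (w (Suc k)) \<omega> - B (w k) \<omega>))"
      using Cons.IH Cons.prems by (simp_all add: on_grid_def)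
    note g = indicator_grid(1)[OF w ij(1,2), of s] indicator_grid(2)[OF w ij(1,2), of "\<lambda>r. B r \<omega>"]
    show ?case
      unfolding x step_fun_Cons step_ito_Cons ij(3,4)
      by (subst g(1), subst g(2), subst IH(1), subst IH(2))
        (simp only: distrib_right sum.distrib sum_distrib_left mult.assoc simp_thms)
  qed simp
  then show "step_fun xs s = (\<Sum>k<n. step_fun xs (w (Suc k)) * indicator {w k<..w (Suc k)} s)"
    "step_ito B xs \<omega> = (\<Sum>k<n. step_fun xs (w (Suc k)) * (B (w (Suc k)) \<omega> - B (w k) \<omega>))"
    by auto
qed

lemma nn_integral_step_fun_grid:
  fixes w :: "nat \<Rightarrow> real"
  assumes w: "\<forall>i<n. w i < w (Suc i)" and t: "n = 0 \<or> 0 \<le> w 0" "n = 0 \<or> w n \<le> t"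
    and xs: "on_grid n w xs"
  shows "(\<integral>\<^sup>+s. ennreal ((step_fun xs s)\<^sup>2) \<partial>lebesgue_on {0..t})
     = ennreal (\<Sum>k<n. (step_fun xs (w (Suc k)))\<^sup>2 * (w (Suc k) - w k))"
proof -
  have mono: "w a \<le> w b" if "a \<le> b" "b \<le> n" for a b
    using grid_mono[OF w that] .
  have eq: "ennreal ((step_fun xs s)\<^sup>2) * indicator {0..t} s
      = (\<Sum>k<n. ennreal ((step_fun xs (w (Suc k)))\<^sup>2) * indicator {w k<..w (Suc k)} s)" for s
  proof (cases "\<exists>k<n. s \<in> {w k<..w (Suc k)}")
    case True
    then obtain k where k: "k < n" "s \<in> {w k<..w (Suc k)}" by auto
    have uniq: "s \<in> {w j<..w (Suc j)} \<longleftrightarrow> j = k" if "j < n" for j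
    proof
      assume j: "s \<in> {w j<..w (Suc j)}"
      show "j = k"
      proof (rule ccontr)
        assume "j \<noteq> k"
        then consider "Suc j \<le> k" | "Suc k \<le> j" by linarith
        then show False using mono[of "Suc j" k] mono[of "Suc k" j] j k that by cases auto
      qed
    qed (use k in auto)
    have "0 \<le> s" "s \<le> t" using t k mono[of 0 k] mono[of "Suc k" n] by auto
    have *: "(\<Sum>j<n. g j * indicator {w j<..w (Suc j)} s) = g k" for g :: "nat \<Rightarrow> 'c::semiring_1"
    proof -
      have "(\<Sum>j<n. g j * indicator {w j<..w (Suc j)} s) = (\<Sum>j<n. if j = k then g j else 0)"
        using uniq by (intro sum.cong) (auto simp: indicator_def)
      then show ?thesis using k by simp
    qed
    show ?thesis unfolding * using \<open>0 \<le> s\<close> \<open>s \<le> t\<close>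
      by (subst step_grid(1)[OF w xs]) (auto simp: *)
  next
    case False
    have *: "(\<Sum>k<n. g k * indicator {w k<..w (Suc k)} s) = 0" for g :: "nat \<Rightarrow> 'c::semiring_1"
      using False by (intro sum.neutral) (auto simp: indicator_def)
    have "step_fun xs s = 0"
      by (subst step_grid(1)[OF w xs]) (rule *)
    then show ?thesis unfolding * by simp
  qed
  have "(\<integral>\<^sup>+s. ennreal ((step_fun xs s)\<^sup>2) \<partial>lebesgue_on {0..t})
      = (\<integral>\<^sup>+s. (\<Sum>k<n. ennreal ((step_fun xs (w (Suc k)))\<^sup>2) * indicator {w k<..w (Suc k)} s) \<partial>lebesgue)"
    by (subst nn_integral_restrict_space) (auto simp: eq)
  also have "\<dots> = (\<Sum>k<n. ennreal ((step_fun xs (w (Suc k)))\<^sup>2) * ennreal (w (Suc k) - w k))"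
    using mono w by (subst nn_integral_sum) (auto intro!: sum.cong measurable_completion simp: nn_integral_cmult_indicator less_imp_le)
  also have "\<dots> = ennreal (\<Sum>k<n. (step_fun xs (w (Suc k)))\<^sup>2 * (w (Suc k) - w k))"
    using w by (subst sum_ennreal[symmetric]) (auto simp: less_imp_le ennreal_mult intro!: sum.cong)
  finally show ?thesis .
qed

context prob_space
begin

lemma char_centered_normal:
  assumes X: "distributed M lborel X (normal_density 0 \<sigma>)" and "0 < \<sigma>"
  shows "char (distr M borel X) r = exp (- (\<sigma>\<^sup>2 * r\<^sup>2 / 2))"
proof -
  have [measurable]: "X \<in> borel_measurable M" using distributed_measurable[OF X] by simp
  have "distributed M lborel (\<lambda>\<omega>. X \<omega> / \<sigma>) std_normal_density"
    using normal_standard_normal_convert[of \<sigma> X 0] assms by simp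
  then have "distr M lborel (\<lambda>\<omega>. X \<omega> / \<sigma>) = std_normal_distribution"
    by (rule distributed_distr_eq_density)
  then have D: "distr M borel (\<lambda>\<omega>. X \<omega> / \<sigma>) = std_normal_distribution"
    using distr_cong[of M M lborel "borel :: real measure" "\<lambda>\<omega>. X \<omega> / \<sigma>" "\<lambda>\<omega>. X \<omega> / \<sigma>"] by simp
  have "char (distr M borel X) r = char (distr M borel (\<lambda>\<omega>. X \<omega> / \<sigma>)) (\<sigma> * r)"
    using \<open>0 < \<sigma>\<close> by (simp add: char_distr_eq)
  also have "\<dots> = exp (- (\<sigma>\<^sup>2 * r\<^sup>2 / 2))"
    unfolding D char_std_normal_distribution by (simp add: power_mult_distrib)
  finally show ?thesis .
qed

text \<open>The characteristic function of a sum of independent increments is a product of Gaussian ones; the exponents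
add up to the squared norm of the step function, which is the Ito isometry for step functions.\<close>

lemma gaussian_rv_step_ito:
  assumes B: "brownian_motion M B"
    and xs: "\<And>c u v. (c, u, v) \<in> set xs \<Longrightarrow> 0 \<le> u \<and> u \<le> v \<and> v \<le> t"
  shows "gaussian_rv M (step_ito B xs) (enn2real (\<integral>\<^sup>+s. ennreal ((step_fun xs s)\<^sup>2) \<partial>lebesgue_on {0..t}))"
proof -
  obtain n w where "(n = 0 \<or> 0 \<le> w 0) \<and> (n = 0 \<or> w n \<le> t) \<and> (\<forall>i<n. w i < w (Suc i)) \<and> on_grid n w xs"
    using common_grid[of xs t] xs by blast
  then have w0: "n = 0 \<or> 0 \<le> w 0" and wt: "n = 0 \<or> w n \<le> t" and w: "\<forall>i<n. w i < w (Suc i)"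
    and g: "on_grid n w xs" by auto
  define \<gamma> where "\<gamma> k = step_fun xs (w (Suc k))" for k
  have mono: "w a \<le> w b" if "a \<le> b" "b \<le> n" for a b
    using grid_mono[OF w that] .
  have Bm0: "B r \<in> borel_measurable M" if "0 \<le> r" for r
    using B that by (auto simp: brownian_motion_def)
  have wpos: "0 \<le> w k" if "k \<le> n" "n \<noteq> 0" for k using w0 mono[of 0 k] that by auto
  have Bm: "B (w k) \<in> borel_measurable M" if "k \<le> n" "n \<noteq> 0" for k
    using Bm0[OF wpos[OF that]] .
  have ind: "indep_vars (\<lambda>_. borel) (\<lambda>i \<omega>. B (w (Suc i)) \<omega> - B (w i) \<omega>) {..<n}"
  proof (cases "n = 0")
    case False
    then have "0 \<le> w 0 \<and> (\<forall>i<n. w i < w (Suc i))" using w0 w by simp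
    then show ?thesis using B unfolding brownian_motion_def by blast
  qed (simp add: indep_vars_def indep_sets_def)
  have ind': "indep_vars (\<lambda>_. borel) (\<lambda>i \<omega>. \<gamma> i * (B (w (Suc i)) \<omega> - B (w i) \<omega>)) {..<n}"
    by (rule indep_vars_compose2[OF ind, of "\<lambda>i x. \<gamma> i * x"]) auto
  have eq: "step_ito B xs = (\<lambda>\<omega>. \<Sum>k<n. \<gamma> k * (B (w (Suc k)) \<omega> - B (w k) \<omega>))"
    unfolding \<gamma>_def by (rule ext) (rule step_grid(2)[OF w g])
  have "char (distr M borel (step_ito B xs)) r = exp (- ((\<Sum>k<n. (\<gamma> k)\<^sup>2 * (w (Suc k) - w k)) * r\<^sup>2 / 2))" for r
  proof -
    have "char (distr M borel (step_ito B xs)) r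
        = (\<Prod>k<n. char (distr M borel (\<lambda>\<omega>. \<gamma> k * (B (w (Suc k)) \<omega> - B (w k) \<omega>))) r)"
      unfolding eq by (rule char_distr_sum[OF ind'])
    also have "\<dots> = (\<Prod>k<n. exp (- ((\<gamma> k)\<^sup>2 * (w (Suc k) - w k) * r\<^sup>2 / 2)))"
    proof (subst of_real_prod, rule prod.cong[OF refl])
      fix k assume "k \<in> {..<n}"
      then have k: "k < n" by simp
      have [measurable]: "B (w k) \<in> borel_measurable M" "B (w (Suc k)) \<in> borel_measurable M"
        using k by (auto intro!: Bm)
      have D: "distributed M lborel (\<lambda>\<omega>. B (w (Suc k)) \<omega> - B (w k) \<omega>) (normal_density 0 (sqrt (w (Suc k) - w k)))"
        using B spec[OF w, of k] wpos[of k] k unfolding brownian_motion_def by fastforce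
      have "char (distr M borel (\<lambda>\<omega>. \<gamma> k * (B (w (Suc k)) \<omega> - B (w k) \<omega>))) r
          = char (distr M borel (\<lambda>\<omega>. B (w (Suc k)) \<omega> - B (w k) \<omega>)) (r * \<gamma> k)"
        by (simp add: char_distr_eq ac_simps)
      also have "\<dots> = exp (- ((\<gamma> k)\<^sup>2 * (w (Suc k) - w k) * r\<^sup>2 / 2))"
        using w k by (subst char_centered_normal[OF D]) (auto simp: power_mult_distrib ac_simps)
      finally show "char (distr M borel (\<lambda>\<omega>. \<gamma> k * (B (w (Suc k)) \<omega> - B (w k) \<omega>))) r
          = complex_of_real (exp (- ((\<gamma> k)\<^sup>2 * (w (Suc k) - w k) * r\<^sup>2 / 2)))" by simp
    qed
    also have "\<dots> = exp (- ((\<Sum>k<n. (\<gamma> k)\<^sup>2 * (w (Suc k) - w k)) * r\<^sup>2 / 2))"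
      by (simp add: exp_sum[symmetric] sum_negf sum_distrib_right sum_divide_distrib)
    finally show ?thesis .
  qed
  moreover have "0 \<le> (\<Sum>k<n. (\<gamma> k)\<^sup>2 * (w (Suc k) - w k))"
    using w by (intro sum_nonneg mult_nonneg_nonneg) (auto simp: less_imp_le)
  moreover have "step_ito B xs \<in> borel_measurable M"
    by (rule borel_measurable_step_ito) (use xs Bm0 in blast)+
  ultimately show ?thesis
    using nn_integral_step_fun_grid[OF w w0 wt g] by (simp add: gaussian_rv_def \<gamma>_def)
qed

end

section \<open>The Gaussian space spanned by a Brownian motion\<close>

text \<open>The closure in mean of the linear span of the increments of \<open>B\<close>, a space of jointly Gaussian variables.\<close>

definition brownian_space :: "'w measure \<Rightarrow> (real \<Rightarrow> 'w \<Rightarrow> real) \<Rightarrow> ('w \<Rightarrow> real) \<Rightarrow> bool" where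
  "brownian_space M B X \<longleftrightarrow> X \<in> borel_measurable M \<and>
     (\<forall>e>0. \<exists>xs. (\<forall>(c, u, v)\<in>set xs. 0 \<le> u \<and> u \<le> v) \<and>
        (\<integral>\<^sup>+\<omega>. ennreal \<bar>step_ito B xs \<omega> - X \<omega>\<bar> \<partial>M) < ennreal e)"

lemma ennreal_abs_triangle:
  fixes a b :: real
  shows "\<bar>c\<bar> \<le> \<bar>a\<bar> + \<bar>b\<bar> \<Longrightarrow> ennreal \<bar>c\<bar> \<le> ennreal \<bar>a\<bar> + ennreal \<bar>b\<bar>"
  by (metis abs_ge_zero ennreal_leI ennreal_plus)

lemma ennreal_add_less_halves:
  fixes a b :: ennreal
  shows "0 < e \<Longrightarrow> a < ennreal (e / 2) \<Longrightarrow> b < ennreal (e / 2) \<Longrightarrow> a + b < ennreal e"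
proof -
  assume "0 < e" "a < ennreal (e / 2)" "b < ennreal (e / 2)"
  then have "a + b < ennreal (e / 2) + ennreal (e / 2)" by (intro add_strict_mono)
  also have "\<dots> = ennreal e" using \<open>0 < e\<close> by (subst ennreal_plus[symmetric]) auto
  finally show ?thesis .
qed

context prob_space
begin

lemma nn_integral_abs_triangle:
  assumes [measurable]: "X \<in> borel_measurable M" "Y \<in> borel_measurable M" "Z \<in> borel_measurable M"
  shows "(\<integral>\<^sup>+\<omega>. ennreal \<bar>X \<omega> - Z \<omega>\<bar> \<partial>M)
     \<le> (\<integral>\<^sup>+\<omega>. ennreal \<bar>X \<omega> - Y \<omega>\<bar> \<partial>M) + (\<integral>\<^sup>+\<omega>. ennreal \<bar>Y \<omega> - Z \<omega>\<bar> \<partial>M)"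
proof -
  have "(\<integral>\<^sup>+\<omega>. ennreal \<bar>X \<omega> - Z \<omega>\<bar> \<partial>M) \<le> (\<integral>\<^sup>+\<omega>. ennreal \<bar>X \<omega> - Y \<omega>\<bar> + ennreal \<bar>Y \<omega> - Z \<omega>\<bar> \<partial>M)"
    by (intro nn_integral_mono ennreal_abs_triangle) linarith
  also have "\<dots> = (\<integral>\<^sup>+\<omega>. ennreal \<bar>X \<omega> - Y \<omega>\<bar> \<partial>M) + (\<integral>\<^sup>+\<omega>. ennreal \<bar>Y \<omega> - Z \<omega>\<bar> \<partial>M)"
    by (rule nn_integral_add) measurable
  finally show ?thesis .
qed

text \<open>Ito integrals are limits in mean square, whereas for the fractional integral only first moments of the
error are controlled; so the closure is taken in mean.\<close>

lemma L1_limit_of_L2_limit: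
  assumes [measurable]: "\<And>n. X n \<in> borel_measurable M" "Y \<in> borel_measurable M"
    and lim: "(\<lambda>n. \<integral>\<^sup>+\<omega>. ennreal ((X n \<omega> - Y \<omega>)\<^sup>2) \<partial>M) \<longlonglongrightarrow> 0"
  shows "(\<lambda>n. \<integral>\<^sup>+\<omega>. ennreal \<bar>X n \<omega> - Y \<omega>\<bar> \<partial>M) \<longlonglongrightarrow> 0"
proof (rule order_tendstoI)
  fix e :: ennreal assume "0 < e"
  obtain r where r: "0 < r" "ennreal r \<le> e"
  proof (cases e rule: ennreal_cases)
    case (real q)
    then show thesis using \<open>0 < e\<close> that[of q] by simp
  next
    case top
    then show thesis using that[of 1] by simp
  qed
  have "\<forall>\<^sub>F n in sequentially. (\<integral>\<^sup>+\<omega>. ennreal ((X n \<omega> - Y \<omega>)\<^sup>2) \<partial>M) < ennreal ((r/2)\<^sup>2)"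
    using r by (intro order_tendstoD[OF lim]) auto
  then show "\<forall>\<^sub>F n in sequentially. (\<integral>\<^sup>+\<omega>. ennreal \<bar>X n \<omega> - Y \<omega>\<bar> \<partial>M) < e"
  proof eventually_elim
    case (elim n)
    have "(\<integral>\<^sup>+\<omega>. ennreal \<bar>X n \<omega> - Y \<omega>\<bar> \<partial>M) \<le> ennreal (sqrt ((r/2)\<^sup>2))"
      using elim by (intro nn_integral_abs_le_sqrt) auto
    also have "\<dots> < ennreal r" using r by (auto intro!: ennreal_lessI)
    finally show ?case using r by simp
  qed
qed simp

text \<open>Finite sums are Gaussian by \<open>gaussian_rv_step_ito\<close>, and limits in mean inherit this by
\<open>gaussian_rv_limit\<close>.\<close>

lemma brownian_space_gaussian:
  assumes B: "brownian_motion M B" and X: "brownian_space M B X"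
  shows "\<exists>s. gaussian_rv M X s"
proof -
  define Q where "Q n xs \<longleftrightarrow> (\<forall>(c, u, v)\<in>set xs. 0 \<le> u \<and> u \<le> v) \<and>
      (\<integral>\<^sup>+\<omega>. ennreal \<bar>step_ito B xs \<omega> - X \<omega>\<bar> \<partial>M) < ennreal (1 / real (Suc n))" for n xs
  have "\<forall>n. \<exists>xs. Q n xs"
    using X unfolding brownian_space_def Q_def by (auto simp del: of_nat_Suc)
  then obtain xs where "\<forall>n. Q n (xs n)" by (rule choice[THEN exE])
  then have xs: "\<And>n. \<forall>(c, u, v)\<in>set (xs n). 0 \<le> u \<and> u \<le> v"
    and le: "\<And>n. (\<integral>\<^sup>+\<omega>. ennreal \<bar>step_ito B (xs n) \<omega> - X \<omega>\<bar> \<partial>M) < ennreal (1 / real (Suc n))"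
    unfolding Q_def by blast+
  have "\<exists>s. gaussian_rv M (step_ito B (xs n)) s" for n
  proof -
    define t where "t = Max (insert 0 ((\<lambda>(c, u, v). v) ` set (xs n)))"
    have "v \<le> t" if "(c, u, v) \<in> set (xs n)" for c u v
      unfolding t_def using that by (intro Max_ge) force+
    then show ?thesis using gaussian_rv_step_ito[OF B, of "xs n" t] xs[of n] by blast
  qed
  then obtain s where s: "\<And>n. gaussian_rv M (step_ito B (xs n)) (s n)" by metis
  have "(\<lambda>n. \<integral>\<^sup>+\<omega>. ennreal \<bar>step_ito B (xs n) \<omega> - X \<omega>\<bar> \<partial>M) \<longlonglongrightarrow> 0"
  proof (rule tendsto_sandwich[OF _ _ tendsto_const])
    have "(\<lambda>n. ennreal (1 / real (Suc n))) \<longlonglongrightarrow> ennreal 0"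
      by (intro tendsto_ennrealI LIMSEQ_inverse_real_of_nat[unfolded inverse_eq_divide])
    then show "(\<lambda>n. ennreal (1 / real (Suc n))) \<longlonglongrightarrow> 0" by simp
  qed (use le in \<open>auto intro!: always_eventually less_imp_le simp del: of_nat_Suc\<close>)
  from gaussian_rv_limit[OF s _ this] X show ?thesis by (auto simp: brownian_space_def)
qed

lemma brownian_space_limit:
  assumes B: "brownian_motion M B"
    and X: "\<And>n. brownian_space M B (X n)" and Y [measurable]: "Y \<in> borel_measurable M"
    and lim: "(\<lambda>n. \<integral>\<^sup>+\<omega>. ennreal \<bar>X n \<omega> - Y \<omega>\<bar> \<partial>M) \<longlonglongrightarrow> 0"
  shows "brownian_space M B Y"
  unfolding brownian_space_def
proof (intro conjI allI impI)
  fix e :: real assume e: "0 < e"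
  have [measurable]: "X n \<in> borel_measurable M" for n using X by (auto simp: brownian_space_def)
  have Bm: "B r \<in> borel_measurable M" if "0 \<le> r" for r
    using B that by (auto simp: brownian_motion_def)
  have "\<forall>\<^sub>F n in sequentially. (\<integral>\<^sup>+\<omega>. ennreal \<bar>X n \<omega> - Y \<omega>\<bar> \<partial>M) < ennreal (e / 2)"
    using e by (intro order_tendstoD[OF lim]) auto
  then obtain n where n: "(\<integral>\<^sup>+\<omega>. ennreal \<bar>X n \<omega> - Y \<omega>\<bar> \<partial>M) < ennreal (e / 2)"
    by (auto simp: eventually_sequentially)
  obtain xs where xs: "\<forall>(c, u, v)\<in>set xs. 0 \<le> u \<and> u \<le> v"
    "(\<integral>\<^sup>+\<omega>. ennreal \<bar>step_ito B xs \<omega> - X n \<omega>\<bar> \<partial>M) < ennreal (e / 2)"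
    using X[of n] e unfolding brownian_space_def by (meson half_gt_zero)
  have [measurable]: "step_ito B xs \<in> borel_measurable M"
    by (rule borel_measurable_step_ito) (use Bm xs in blast)+
  have "(\<integral>\<^sup>+\<omega>. ennreal \<bar>step_ito B xs \<omega> - Y \<omega>\<bar> \<partial>M)
      \<le> (\<integral>\<^sup>+\<omega>. ennreal \<bar>step_ito B xs \<omega> - X n \<omega>\<bar> \<partial>M) + (\<integral>\<^sup>+\<omega>. ennreal \<bar>X n \<omega> - Y \<omega>\<bar> \<partial>M)"
    by (rule nn_integral_abs_triangle) measurable
  also have "\<dots> < ennreal e" by (rule ennreal_add_less_halves[OF e xs(2) n])
  finally show "\<exists>xs. (\<forall>(c, u, v)\<in>set xs. 0 \<le> u \<and> u \<le> v) \<and>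
        (\<integral>\<^sup>+\<omega>. ennreal \<bar>step_ito B xs \<omega> - Y \<omega>\<bar> \<partial>M) < ennreal e" using xs by blast
qed simp

lemma brownian_space_add:
  assumes B: "brownian_motion M B" and X: "brownian_space M B X" and Y: "brownian_space M B Y"
  shows "brownian_space M B (\<lambda>\<omega>. X \<omega> + Y \<omega>)"
  unfolding brownian_space_def
proof (intro conjI allI impI)
  have [measurable]: "X \<in> borel_measurable M" "Y \<in> borel_measurable M"
    using X Y by (auto simp: brownian_space_def)
  have Bm: "B r \<in> borel_measurable M" if "0 \<le> r" for r
    using B that by (auto simp: brownian_motion_def)
  show "(\<lambda>\<omega>. X \<omega> + Y \<omega>) \<in> borel_measurable M" by measurable
  fix e :: real assume e: "0 < e"
  obtain xs where xs: "\<forall>(c, u, v)\<in>set xs. 0 \<le> u \<and> u \<le> v"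
    "(\<integral>\<^sup>+\<omega>. ennreal \<bar>step_ito B xs \<omega> - X \<omega>\<bar> \<partial>M) < ennreal (e / 2)"
    using X e unfolding brownian_space_def by (meson half_gt_zero)
  obtain ys where ys: "\<forall>(c, u, v)\<in>set ys. 0 \<le> u \<and> u \<le> v"
    "(\<integral>\<^sup>+\<omega>. ennreal \<bar>step_ito B ys \<omega> - Y \<omega>\<bar> \<partial>M) < ennreal (e / 2)"
    using Y e unfolding brownian_space_def by (meson half_gt_zero)
  have [measurable]: "step_ito B xs \<in> borel_measurable M" "step_ito B ys \<in> borel_measurable M"
    by (rule borel_measurable_step_ito; use Bm xs ys in blast)+
  have "(\<integral>\<^sup>+\<omega>. ennreal \<bar>step_ito B (xs @ ys) \<omega> - (X \<omega> + Y \<omega>)\<bar> \<partial>M)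
      \<le> (\<integral>\<^sup>+\<omega>. ennreal \<bar>step_ito B xs \<omega> - X \<omega>\<bar> + ennreal \<bar>step_ito B ys \<omega> - Y \<omega>\<bar> \<partial>M)"
    by (intro nn_integral_mono ennreal_abs_triangle) (unfold step_ito_append, linarith)
  also have "\<dots> = (\<integral>\<^sup>+\<omega>. ennreal \<bar>step_ito B xs \<omega> - X \<omega>\<bar> \<partial>M) + (\<integral>\<^sup>+\<omega>. ennreal \<bar>step_ito B ys \<omega> - Y \<omega>\<bar> \<partial>M)"
    by (rule nn_integral_add) measurable
  also have "\<dots> < ennreal e" by (rule ennreal_add_less_halves[OF e xs(2) ys(2)])
  finally have "(\<integral>\<^sup>+\<omega>. ennreal \<bar>step_ito B (xs @ ys) \<omega> - (X \<omega> + Y \<omega>)\<bar> \<partial>M) < ennreal e" .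
  moreover have "\<forall>(c, u, v)\<in>set (xs @ ys). 0 \<le> u \<and> u \<le> v" using xs ys by auto
  ultimately show "\<exists>xs. (\<forall>(c, u, v)\<in>set xs. 0 \<le> u \<and> u \<le> v) \<and>
        (\<integral>\<^sup>+\<omega>. ennreal \<bar>step_ito B xs \<omega> - (X \<omega> + Y \<omega>)\<bar> \<partial>M) < ennreal e" by blast
qed

lemma brownian_space_scale:
  assumes B: "brownian_motion M B" and X: "brownian_space M B X"
  shows "brownian_space M B (\<lambda>\<omega>. k * X \<omega>)"
  unfolding brownian_space_def
proof (intro conjI allI impI)
  have [measurable]: "X \<in> borel_measurable M"
    using X by (auto simp: brownian_space_def)
  have Bm: "B r \<in> borel_measurable M" if "0 \<le> r" for r
    using B that by (auto simp: brownian_motion_def)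
  show "(\<lambda>\<omega>. k * X \<omega>) \<in> borel_measurable M" by measurable
  fix e :: real assume e: "0 < e"
  define d where "d = e / (\<bar>k\<bar> + 1)"
  have d: "0 < d" "\<bar>k\<bar> * d < e" using e by (auto simp: d_def field_simps)
  obtain xs where xs: "\<forall>(c, u, v)\<in>set xs. 0 \<le> u \<and> u \<le> v"
    "(\<integral>\<^sup>+\<omega>. ennreal \<bar>step_ito B xs \<omega> - X \<omega>\<bar> \<partial>M) < ennreal d"
    using X d(1) unfolding brownian_space_def by meson
  have [measurable]: "step_ito B xs \<in> borel_measurable M"
    by (rule borel_measurable_step_ito; use Bm xs in blast)
  let ?ys = "map (\<lambda>(c, u, v). (k * c, u, v)) xs"
  have "(\<integral>\<^sup>+\<omega>. ennreal \<bar>step_ito B ?ys \<omega> - k * X \<omega>\<bar> \<partial>M)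
      = (\<integral>\<^sup>+\<omega>. ennreal \<bar>k\<bar> * ennreal \<bar>step_ito B xs \<omega> - X \<omega>\<bar> \<partial>M)"
    unfolding step_ito_scale right_diff_distrib[symmetric] abs_mult
    by (simp add: ennreal_mult)
  also have "\<dots> = ennreal \<bar>k\<bar> * (\<integral>\<^sup>+\<omega>. ennreal \<bar>step_ito B xs \<omega> - X \<omega>\<bar> \<partial>M)"
    by (rule nn_integral_cmult) measurable
  also have "\<dots> \<le> ennreal \<bar>k\<bar> * ennreal d" using xs(2) by (intro mult_left_mono) auto
  also have "\<dots> < ennreal e" using d e by (subst ennreal_mult[symmetric]) (auto intro!: ennreal_lessI)
  finally have "(\<integral>\<^sup>+\<omega>. ennreal \<bar>step_ito B ?ys \<omega> - k * X \<omega>\<bar> \<partial>M) < ennreal e" .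
  moreover have "\<forall>(c, u, v)\<in>set ?ys. 0 \<le> u \<and> u \<le> v" using xs by fastforce
  ultimately show "\<exists>xs. (\<forall>(c, u, v)\<in>set xs. 0 \<le> u \<and> u \<le> v) \<and>
        (\<integral>\<^sup>+\<omega>. ennreal \<bar>step_ito B xs \<omega> - k * X \<omega>\<bar> \<partial>M) < ennreal e" by blast
qed

lemma brownian_space_zero: "brownian_space M B (\<lambda>_. 0)"
  by (auto simp: brownian_space_def intro!: exI[of _ "[]"])

lemma brownian_space_sum:
  assumes "brownian_motion M B" and "finite I" "\<And>i. i \<in> I \<Longrightarrow> brownian_space M B (X i)"
  shows "brownian_space M B (\<lambda>\<omega>. \<Sum>i\<in>I. X i \<omega>)"
  using assms(2,3) by (induction I rule: finite_induct) (auto intro: brownian_space_zero brownian_space_add assms(1))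

lemma ito_integral_L1_limit:
  assumes B: "brownian_motion M B" and I: "has_ito_integral M B t f I"
  shows "\<exists>xs. (\<forall>n. \<forall>(c, u, v)\<in>set (xs n). 0 \<le> u \<and> u \<le> v \<and> v \<le> t) \<and>
    (\<lambda>n. \<integral>\<^sup>+s. ennreal ((step_fun (xs n) s - f s)\<^sup>2) \<partial>lebesgue_on {0..t}) \<longlonglongrightarrow> 0 \<and>
    (\<lambda>n. \<integral>\<^sup>+\<omega>. ennreal \<bar>step_ito B (xs n) \<omega> - I \<omega>\<bar> \<partial>M) \<longlonglongrightarrow> 0"
proof -
  obtain xs where xs: "\<forall>n. \<forall>(c, u, v)\<in>set (xs n). 0 \<le> u \<and> u \<le> v \<and> v \<le> t"
    and f: "(\<lambda>n. \<integral>\<^sup>+s. ennreal ((step_fun (xs n) s - f s)\<^sup>2) \<partial>lebesgue_on {0..t}) \<longlonglongrightarrow> 0"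
    and L: "(\<lambda>n. \<integral>\<^sup>+\<omega>. ennreal ((step_ito B (xs n) \<omega> - I \<omega>)\<^sup>2) \<partial>M) \<longlonglongrightarrow> 0"
    and [measurable]: "I \<in> borel_measurable M"
    using I unfolding has_ito_integral_def by blast
  have Bm: "B r \<in> borel_measurable M" if "0 \<le> r" for r
    using B that by (auto simp: brownian_motion_def)
  have xs': "0 \<le> u \<and> u \<le> v \<and> v \<le> t" if "(c, u, v) \<in> set (xs n)" for n c u v
    using bspec[OF spec[OF xs, of n] that] by simp
  have "step_ito B (xs n) \<in> borel_measurable M" for n
    by (rule borel_measurable_step_ito) (auto intro: Bm dest: xs')
  from L1_limit_of_L2_limit[OF this _ L] show ?thesis
    using xs f by (intro exI[of _ xs]) simp
qed

lemma ito_integral_brownian_space: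
  assumes B: "brownian_motion M B" and I: "has_ito_integral M B t f I"
  shows "brownian_space M B I"
proof -
  obtain xs where xs: "\<forall>n. \<forall>(c, u, v)\<in>set (xs n). 0 \<le> u \<and> u \<le> v \<and> v \<le> t"
    and "(\<lambda>n. \<integral>\<^sup>+s. ennreal ((step_fun (xs n) s - f s)\<^sup>2) \<partial>lebesgue_on {0..t}) \<longlonglongrightarrow> 0"
    and L: "(\<lambda>n. \<integral>\<^sup>+\<omega>. ennreal \<bar>step_ito B (xs n) \<omega> - I \<omega>\<bar> \<partial>M) \<longlonglongrightarrow> 0"
    using ito_integral_L1_limit[OF B I] by blast
  have xs': "0 \<le> u \<and> u \<le> v \<and> v \<le> t" if "(c, u, v) \<in> set (xs n)" for n c u v
    using bspec[OF spec[OF xs, of n] that] by simp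
  show ?thesis
    unfolding brownian_space_def
  proof (intro conjI allI impI)
    show "I \<in> borel_measurable M" using I by (auto simp: has_ito_integral_def)
    fix e :: real assume "0 < e"
    then have "\<forall>\<^sub>F n in sequentially. (\<integral>\<^sup>+\<omega>. ennreal \<bar>step_ito B (xs n) \<omega> - I \<omega>\<bar> \<partial>M) < ennreal e"
      by (intro order_tendstoD[OF L]) auto
    then obtain n where "(\<integral>\<^sup>+\<omega>. ennreal \<bar>step_ito B (xs n) \<omega> - I \<omega>\<bar> \<partial>M) < ennreal e"
      by (auto simp: eventually_sequentially)
    then show "\<exists>xs. (\<forall>(c, u, v)\<in>set xs. 0 \<le> u \<and> u \<le> v) \<and>
        (\<integral>\<^sup>+\<omega>. ennreal \<bar>step_ito B xs \<omega> - I \<omega>\<bar> \<partial>M) < ennreal e"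
      using xs' by (intro exI[of _ "xs n"] conjI ballI) auto
  qed
qed

text \<open>The variances of the approximating step integrals are the squared norms of the step functions, and these
converge to the squared norm of \<open>f\<close>.\<close>

lemma ito_integral_variance_le:
  assumes B: "brownian_motion M B" and I: "has_ito_integral M B t f I"
    and f: "integrable (lebesgue_on {0..t}) (\<lambda>s. (f s)\<^sup>2)"
    and X: "gaussian_rv M I s"
  shows "s \<le> (LINT r|lebesgue_on {0..t}. (f r)\<^sup>2)"
proof -
  let ?L = "lebesgue_on {0..t}"
  let ?V = "LINT r|?L. (f r)\<^sup>2"
  obtain xs where xs: "\<forall>n. \<forall>(c, u, v)\<in>set (xs n). 0 \<le> u \<and> u \<le> v \<and> v \<le> t"
    and F: "(\<lambda>n. \<integral>\<^sup>+s. ennreal ((step_fun (xs n) s - f s)\<^sup>2) \<partial>?L) \<longlonglongrightarrow> 0"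
    and L: "(\<lambda>n. \<integral>\<^sup>+\<omega>. ennreal \<bar>step_ito B (xs n) \<omega> - I \<omega>\<bar> \<partial>M) \<longlonglongrightarrow> 0"
    using ito_integral_L1_limit[OF B I] by blast
  have xs': "0 \<le> u \<and> u \<le> v \<and> v \<le> t" if "(c, u, v) \<in> set (xs n)" for n c u v
    using bspec[OF spec[OF xs, of n] that] by simp
  have fm [measurable]: "f \<in> borel_measurable ?L" and Im: "I \<in> borel_measurable M"
    using I by (auto simp: has_ito_integral_def)
  have sm [measurable]: "step_fun ys \<in> borel_measurable ?L" for ys
    by (intro measurable_restrict_space1 measurable_completion) simp
  define v where "v n = enn2real (\<integral>\<^sup>+s. ennreal ((step_fun (xs n) s)\<^sup>2) \<partial>?L)" for n
  have g: "gaussian_rv M (step_ito B (xs n)) (v n)" for n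
    unfolding v_def by (rule gaussian_rv_step_ito[OF B xs'])
  obtain w where w: "v \<longlonglongrightarrow> w" "gaussian_rv M I w"
    using gaussian_rv_limit[OF g Im L] by blast
  have "ennreal w = ennreal s"
    using gaussian_rv_second_moment[OF w(2)] gaussian_rv_second_moment[OF X] by simp
  then have "w = s" using w(2) X by (simp add: gaussian_rv_def)
  \<comment> \<open>the square of a sum is split with a weight \<open>\<delta>\<close>, which tends to \<open>0\<close> afterwards\<close>
  have "w \<le> (1 + \<delta>) * ?V" if \<delta>: "0 < \<delta>" for \<delta>
  proof -
    have sq: "(x + y)\<^sup>2 \<le> (1 + 1 / \<delta>) * x\<^sup>2 + (1 + \<delta>) * y\<^sup>2" for x y :: real
    proof -
      have "0 \<le> (x - \<delta> * y)\<^sup>2 / \<delta>" using \<delta> by simp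
      then show ?thesis using \<delta> by (simp add: power2_eq_square field_simps)
    qed
    have le: "ennreal (v n) \<le> ennreal (1 + 1 / \<delta>) * (\<integral>\<^sup>+s. ennreal ((step_fun (xs n) s - f s)\<^sup>2) \<partial>?L)
        + ennreal ((1 + \<delta>) * ?V)" for n
    proof -
      have "ennreal (v n) \<le> (\<integral>\<^sup>+s. ennreal ((step_fun (xs n) s)\<^sup>2) \<partial>?L)"
        unfolding v_def by (simp add: ennreal_enn2real_if)
      also have "\<dots> \<le> (\<integral>\<^sup>+s. ennreal (1 + 1 / \<delta>) * ennreal ((step_fun (xs n) s - f s)\<^sup>2)
          + ennreal (1 + \<delta>) * ennreal ((f s)\<^sup>2) \<partial>?L)"
      proof (intro nn_integral_mono)
        fix s
        show "ennreal ((step_fun (xs n) s)\<^sup>2) \<le> ennreal (1 + 1 / \<delta>) * ennreal ((step_fun (xs n) s - f s)\<^sup>2)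
          + ennreal (1 + \<delta>) * ennreal ((f s)\<^sup>2)"
          using sq[of "step_fun (xs n) s - f s" "f s"] \<delta>
          by (simp flip: ennreal_mult ennreal_plus)
      qed
      also have "\<dots> = ennreal (1 + 1 / \<delta>) * (\<integral>\<^sup>+s. ennreal ((step_fun (xs n) s - f s)\<^sup>2) \<partial>?L)
          + ennreal (1 + \<delta>) * (\<integral>\<^sup>+s. ennreal ((f s)\<^sup>2) \<partial>?L)"
        by (subst nn_integral_add; (subst nn_integral_cmult)?) (auto simp: nn_integral_cmult)
      also have "(\<integral>\<^sup>+s. ennreal ((f s)\<^sup>2) \<partial>?L) = ennreal ?V"
        using f by (intro nn_integral_eq_integral) auto
      finally show ?thesis using \<delta> by (simp add: ennreal_mult)
    qed
    have "(\<lambda>n. ennreal (1 + 1 / \<delta>) * (\<integral>\<^sup>+s. ennreal ((step_fun (xs n) s - f s)\<^sup>2) \<partial>?L)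
        + ennreal ((1 + \<delta>) * ?V)) \<longlonglongrightarrow> ennreal (1 + 1 / \<delta>) * 0 + ennreal ((1 + \<delta>) * ?V)"
      by (intro tendsto_add tendsto_const ennreal_tendsto_cmult F) auto
    then have "ennreal w \<le> ennreal (1 + 1 / \<delta>) * 0 + ennreal ((1 + \<delta>) * ?V)"
      by (rule LIMSEQ_le[OF tendsto_ennrealI[OF w(1)]]) (use le in auto)
    then show ?thesis using \<delta> by (simp add: ennreal_le_iff)
  qed
  then have "w \<le> ?V + e" if "0 < e" for e
  proof -
    have V: "0 \<le> ?V" by simp
    have "0 < e / (?V + 1)" using that V by (intro divide_pos_pos) linarith+
    then have "w \<le> (1 + e / (?V + 1)) * ?V" by (rule \<open>\<And>\<delta>. 0 < \<delta> \<Longrightarrow> w \<le> (1 + \<delta>) * ?V\<close>)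
    also have "\<dots> \<le> ?V + e"
    proof -
      have "(1 + e / (v + 1)) * v \<le> v + e" if "0 \<le> v" for v
        using that \<open>0 < e\<close> by (simp add: field_simps)
      then show ?thesis using V .
    qed
    finally show ?thesis .
  qed
  then show ?thesis unfolding \<open>w = s\<close> by (rule field_le_epsilon)
qed

end

section \<open>Piecewise linear interpolation\<close>

text \<open>Composition with \<open>clamp_to t\<close> extends a function on \<open>[0,t]\<close> by constants to the whole line.\<close>

definition clamp_to :: "real \<Rightarrow> real \<Rightarrow> real" where
  "clamp_to t x = max 0 (min t x)"

definition node :: "real \<Rightarrow> nat \<Rightarrow> nat \<Rightarrow> real" where
  "node t n i = real i * (t / real n)"

text \<open>The continuous function that is \<open>0\<close> before the cell with number \<open>i\<close>, \<open>1\<close> after it and linear on it,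
written as a difference of two positive parts because those have explicit fractional derivatives.\<close>

definition ramp :: "real \<Rightarrow> nat \<Rightarrow> nat \<Rightarrow> real \<Rightarrow> real" where
  "ramp t n i x = (max 0 (x - node t n i) - max 0 (x - node t n (Suc i))) / (t / real n)"

text \<open>The piecewise linear interpolation of \<open>f\<close> at the nodes, constant outside \<open>[0,t]\<close>.\<close>

definition interp :: "real \<Rightarrow> nat \<Rightarrow> (real \<Rightarrow> real) \<Rightarrow> real \<Rightarrow> real" where
  "interp t n f x = f 0 + (\<Sum>i<n. (f (node t n (Suc i)) - f (node t n i)) * ramp t n i x)"

lemma node_mono: "0 \<le> t \<Longrightarrow> i \<le> j \<Longrightarrow> node t n i \<le> node t n j"
  unfolding node_def by (intro mult_right_mono) auto

lemma node_0 [simp]: "node t n 0 = 0" by (simp add: node_def)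
lemma node_end [simp]: "0 < n \<Longrightarrow> node t n n = t" by (simp add: node_def)
lemma node_Suc: "node t n (Suc i) = node t n i + t / real n" by (simp add: node_def field_simps add_divide_distrib)
lemma node_in: "0 \<le> t \<Longrightarrow> 0 < n \<Longrightarrow> i \<le> n \<Longrightarrow> 0 \<le> node t n i \<and> node t n i \<le> t"
  using node_mono[of t 0 i n] node_mono[of t i n n] by simp

lemma clamp_to_in: "0 \<le> t \<Longrightarrow> clamp_to t x \<in> {0..t}" by (auto simp: clamp_to_def)
lemma clamp_to_id: "x \<in> {0..t} \<Longrightarrow> clamp_to t x = x" by (auto simp: clamp_to_def)
lemma clamp_to_dist: "\<bar>clamp_to t x - clamp_to t y\<bar> \<le> \<bar>x - y\<bar>" by (auto simp: clamp_to_def)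
lemma clamp_to_dist_t: "0 \<le> t \<Longrightarrow> \<bar>clamp_to t x - clamp_to t y\<bar> \<le> t" by (auto simp: clamp_to_def)

lemma borel_measurable_ramp [measurable]: "ramp t n i \<in> borel_measurable borel"
  unfolding ramp_def[abs_def] by measurable

lemma borel_measurable_interp [measurable]: "interp t n f \<in> borel_measurable borel"
  unfolding interp_def[abs_def] by measurable

lemma ramp_clamp:
  assumes "0 \<le> t" "i < n"
  shows "ramp t n i x = ramp t n i (clamp_to t x)"
proof -
  have "0 \<le> node t n i" "node t n i \<le> node t n (Suc i)" "node t n (Suc i) \<le> t"
    using node_in[of t n i] node_in[of t n "Suc i"] node_mono[of t i "Suc i" n] assms by auto
  then have "max 0 (x - node t n i) - max 0 (x - node t n (Suc i))
     = max 0 (clamp_to t x - node t n i) - max 0 (clamp_to t x - node t n (Suc i))"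
    by (auto simp: clamp_to_def max_def min_def)
  then show ?thesis by (simp add: ramp_def)
qed

lemma interp_clamp: "0 \<le> t \<Longrightarrow> interp t n f x = interp t n f (clamp_to t x)"
proof -
  assume "0 \<le> t"
  then have "(\<Sum>i<n. (f (node t n (Suc i)) - f (node t n i)) * ramp t n i x)
    = (\<Sum>i<n. (f (node t n (Suc i)) - f (node t n i)) * ramp t n i (clamp_to t x))"
    by (intro sum.cong[OF refl] arg_cong2[where f="(*)", OF refl] ramp_clamp) auto
  then show ?thesis by (simp only: interp_def)
qed

lemma interp_cell:
  assumes t: "0 < t" and n: "0 < n" and x: "x \<in> {0..t}"
  shows "\<exists>i \<theta>. i < n \<and> 0 \<le> \<theta> \<and> \<theta> \<le> 1 \<and> x = node t n i + \<theta> * (t / real n) \<and>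
    (\<forall>f. interp t n f x = f (node t n i) + \<theta> * (f (node t n (Suc i)) - f (node t n i)))"
proof -
  define d where "d = t / real n"
  have d: "0 < d" using t n by (simp add: d_def)
  define i where "i = min (n - 1) (nat \<lfloor>x / d\<rfloor>)"
  define \<theta> where "\<theta> = x / d - real i"
  have xd: "0 \<le> x / d" using x d by auto
  have "i < n" using n by (auto simp: i_def)
  have "real i \<le> x / d" using xd by (simp add: i_def) linarith
  moreover have "x / d \<le> real (Suc i)"
  proof (cases "nat \<lfloor>x / d\<rfloor> \<le> n - 1")
    case True
    then show ?thesis using xd by (simp add: i_def min_def) linarith
  next
    case False
    then have "Suc i = n" using n by (simp add: i_def)
    moreover have "x / d \<le> real n" using x t n by (simp add: d_def field_simps)
    ultimately show ?thesis by simp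
  qed
  ultimately have \<theta>: "0 \<le> \<theta>" "\<theta> \<le> 1" by (auto simp: \<theta>_def)
  have xeq: "x = node t n i + \<theta> * d"
    using d by (simp add: \<theta>_def node_def field_simps flip: d_def)
  have nS: "node t n (Suc j) = node t n j + d" for j by (simp add: node_Suc d_def)
  have nm: "j \<le> k \<Longrightarrow> node t n j \<le> node t n k" for j k using t by (simp add: node_mono)
  have \<theta>d: "0 \<le> \<theta> * d" "\<theta> * d \<le> d" using \<theta> d by auto
  have r1: "ramp t n j x = 1" if "j < i" for j
    using nm[of "Suc j" i] that \<theta>d d by (simp add: ramp_def xeq nS flip: d_def)
  have r2: "ramp t n i x = \<theta>"
    using \<theta>d d by (simp add: ramp_def xeq nS flip: d_def)
  have r3: "ramp t n j x = 0" if "i < j" for j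
  proof -
    have "x \<le> node t n j" using nm[of "Suc i" j] that \<theta>d(2) nS[of i] xeq by linarith
    then show ?thesis using d by (simp add: ramp_def nS max_def flip: d_def)
  qed
  have "interp t n f x = f (node t n i) + \<theta> * (f (node t n (Suc i)) - f (node t n i))" for f
  proof -
    let ?g = "\<lambda>j. (f (node t n (Suc j)) - f (node t n j)) * ramp t n j x"
    have "(\<Sum>j<n. ?g j) = (\<Sum>j<Suc i. ?g j)"
      using \<open>i < n\<close> r3 by (intro sum.mono_neutral_right) auto
    also have "\<dots> = (\<Sum>j<i. f (node t n (Suc j)) - f (node t n j)) + ?g i"
      using r1 by simp
    also have "(\<Sum>j<i. f (node t n (Suc j)) - f (node t n j)) = f (node t n i) - f 0"
      by (subst sum_lessThan_telescope) simp
    finally show ?thesis by (simp add: interp_def r2 mult.commute)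
  qed
  then show ?thesis using \<open>i < n\<close> \<theta> xeq by (auto simp: d_def)
qed

text \<open>An increment of the interpolation splits into a partial cell, a run of whole cells and another partial
cell.  The coefficients and points do not depend on \<open>f\<close>, so the splitting can be used for all paths of a
process at once.\<close>

lemma interp_increment:
  assumes t: "0 < t" and n: "0 < n" and x: "x \<in> {0..t}" and y: "y \<in> {0..t}" and "x \<le> y"
  shows "\<exists>p u u' v v' q w w'. 0 \<le> p \<and> p \<le> 1 \<and> 0 \<le> q \<and> q \<le> 1 \<and> {u, u', v, v', w, w'} \<subseteq> {0..t} \<and>
    p * \<bar>u - u'\<bar> \<le> y - x \<and> \<bar>v - v'\<bar> \<le> y - x \<and> q * \<bar>w - w'\<bar> \<le> y - x \<and>
    (\<forall>f. interp t n f y - interp t n f x = p * (f u - f u') + (f v - f v') + q * (f w - f w'))"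
proof (cases "x = y")
  case True
  then show ?thesis using t by - (rule exI[of _ "0"], rule exI[of _ "0"], rule exI[of _ "0"],
    rule exI[of _ "0"], rule exI[of _ "0"], rule exI[of _ "0"], rule exI[of _ "0"],
    rule exI[of _ "0"], simp)
next
  case False
  define d where "d = t / real n"
  have d: "0 < d" using t n by (simp add: d_def)
  obtain i \<theta> where i: "i < n" "0 \<le> \<theta>" "\<theta> \<le> 1" "x = node t n i + \<theta> * d"
    and ix: "\<And>f. interp t n f x = f (node t n i) + \<theta> * (f (node t n (Suc i)) - f (node t n i))"
    using interp_cell[OF t n x] unfolding d_def by blast
  obtain j \<eta> where j: "j < n" "0 \<le> \<eta>" "\<eta> \<le> 1" "y = node t n j + \<eta> * d"
    and jy: "\<And>f. interp t n f y = f (node t n j) + \<eta> * (f (node t n (Suc j)) - f (node t n j))"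
    using interp_cell[OF t n y] unfolding d_def by blast
  have nS: "node t n (Suc j) = node t n j + d" for j by (simp add: node_Suc d_def)
  have nm: "j \<le> k \<Longrightarrow> node t n j \<le> node t n k" for j k using t by (simp add: node_mono)
  have nin: "j \<le> n \<Longrightarrow> node t n j \<in> {0..t}" for j using node_in[of t n j] t n by auto
  have \<theta>d: "0 \<le> \<theta> * d" "\<theta> * d \<le> d" "0 \<le> \<eta> * d" "\<eta> * d \<le> d" using i j d by auto
  have "i \<le> j"
  proof (rule ccontr)
    assume "\<not> i \<le> j"
    then have "node t n (Suc j) \<le> node t n i" by (intro nm) auto
    then show False using \<theta>d i(4) j(4) nS[of j] \<open>x \<le> y\<close> False by simp
  qed
  show ?thesis
  proof (cases "i = j")
    case True
    have "\<theta> * d \<le> \<eta> * d" using True i j \<open>x \<le> y\<close> by simp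
    then have "\<theta> \<le> \<eta>" using d by simp
    have "(\<eta> - \<theta>) * d \<le> y - x" using True i j by (simp add: algebra_simps)
    then have *: "(\<eta> - \<theta>) * \<bar>node t n (Suc i) - node t n i\<bar> \<le> y - x" using d by (simp add: nS)
    have "interp t n f y - interp t n f x
        = (\<eta> - \<theta>) * (f (node t n (Suc i)) - f (node t n i)) + (f 0 - f 0) + 0 * (f 0 - f 0)" for f
      unfolding ix jy True by (simp add: algebra_simps)
    then show ?thesis using * \<open>\<theta> \<le> \<eta>\<close> i(1-3) j(1-3) nin[of i] nin[of "Suc i"] t \<open>x \<le> y\<close>
      by - (rule exI[of _ "\<eta> - \<theta>"], rule exI[of _ "node t n (Suc i)"], rule exI[of _ "node t n i"],
        rule exI[of _ "0"], rule exI[of _ "0"], rule exI[of _ "0"], rule exI[of _ "0"],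
        rule exI[of _ "0"], simp)
  next
    case False
    then have ij: "node t n (Suc i) \<le> node t n j" using \<open>i \<le> j\<close> by (intro nm) auto
    have "(1 - \<theta>) * \<bar>node t n (Suc i) - node t n i\<bar> = d - \<theta> * d"
      "\<eta> * \<bar>node t n (Suc j) - node t n j\<bar> = \<eta> * d"
      using d by (simp_all add: nS left_diff_distrib)
    then have 1: "(1 - \<theta>) * \<bar>node t n (Suc i) - node t n i\<bar> \<le> y - x"
      and 2: "\<bar>node t n j - node t n (Suc i)\<bar> \<le> y - x"
      and 3: "\<eta> * \<bar>node t n (Suc j) - node t n j\<bar> \<le> y - x"
      using ij \<theta>d i(4) j(4) nS[of i] by linarith+
    have "interp t n f y - interp t n f x = (1 - \<theta>) * (f (node t n (Suc i)) - f (node t n i))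
        + (f (node t n j) - f (node t n (Suc i))) + \<eta> * (f (node t n (Suc j)) - f (node t n j))" for f
      unfolding ix jy by (simp add: algebra_simps)
    then show ?thesis using 1 2 3 i(1-3) j(1-3) nin[of i] nin[of j] nin[of "Suc i"] nin[of "Suc j"]
      by - (rule exI[of _ "1 - \<theta>"], rule exI[of _ "node t n (Suc i)"], rule exI[of _ "node t n i"],
        rule exI[of _ "node t n j"], rule exI[of _ "node t n (Suc i)"], rule exI[of _ "\<eta>"],
        rule exI[of _ "node t n (Suc j)"], rule exI[of _ "node t n j"], simp)
  qed
qed

text \<open>A fraction \<open>p\<close> of a cell of length \<open>r\<close> contributes \<open>p\<close> times the increment over the cell; since
\<open>p \<le> p powr \<gamma>\<close>, linear interpolation does not spoil a Hoelder modulus.\<close>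

lemma scaled_powr_le:
  assumes "0 \<le> p" "p \<le> 1" "p * r \<le> s" "0 \<le> r" "0 < \<gamma>" "\<gamma> \<le> (1::real)"
  shows "p * r powr \<gamma> \<le> s powr \<gamma>"
proof (cases "p = 0")
  case False
  then have "p powr 1 \<le> p powr \<gamma>" using assms by (intro powr_mono') auto
  then have "p * r powr \<gamma> \<le> p powr \<gamma> * r powr \<gamma>" using assms by (intro mult_right_mono) auto
  also have "\<dots> = (p * r) powr \<gamma>" using assms by (simp add: powr_mult)
  also have "\<dots> \<le> s powr \<gamma>" using assms by (intro powr_mono2) auto
  finally show ?thesis .
qed simp

text \<open>Interpolation preserves a modulus of continuity in mean up to the factor \<open>3\<close>, one for each of the three pieces of
\<open>interp_increment\<close>, uniformly in the grid.\<close>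

lemma nn_integral_interp_increment:
  fixes f :: "real \<Rightarrow> 'w \<Rightarrow> real"
  assumes t: "0 < t" and n: "0 < n" and \<gamma>: "0 < \<gamma>" "\<gamma> \<le> 1" and c: "0 \<le> c"
    and [measurable]: "\<And>u. u \<in> {0..t} \<Longrightarrow> f u \<in> borel_measurable M"
    and f: "\<And>u v. u \<in> {0..t} \<Longrightarrow> v \<in> {0..t} \<Longrightarrow> (\<integral>\<^sup>+\<omega>. ennreal \<bar>f u \<omega> - f v \<omega>\<bar> \<partial>M) \<le> ennreal (c * \<bar>u - v\<bar> powr \<gamma>)"
  shows "(\<integral>\<^sup>+\<omega>. ennreal \<bar>interp t n (\<lambda>s. f s \<omega>) x - interp t n (\<lambda>s. f s \<omega>) y\<bar> \<partial>M)
     \<le> ennreal (3 * c * \<bar>clamp_to t x - clamp_to t y\<bar> powr \<gamma>)"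
proof -
  have main: "(\<integral>\<^sup>+\<omega>. ennreal \<bar>interp t n (\<lambda>s. f s \<omega>) y - interp t n (\<lambda>s. f s \<omega>) x\<bar> \<partial>M)
     \<le> ennreal (3 * c * (y - x) powr \<gamma>)" if x: "x \<in> {0..t}" and y: "y \<in> {0..t}" and "x \<le> y" for x y
  proof -
    obtain p u u' v v' q w w' where pq: "0 \<le> p" "p \<le> 1" "0 \<le> q" "q \<le> 1"
      and in_t: "{u, u', v, v', w, w'} \<subseteq> {0..t}"
      and le: "p * \<bar>u - u'\<bar> \<le> y - x" "\<bar>v - v'\<bar> \<le> y - x" "q * \<bar>w - w'\<bar> \<le> y - x"
      and eq: "\<forall>f. interp t n f y - interp t n f x = p * (f u - f u') + (f v - f v') + q * (f w - f w')"
      using interp_increment[OF t n x y \<open>x \<le> y\<close>] by (elim exE conjE) (rule that)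
    have [measurable]: "f u \<in> borel_measurable M" "f u' \<in> borel_measurable M" "f v \<in> borel_measurable M"
      "f v' \<in> borel_measurable M" "f w \<in> borel_measurable M" "f w' \<in> borel_measurable M"
      using in_t by auto
    have piece: "(\<integral>\<^sup>+\<omega>. ennreal (r * \<bar>f a \<omega> - f b \<omega>\<bar>) \<partial>M) \<le> ennreal (c * (y - x) powr \<gamma>)"
      if "0 \<le> r" "r \<le> 1" "r * \<bar>a - b\<bar> \<le> y - x" "a \<in> {0..t}" "b \<in> {0..t}" for r a b
    proof -
      have [measurable]: "f a \<in> borel_measurable M" "f b \<in> borel_measurable M" using that by auto
      have "(\<integral>\<^sup>+\<omega>. ennreal (r * \<bar>f a \<omega> - f b \<omega>\<bar>) \<partial>M) = ennreal r * (\<integral>\<^sup>+\<omega>. ennreal \<bar>f a \<omega> - f b \<omega>\<bar> \<partial>M)"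
        using that by (simp add: ennreal_mult nn_integral_cmult)
      also have "\<dots> \<le> ennreal r * ennreal (c * \<bar>a - b\<bar> powr \<gamma>)"
        using f that by (intro mult_left_mono) auto
      also have "\<dots> = ennreal (c * (r * \<bar>a - b\<bar> powr \<gamma>))"
        using that c by (simp add: ac_simps flip: ennreal_mult)
      also have "\<dots> \<le> ennreal (c * (y - x) powr \<gamma>)"
        using that c \<gamma> by (intro ennreal_leI mult_left_mono scaled_powr_le) auto
      finally show ?thesis .
    qed
    have "(\<integral>\<^sup>+\<omega>. ennreal \<bar>interp t n (\<lambda>s. f s \<omega>) y - interp t n (\<lambda>s. f s \<omega>) x\<bar> \<partial>M)
       \<le> (\<integral>\<^sup>+\<omega>. ennreal (p * \<bar>f u \<omega> - f u' \<omega>\<bar>) + ennreal (1 * \<bar>f v \<omega> - f v' \<omega>\<bar>) + ennreal (q * \<bar>f w \<omega> - f w' \<omega>\<bar>) \<partial>M)"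
    proof (intro nn_integral_mono)
      fix \<omega>
      let ?a = "f u \<omega> - f u' \<omega>" and ?b = "f v \<omega> - f v' \<omega>" and ?c = "f w \<omega> - f w' \<omega>"
      have "\<bar>p * ?a + ?b + q * ?c\<bar> \<le> \<bar>p * ?a\<bar> + \<bar>?b\<bar> + \<bar>q * ?c\<bar>" by linarith
      also have "\<dots> = p * \<bar>?a\<bar> + 1 * \<bar>?b\<bar> + q * \<bar>?c\<bar>" using pq by (simp add: abs_mult)
      finally have "ennreal \<bar>p * ?a + ?b + q * ?c\<bar> \<le> ennreal (p * \<bar>?a\<bar> + 1 * \<bar>?b\<bar> + q * \<bar>?c\<bar>)"
        by (rule ennreal_leI)
      also have "\<dots> = ennreal (p * \<bar>?a\<bar>) + ennreal (1 * \<bar>?b\<bar>) + ennreal (q * \<bar>?c\<bar>)"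
        using pq by (simp add: ennreal_plus)
      finally show "ennreal \<bar>interp t n (\<lambda>s. f s \<omega>) y - interp t n (\<lambda>s. f s \<omega>) x\<bar>
        \<le> ennreal (p * \<bar>?a\<bar>) + ennreal (1 * \<bar>?b\<bar>) + ennreal (q * \<bar>?c\<bar>)" unfolding eq[rule_format] .
    qed
    also have "\<dots> = (\<integral>\<^sup>+\<omega>. ennreal (p * \<bar>f u \<omega> - f u' \<omega>\<bar>) \<partial>M) + (\<integral>\<^sup>+\<omega>. ennreal (1 * \<bar>f v \<omega> - f v' \<omega>\<bar>) \<partial>M)
        + (\<integral>\<^sup>+\<omega>. ennreal (q * \<bar>f w \<omega> - f w' \<omega>\<bar>) \<partial>M)"
      by (subst nn_integral_add; (subst nn_integral_add)?) auto
    also have "\<dots> \<le> ennreal (c * (y - x) powr \<gamma>) + ennreal (c * (y - x) powr \<gamma>) + ennreal (c * (y - x) powr \<gamma>)"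
      using in_t le pq by (intro add_mono piece) auto
    also have "\<dots> = ennreal (3 * c * (y - x) powr \<gamma>)"
      using c by (simp flip: ennreal_plus)
    finally show ?thesis .
  qed
  have cl: "clamp_to t x \<in> {0..t}" "clamp_to t y \<in> {0..t}" using t by (auto intro!: clamp_to_in simp del: atLeastAtMost_iff)
  have ic: "interp t n h z = interp t n h (clamp_to t z)" for h z using t by (intro interp_clamp) auto
  show ?thesis
  proof (cases "clamp_to t x \<le> clamp_to t y")
    case True
    then show ?thesis using main[OF cl True] by (subst ic, subst (2) ic) (simp add: abs_minus_commute)
  next
    case False
    then show ?thesis using main[OF cl(2,1)] by (subst ic, subst (2) ic) simp
  qed
qed

lemma interp_approx:
  assumes t: "0 < t" and n: "0 < n" and x: "x \<in> {0..t}"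
  shows "\<exists>\<theta> u v. 0 \<le> \<theta> \<and> \<theta> \<le> 1 \<and> u \<in> {0..t} \<and> v \<in> {0..t} \<and> \<bar>u - x\<bar> \<le> t / real n \<and> \<bar>v - x\<bar> \<le> t / real n \<and>
    (\<forall>f. interp t n f x - f x = (1 - \<theta>) * (f u - f x) + \<theta> * (f v - f x))"
proof -
  define d where "d = t / real n"
  have d: "0 < d" using t n by (simp add: d_def)
  obtain i \<theta> where i: "i < n" "0 \<le> \<theta>" "\<theta> \<le> 1" "x = node t n i + \<theta> * d"
    and ix: "\<And>f. interp t n f x = f (node t n i) + \<theta> * (f (node t n (Suc i)) - f (node t n i))"
    using interp_cell[OF t n x] unfolding d_def by blast
  have nS: "node t n (Suc j) = node t n j + d" for j by (simp add: node_Suc d_def)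
  have nin: "j \<le> n \<Longrightarrow> node t n j \<in> {0..t}" for j using node_in[of t n j] t n by auto
  have \<theta>d: "0 \<le> \<theta> * d" "\<theta> * d \<le> d" using i d by auto
  have "interp t n f x - f x = (1 - \<theta>) * (f (node t n i) - f x) + \<theta> * (f (node t n (Suc i)) - f x)" for f
    unfolding ix by (simp add: algebra_simps)
  then show ?thesis
    using i nin[of i] nin[of "Suc i"] nS[of i] \<theta>d
    by - (rule exI[of _ \<theta>], rule exI[of _ "node t n i"], rule exI[of _ "node t n (Suc i)"], auto simp: d_def)
qed

lemma interp_tendsto:
  assumes t: "0 < t" and f: "continuous_on {0..t} f" and x: "x \<in> {0..t}"
  shows "(\<lambda>n. interp t (Suc n) f x) \<longlonglongrightarrow> f x"
proof (rule tendstoI)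
  fix e :: real assume "0 < e"
  then obtain r where r: "0 < r" "\<And>u. u \<in> {0..t} \<Longrightarrow> dist u x < r \<Longrightarrow> dist (f u) (f x) < e"
    using f x unfolding continuous_on_iff by blast
  have "(\<lambda>n. t * (1 / real (Suc n))) \<longlonglongrightarrow> t * 0"
    by (intro tendsto_mult tendsto_const LIMSEQ_inverse_real_of_nat[unfolded inverse_eq_divide])
  then have "\<forall>\<^sub>F n in sequentially. t / real (Suc n) < r"
    using r by (auto dest!: order_tendstoD(2)[of _ 0 _ r] simp del: of_nat_Suc)
  then show "\<forall>\<^sub>F n in sequentially. dist (interp t (Suc n) f x) (f x) < e"
  proof eventually_elim
    case (elim n)
    obtain \<theta> u v where *: "0 \<le> \<theta>" "\<theta> \<le> 1" "u \<in> {0..t}" "v \<in> {0..t}" "\<bar>u - x\<bar> \<le> t / real (Suc n)"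
      "\<bar>v - x\<bar> \<le> t / real (Suc n)"
      "interp t (Suc n) f x - f x = (1 - \<theta>) * (f u - f x) + \<theta> * (f v - f x)"
      using interp_approx[OF t zero_less_Suc x, of n] by blast
    have "\<bar>f u - f x\<bar> < e" "\<bar>f v - f x\<bar> < e"
      using r(2)[of u] r(2)[of v] * elim by (auto simp: dist_real_def)
    moreover have "\<bar>(1 - \<theta>) * (f u - f x) + \<theta> * (f v - f x)\<bar> \<le> (1 - \<theta>) * \<bar>f u - f x\<bar> + \<theta> * \<bar>f v - f x\<bar>"
      using * abs_triangle_ineq[of "(1 - \<theta>) * (f u - f x)" "\<theta> * (f v - f x)"] by (simp add: abs_mult)
    ultimately show ?case
      using * convex_bound_lt[of "\<bar>f u - f x\<bar>" e "\<bar>f v - f x\<bar>" "1 - \<theta>" \<theta>] by (auto simp: dist_real_def)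
  qed
qed

section \<open>Weyl derivatives as singular integrals over the half-line\<close>

lemma has_bochner_integral_of_has_integral:
  fixes f :: "real \<Rightarrow> real"
  assumes [measurable]: "S \<in> sets borel" "f \<in> borel_measurable borel"
    and nn: "\<And>x. x \<in> S \<Longrightarrow> 0 \<le> f x" and I: "(f has_integral I) S"
  shows "has_bochner_integral lborel (\<lambda>x. indicator S x * f x) I"
proof -
  have eq: "(\<lambda>x. indicator S x * f x) = (\<lambda>x. if x \<in> S then f x else 0)"
    by (auto simp: indicator_def)
  have "0 \<le> I" using I nn by (rule has_integral_nonneg)
  have "integral\<^sup>N lborel (\<lambda>x. ennreal (indicator S x * f x)) = ennreal I"
  proof (rule nn_integral_has_integral_lborel)
    show "((\<lambda>x. indicator S x * f x) has_integral I) UNIV"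
      unfolding eq using I by (simp add: has_integral_restrict_UNIV)
  qed (use nn in \<open>auto simp: indicator_def\<close>)
  then show ?thesis
    using \<open>0 \<le> I\<close> nn by (intro has_bochner_integral_nn_integral) (auto simp: indicator_def)
qed

text \<open>This and the next lemma integrate the kernel of a fractional derivative near \<open>0\<close> and near infinity.\<close>

lemma integral_powr_near:
  fixes a r :: real
  assumes "-1 < a" "0 \<le> r"
  shows "has_bochner_integral lborel (\<lambda>z. indicator {0<..r} z * z powr a) (r powr (a + 1) / (a + 1))"
proof -
  have "has_bochner_integral lborel (\<lambda>z. indicator {0..r} z * z powr a) (r powr (a + 1) / (a + 1))"
    using assms by (intro has_bochner_integral_of_has_integral has_integral_powr_from_0) auto
  moreover have "(\<lambda>z. indicator {0..r} z * z powr a) = (\<lambda>z. indicator {0<..r} z * z powr a)"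
    by (auto simp: indicator_def fun_eq_iff)
  ultimately show ?thesis by simp
qed

lemma integral_powr_tail:
  fixes a r :: real
  assumes "a < -1" "0 < r"
  shows "has_bochner_integral lborel (\<lambda>z. indicator {r<..} z * z powr a) (- (r powr (a + 1)) / (a + 1))"
proof -
  have "has_bochner_integral lborel (\<lambda>z. indicator {r..} z * z powr a) (- (r powr (a + 1)) / (a + 1))"
    using assms by (intro has_bochner_integral_of_has_integral has_integral_powr_to_inf) auto
  moreover have "AE z in lborel. indicator {r..} z * z powr a = indicator {r<..} z * z powr a"
    using AE_lborel_singleton[of r] by eventually_elim (auto simp: indicator_def)
  ultimately show ?thesis
    by (subst has_bochner_integral_cong_AE[symmetric]) auto
qed

definition kernel :: "real \<Rightarrow> real \<Rightarrow> real" where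
  "kernel \<delta> z = indicator {0<..} z * z powr (-1 - \<delta>)"

lemma kernel_nonneg [simp]: "0 \<le> kernel \<delta> z" by (simp add: kernel_def)
lemma borel_measurable_kernel [measurable]: "kernel \<delta> \<in> borel_measurable borel"
  unfolding kernel_def[abs_def] by measurable

text \<open>The majorant for all dominated convergence arguments: an increment of a clamped function over the distance
\<open>z\<close> is at most a multiple of \<open>(min z t) powr \<gamma>\<close>.\<close>

lemma integrable_min_powr_kernel:
  assumes "0 < \<delta>" "\<delta> < \<gamma>" "0 < t"
  shows "integrable lborel (\<lambda>z. (min z t) powr \<gamma> * kernel \<delta> z)"
proof -
  have "(\<lambda>z. (min z t) powr \<gamma> * kernel \<delta> z) = (\<lambda>z. indicator {0<..t} z * z powr (\<gamma> + (-1 - \<delta>))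
      + t powr \<gamma> * (indicator {t<..} z * z powr (-1 - \<delta>)))"
    using assms by (auto simp: kernel_def fun_eq_iff indicator_def min_def simp flip: powr_add)
  moreover have "integrable lborel (\<lambda>z. indicator {0<..t} z * z powr (\<gamma> + (-1 - \<delta>)))"
    using assms integral_powr_near[of "\<gamma> + (-1 - \<delta>)" t] by (auto simp: has_bochner_integral_iff)
  moreover have "integrable lborel (\<lambda>z. indicator {t<..} z * z powr (-1 - \<delta>))"
    using assms integral_powr_tail[of "-1 - \<delta>" t] by (auto simp: has_bochner_integral_iff)
  ultimately show ?thesis by simp
qed

text \<open>With \<open>r = x - a > 0\<close> the increment is \<open>z\<close> for \<open>z \<le> r\<close> and \<open>r\<close> beyond, so the two pieces contribute
\<open>r powr (1 - \<delta>) / (1 - \<delta>)\<close> and \<open>r powr (1 - \<delta>) / \<delta>\<close>.\<close>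

lemma has_integral_kernel_ramp:
  assumes \<delta>: "0 < \<delta>" "\<delta> < 1"
  shows "has_bochner_integral lborel (\<lambda>z. (max 0 (x - a) - max 0 (x - z - a)) * kernel \<delta> z)
     ((max 0 (x - a)) powr (1 - \<delta>) / (\<delta> * (1 - \<delta>)))"
proof (cases "0 < x - a")
  case True
  define r where "r = x - a"
  have r: "0 < r" using True by (simp add: r_def)
  have eq: "(max 0 (x - a) - max 0 (x - z - a)) * kernel \<delta> z =
      indicator {0<..r} z * z powr (- \<delta>) + r * (indicator {r<..} z * z powr (-1 - \<delta>))" for z
    using r by (auto simp: r_def kernel_def indicator_def max_def powr_mult_base)
  have v: "r powr (- \<delta> + 1) / (- \<delta> + 1) + r * (- (r powr (-1 - \<delta> + 1)) / (-1 - \<delta> + 1))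
      = r powr (1 - \<delta>) / (\<delta> * (1 - \<delta>))"
  proof -
    have "r * r powr (- \<delta>) = r powr (1 - \<delta>)" using r by (simp add: powr_mult_base)
    then have "r powr (- \<delta> + 1) / (- \<delta> + 1) + r * (- (r powr (-1 - \<delta> + 1)) / (-1 - \<delta> + 1))
      = r powr (1 - \<delta>) / (1 - \<delta>) + r powr (1 - \<delta>) / \<delta>" by simp
    also have "\<dots> = r powr (1 - \<delta>) / (\<delta> * (1 - \<delta>))" using \<delta> by (simp add: field_simps)
    finally show ?thesis .
  qed
  have "has_bochner_integral lborel (\<lambda>z. indicator {0<..r} z * z powr (- \<delta>) + r * (indicator {r<..} z * z powr (-1 - \<delta>)))
     (r powr (- \<delta> + 1) / (- \<delta> + 1) + r * (- (r powr (-1 - \<delta> + 1)) / (-1 - \<delta> + 1)))"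
    using \<delta> r by (intro has_bochner_integral_add has_bochner_integral_mult_right integral_powr_near integral_powr_tail) auto
  then show ?thesis using r unfolding eq v by (simp add: r_def)
next
  case False
  then have eq: "(\<lambda>z. (max 0 (x - a) - max 0 (x - z - a)) * kernel \<delta> z) = (\<lambda>_. 0)"
    by (auto simp: kernel_def indicator_def max_def)
  have "max 0 (x - a) = 0" using False by simp
  then show ?thesis unfolding eq by (auto intro: has_bochner_integral_zero)
qed

lemma LINT_lebesgue_on_borel:
  fixes g :: "real \<Rightarrow> real"
  assumes [measurable]: "g \<in> borel_measurable borel" "S \<in> sets borel"
  shows "(LINT x|lebesgue_on S. g x) = (LINT x|lborel. indicator S x * g x)"
proof -
  have "(LINT x|lebesgue_on S. g x) = (LINT x|lebesgue. indicator S x * g x)"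
    by (subst integral_restrict_space) auto
  also have "\<dots> = (LINT x|lborel. indicator S x * g x)"
    by (rule integral_completion) measurable
  finally show ?thesis .
qed

lemma LINT_lborel_reflect:
  fixes g :: "real \<Rightarrow> real"
  shows "(LINT x|lborel. g x) = (LINT x|lborel. g (t - x))"
  using lborel_integral_real_affine[of "-1" g t] by simp

text \<open>The Marchaud form of the fractional derivative of order \<open>\<delta>\<close> on the whole line.\<close>

definition marchaud :: "real \<Rightarrow> (real \<Rightarrow> real) \<Rightarrow> real \<Rightarrow> real" where
  "marchaud \<delta> f x = \<delta> / Gamma (1 - \<delta>) * (LINT z|lborel. (f x - f (x - z)) * kernel \<delta> z)"

text \<open>If \<open>f\<close> vanishes on the negative half-line, the boundary term \<open>f x / x powr \<delta>\<close> of the Weyl derivative is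
the part of the Marchaud integral over \<open>z > x\<close>.\<close>

lemma weyl_deriv_left_eq_marchaud:
  assumes \<delta>: "0 < \<delta>" and x: "0 < x" and [measurable]: "f \<in> borel_measurable borel"
    and f0: "\<And>s. s \<le> 0 \<Longrightarrow> f s = 0"
    and int: "integrable lborel (\<lambda>z. (f x - f (x - z)) * kernel \<delta> z)"
  shows "weyl_deriv_left \<delta> f x = marchaud \<delta> f x"
proof -
  let ?g = "\<lambda>z. (f x - f (x - z)) * kernel \<delta> z"
  have near: "(LINT y|lebesgue_on {0..x}. (f x - f y) / (x - y) powr (\<delta> + 1)) = (LINT z|lborel. indicator {0<..x} z * ?g z)"
  proof -
    have "(LINT y|lebesgue_on {0..x}. (f x - f y) / (x - y) powr (\<delta> + 1))
        = (LINT y|lborel. indicator {0..x} y * ((f x - f y) / (x - y) powr (\<delta> + 1)))"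
      by (rule LINT_lebesgue_on_borel) measurable
    also have "\<dots> = (LINT z|lborel. indicator {0..x} (x - z) * ((f x - f (x - z)) / (x - (x - z)) powr (\<delta> + 1)))"
      by (rule LINT_lborel_reflect)
    also have "\<dots> = (LINT z|lborel. indicator {0<..x} z * ?g z)"
    proof (rule Bochner_Integration.integral_cong[OF refl])
      fix z :: real
      have "1 / z powr (\<delta> + 1) = z powr (- (\<delta> + 1))" by (rule powr_minus_divide[symmetric])
      also have "- (\<delta> + 1) = -1 - \<delta>" by simp
      finally have "1 / z powr (\<delta> + 1) = z powr (-1 - \<delta>)" .
      moreover have "(f x - f (x - z)) / (x - (x - z)) powr (\<delta> + 1) = (f x - f (x - z)) * (1 / z powr (\<delta> + 1))"
        by simp
      ultimately have "(f x - f (x - z)) / (x - (x - z)) powr (\<delta> + 1) = (f x - f (x - z)) * z powr (-1 - \<delta>)"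
        by (simp only:)
      then show "indicator {0..x} (x - z) * ((f x - f (x - z)) / (x - (x - z)) powr (\<delta> + 1)) = indicator {0<..x} z * ?g z"
        by (cases "z = 0") (auto simp: kernel_def indicator_def)
    qed
    finally show ?thesis .
  qed
  have far: "(LINT z|lborel. indicator {x<..} z * ?g z) = f x / (\<delta> * x powr \<delta>)"
  proof -
    have "(\<lambda>z. indicator {x<..} z * ?g z) = (\<lambda>z. f x * (indicator {x<..} z * z powr (-1 - \<delta>)))"
      using x f0 by (auto simp: kernel_def indicator_def fun_eq_iff)
    moreover have "(LINT z|lborel. indicator {x<..} z * z powr (-1 - \<delta>)) = x powr (- \<delta>) / \<delta>"
      using integral_powr_tail[of "-1 - \<delta>" x] \<delta> x by (auto simp: has_bochner_integral_iff)
    ultimately show ?thesis by (simp add: powr_minus field_simps)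
  qed
  have "(LINT z|lborel. ?g z) = (LINT z|lborel. indicator {0<..x} z * ?g z + indicator {x<..} z * ?g z)"
    by (rule Bochner_Integration.integral_cong) (use x in \<open>auto simp: indicator_def kernel_def\<close>)
  also have "\<dots> = (LINT z|lborel. indicator {0<..x} z * ?g z) + (LINT z|lborel. indicator {x<..} z * ?g z)"
    using integrable_mult_indicator[OF _ int, of "{0<..x}"] integrable_mult_indicator[OF _ int, of "{x<..}"]
    by (intro Bochner_Integration.integral_add) simp_all
  finally show ?thesis
    unfolding weyl_deriv_left_def marchaud_def near far using \<delta> by (simp add: field_simps)
qed

lemma weyl_deriv_right_reflect:
  assumes [measurable]: "f \<in> borel_measurable borel"
  shows "weyl_deriv_right \<delta> t f x = weyl_deriv_left \<delta> (\<lambda>s. f (t - s)) (t - x)"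
proof -
  have "(LINT y|lebesgue_on {x..t}. (f x - f y) / (y - x) powr (\<delta> + 1))
      = (LINT y|lborel. indicator {x..t} y * ((f x - f y) / (y - x) powr (\<delta> + 1)))"
    by (rule LINT_lebesgue_on_borel) measurable
  also have "\<dots> = (LINT y|lborel. indicator {x..t} (t - y) * ((f x - f (t - y)) / (t - y - x) powr (\<delta> + 1)))"
    by (rule LINT_lborel_reflect)
  also have "\<dots> = (LINT y|lborel. indicator {0..t - x} y * ((f (t - (t - x)) - f (t - y)) / (t - x - y) powr (\<delta> + 1)))"
    by (rule Bochner_Integration.integral_cong) (auto simp: indicator_def algebra_simps)
  also have "\<dots> = (LINT y|lebesgue_on {0..t - x}. (f (t - (t - x)) - f (t - y)) / (t - x - y) powr (\<delta> + 1))"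
    by (rule LINT_lebesgue_on_borel[symmetric]) measurable
  finally show ?thesis by (simp add: weyl_deriv_right_def weyl_deriv_left_def)
qed

section \<open>Fractional derivatives of Hoelder functions\<close>

lemma marchaud_holder:
  assumes \<delta>: "0 < \<delta>" "\<delta> < \<gamma>" "\<delta> < 1" and t: "0 < t" and c: "0 \<le> c"
    and [measurable]: "f \<in> borel_measurable borel"
    and f: "\<And>u v. \<bar>f u - f v\<bar> \<le> c * (min \<bar>u - v\<bar> t) powr \<gamma>"
  shows "integrable lborel (\<lambda>z. (f x - f (x - z)) * kernel \<delta> z)"
    and "\<bar>marchaud \<delta> f x\<bar> \<le> \<delta> / Gamma (1 - \<delta>) * (c * (LINT z|lborel. (min z t) powr \<gamma> * kernel \<delta> z))"
proof -
  have le: "norm ((f x - f (x - z)) * kernel \<delta> z) \<le> c * ((min z t) powr \<gamma> * kernel \<delta> z)" for z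
  proof (cases "0 < z")
    case True
    then show ?thesis using f[of x "x - z"] mult_right_mono[OF f[of x "x - z"], of "kernel \<delta> z"]
      by (simp add: abs_mult mult.assoc)
  qed (simp add: kernel_def)
  have J: "integrable lborel (\<lambda>z. c * ((min z t) powr \<gamma> * kernel \<delta> z))"
    using integrable_min_powr_kernel[OF \<delta>(1,2) t] by simp
  show I: "integrable lborel (\<lambda>z. (f x - f (x - z)) * kernel \<delta> z)"
    by (rule Bochner_Integration.integrable_bound[OF J]) (use order_trans[OF le abs_ge_self] in \<open>auto\<close>)
  have "\<bar>LINT z|lborel. (f x - f (x - z)) * kernel \<delta> z\<bar> \<le> (LINT z|lborel. c * ((min z t) powr \<gamma> * kernel \<delta> z))"
    using le by (intro Bochner_Integration.integral_norm_bound_integral[OF I J, unfolded real_norm_def]) simp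
  then have "\<bar>LINT z|lborel. (f x - f (x - z)) * kernel \<delta> z\<bar> \<le> c * (LINT z|lborel. (min z t) powr \<gamma> * kernel \<delta> z)"
    by simp
  moreover have "0 < Gamma (1 - \<delta>)" using \<delta> by simp
  ultimately show "\<bar>marchaud \<delta> f x\<bar> \<le> \<delta> / Gamma (1 - \<delta>) * (c * (LINT z|lborel. (min z t) powr \<gamma> * kernel \<delta> z))"
    unfolding marchaud_def abs_mult using \<delta> by (intro mult_mono) auto
qed

lemma borel_measurable_marchaud [measurable]:
  assumes [measurable]: "f \<in> borel_measurable borel"
  shows "marchaud \<delta> f \<in> borel_measurable borel"
  unfolding marchaud_def[abs_def] by measurable

text \<open>The case of a point mass in \<open>nn_integral_interp_increment\<close>.\<close>

lemma interp_holder: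
  assumes t: "0 < t" and \<gamma>: "0 < \<gamma>" "\<gamma> \<le> 1" and c: "0 \<le> c" and n: "0 < n"
    and f: "\<And>u v. u \<in> {0..t} \<Longrightarrow> v \<in> {0..t} \<Longrightarrow> \<bar>f u - f v\<bar> \<le> c * \<bar>u - v\<bar> powr \<gamma>"
  shows "\<bar>interp t n f x - interp t n f y\<bar> \<le> 3 * c * (min \<bar>x - y\<bar> t) powr \<gamma>"
proof -
  have *: "(\<integral>\<^sup>+\<omega>. ennreal r \<partial>return (count_space UNIV) (0::nat)) = ennreal r" for r
    by (simp add: nn_integral_return)
  have "(\<integral>\<^sup>+\<omega>. ennreal \<bar>interp t n (\<lambda>s. f s) x - interp t n (\<lambda>s. f s) y\<bar> \<partial>return (count_space UNIV) (0::nat))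
      \<le> ennreal (3 * c * \<bar>clamp_to t x - clamp_to t y\<bar> powr \<gamma>)"
    using f by (intro nn_integral_interp_increment[OF t n \<gamma> c]) (auto simp: * intro!: ennreal_leI)
  then have "\<bar>interp t n f x - interp t n f y\<bar> \<le> 3 * c * \<bar>clamp_to t x - clamp_to t y\<bar> powr \<gamma>"
    unfolding * using c by simp
  also have "\<dots> \<le> 3 * c * (min \<bar>x - y\<bar> t) powr \<gamma>"
    using c \<gamma> t clamp_to_dist[of t x y] clamp_to_dist_t[of t x y]
    by (intro mult_left_mono powr_mono2) auto
  finally show ?thesis .
qed

text \<open>The same ramp seen from the right end, as needed for derivatives based at \<open>t\<close>.\<close>

lemma ramp_right:
  assumes "0 < t" "0 < n"
  shows "ramp t n i x = 1 - (max 0 (node t n (Suc i) - x) - max 0 (node t n i - x)) / (t / real n)"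
proof -
  have "max 0 (x - node t n i) - max 0 (x - node t n (Suc i))
     = t / real n - (max 0 (node t n (Suc i) - x) - max 0 (node t n i - x))"
    by (simp add: node_Suc max_def)
  moreover have d: "t / real n \<noteq> 0" using assms by simp
  ultimately show ?thesis
    by (simp only: ramp_def diff_divide_distrib[of "t / real n"] divide_self[OF d])
qed

lemma integral_ramp_square:
  fixes a c :: real
  assumes "0 \<le> a" "0 \<le> c"
  shows "has_bochner_integral lborel (\<lambda>x. indicator {0..c} x * max 0 (x - a)) ((max 0 (c - a))\<^sup>2 / 2)"
proof (cases "a \<le> c")
  case True
  have "((\<lambda>x. x - a) has_integral ((c - a)\<^sup>2 / 2 - (a - a)\<^sup>2 / 2)) {a..c}"
    using True by (intro fundamental_theorem_of_calculus)
      (auto intro!: derivative_eq_intros simp flip: has_real_derivative_iff_has_vector_derivative)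
  then have "has_bochner_integral lborel (\<lambda>x. indicator {a..c} x * (x - a)) ((c - a)\<^sup>2 / 2)"
    by (intro has_bochner_integral_of_has_integral) auto
  moreover have "(\<lambda>x. indicator {0..c} x * max 0 (x - a)) = (\<lambda>x. indicator {a..c} x * (x - a))"
    using assms by (auto simp: indicator_def fun_eq_iff)
  ultimately show ?thesis using True by simp
next
  case False
  then have eq: "(\<lambda>x. indicator {0..c} x * max 0 (x - a)) = (\<lambda>x. 0)"
    by (auto simp: indicator_def fun_eq_iff)
  show ?thesis unfolding eq using False by (auto intro: has_bochner_integral_zero)
qed

text \<open>An affine change of variables reduces this to \<open>Beta (2 - \<delta>) (1 + \<delta>)\<close>, and the denominator of the Beta
function is \<open>Gamma 3 = 2\<close>.\<close>

lemma integral_beta_ramps: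
  fixes a c t :: real
  assumes \<delta>: "0 < \<delta>" "\<delta> < 1" and "0 \<le> a" "0 \<le> c" "c \<le> t"
  shows "has_bochner_integral lborel
     (\<lambda>x. indicator {0..t} x * ((max 0 (x - a)) powr (1 - \<delta>) * (max 0 (c - x)) powr \<delta>))
     (Gamma (2 - \<delta>) * Gamma (1 + \<delta>) * ((max 0 (c - a))\<^sup>2 / 2))"
proof (cases "a < c")
  case True
  define r where "r = c - a"
  have r: "0 < r" using True by (simp add: r_def)
  \<comment> \<open>substitute \<open>s = (x - a) / r\<close> in the Beta integral\<close>
  have "((\<lambda>s. s powr ((2 - \<delta>) - 1) * (1 - s) powr ((1 + \<delta>) - 1)) has_integral Beta (2 - \<delta>) (1 + \<delta>)) {0..1}"
    using \<delta> by (intro has_integral_Beta_real) auto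
  then have "has_bochner_integral lborel (\<lambda>s. indicator {0..1} s * (s powr ((2 - \<delta>) - 1) * (1 - s) powr ((1 + \<delta>) - 1))) (Beta (2 - \<delta>) (1 + \<delta>))"
    by (intro has_bochner_integral_of_has_integral) auto
  then have 1: "has_bochner_integral lborel (\<lambda>s. indicator {0..1} s * (s powr (1 - \<delta>) * (1 - s) powr \<delta>)) (Beta (2 - \<delta>) (1 + \<delta>))"
    by simp
  have "has_bochner_integral lborel (\<lambda>x. indicator {0..1} (- a / r + (1 / r) * x) * ((- a / r + (1 / r) * x) powr (1 - \<delta>) * (1 - (- a / r + (1 / r) * x)) powr \<delta>))
     (Beta (2 - \<delta>) (1 + \<delta>) /\<^sub>R \<bar>1 / r\<bar>)"
    using r by (intro lborel_has_bochner_integral_real_affine_iff[THEN iffD1, OF _ 1]) auto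
  then have "has_bochner_integral lborel (\<lambda>x. r * (indicator {0..1} (- a / r + (1 / r) * x) * ((- a / r + (1 / r) * x) powr (1 - \<delta>) * (1 - (- a / r + (1 / r) * x)) powr \<delta>)))
     (r * (Beta (2 - \<delta>) (1 + \<delta>) /\<^sub>R \<bar>1 / r\<bar>))"
    by (rule has_bochner_integral_mult_right)
  moreover have "(\<lambda>x. r * (indicator {0..1} (- a / r + (1 / r) * x) * ((- a / r + (1 / r) * x) powr (1 - \<delta>) * (1 - (- a / r + (1 / r) * x)) powr \<delta>)))
     = (\<lambda>x. indicator {0..t} x * ((max 0 (x - a)) powr (1 - \<delta>) * (max 0 (c - x)) powr \<delta>))"
  proof
    fix x
    have e1: "- a / r + (1 / r) * x = (x - a) / r" using r by (simp add: field_simps)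
    have e2: "1 - (x - a) / r = (c - x) / r" using r by (simp add: field_simps r_def)
    show "r * (indicator {0..1} (- a / r + (1 / r) * x) * ((- a / r + (1 / r) * x) powr (1 - \<delta>) * (1 - (- a / r + (1 / r) * x)) powr \<delta>))
     = indicator {0..t} x * ((max 0 (x - a)) powr (1 - \<delta>) * (max 0 (c - x)) powr \<delta>)"
    proof (cases "a \<le> x \<and> x \<le> c")
      case True
      then have ind: "(x - a) / r \<in> {0..1}" "x \<in> {0..t}" using r assms by (auto simp: r_def field_simps)
      have "r powr (1 - \<delta>) * r powr \<delta> = r" using r by (simp flip: powr_add)
      then have "r * ((x - a) powr (1 - \<delta>) / r powr (1 - \<delta>) * ((c - x) powr \<delta> / r powr \<delta>)) = (x - a) powr (1 - \<delta>) * (c - x) powr \<delta>"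
        using r by (simp add: field_simps)
      then show ?thesis unfolding e1 e2 using ind True r by (simp add: powr_divide)
    next
      case False
      then have "(x - a) / r \<notin> {0..1}" using r by (auto simp: r_def field_simps)
      moreover have "max 0 (x - a) = 0 \<or> max 0 (c - x) = 0" using False by auto
      ultimately show ?thesis unfolding e1 by auto
    qed
  qed
  moreover have "r * (Beta (2 - \<delta>) (1 + \<delta>) /\<^sub>R \<bar>1 / r\<bar>) = Gamma (2 - \<delta>) * Gamma (1 + \<delta>) * ((max 0 (c - a))\<^sup>2 / 2)"
  proof -
    have "Gamma ((2 - \<delta>) + (1 + \<delta>)) = (2::real)"
      using Gamma_fact[of 2, where 'a=real] by (simp add: numeral_3_eq_3[symmetric])
    then have "Beta (2 - \<delta>) (1 + \<delta>) = Gamma (2 - \<delta>) * Gamma (1 + \<delta>) / 2"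
      by (simp only: Beta_def)
    then show ?thesis using r by (simp add: r_def power2_eq_square)
  qed
  ultimately show ?thesis by (simp only:)
next
  case False
  then have eq: "(\<lambda>x. indicator {0..t} x * ((max 0 (x - a)) powr (1 - \<delta>) * (max 0 (c - x)) powr \<delta>)) = (\<lambda>x. 0)"
    by (auto simp: fun_eq_iff max_def)
  show ?thesis unfolding eq using False by (auto intro: has_bochner_integral_zero)
qed

lemma marchaud_interp:
  assumes \<delta>: "0 < \<delta>" "\<delta> < 1" 
  shows "marchaud \<delta> (interp t n f) x = (\<Sum>i<n. (f (node t n (Suc i)) - f (node t n i)) *
     (((max 0 (x - node t n i)) powr (1 - \<delta>) - (max 0 (x - node t n (Suc i))) powr (1 - \<delta>)) / (t / real n) / Gamma (2 - \<delta>)))"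
proof -
  let ?D = "\<lambda>i. f (node t n (Suc i)) - f (node t n i)"
  let ?m = "\<lambda>a y. max 0 (y - a) :: real"
  let ?v = "\<lambda>a. (max 0 (x - a)) powr (1 - \<delta>) / (\<delta> * (1 - \<delta>))"
  have eq: "(interp t n f x - interp t n f (x - z)) * kernel \<delta> z = (\<Sum>i<n. ?D i *
     (((?m (node t n i) x - ?m (node t n i) (x - z)) * kernel \<delta> z
       - (?m (node t n (Suc i)) x - ?m (node t n (Suc i)) (x - z)) * kernel \<delta> z) / (t / real n)))" for z
  proof -
    have alg: "(d * ((u - v) / s) - d * ((u' - v') / s)) * w = d * (((u - u') * w - (v - v') * w) / s)"
      for d u v u' v' s w :: real by (cases "s = 0") (simp_all add: field_simps)
    have "interp t n f x - interp t n f (x - z) = (\<Sum>i<n. ?D i * ramp t n i x - ?D i * ramp t n i (x - z))"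
      by (simp add: interp_def sum_subtractf)
    then show ?thesis by (simp only: sum_distrib_right ramp_def alg)
  qed
  have "has_bochner_integral lborel (\<lambda>z. (interp t n f x - interp t n f (x - z)) * kernel \<delta> z)
     (\<Sum>i<n. ?D i * ((?v (node t n i) - ?v (node t n (Suc i))) / (t / real n)))"
    unfolding eq
    by (intro has_bochner_integral_sum has_bochner_integral_mult_right has_bochner_integral_divide_zero
        has_bochner_integral_diff has_integral_kernel_ramp \<delta>)
  then have "marchaud \<delta> (interp t n f) x = \<delta> / Gamma (1 - \<delta>) * (\<Sum>i<n. ?D i * ((?v (node t n i) - ?v (node t n (Suc i))) / (t / real n)))"
    by (simp add: marchaud_def has_bochner_integral_iff)
  also have "\<dots> = (\<Sum>i<n. ?D i *
     (((max 0 (x - node t n i)) powr (1 - \<delta>) - (max 0 (x - node t n (Suc i))) powr (1 - \<delta>)) / (t / real n) / Gamma (2 - \<delta>)))"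
  proof -
    have "Gamma (2 - \<delta>) = (1 - \<delta>) * Gamma (1 - \<delta>)"
    proof -
      have "1 - \<delta> \<notin> \<int>\<^sub>\<le>\<^sub>0" using \<delta> by (auto elim!: nonpos_Ints_cases)
      from Gamma_plus1[OF this] show ?thesis by (simp add: algebra_simps)
    qed
    have nz: "1 - \<delta> \<noteq> 0" "Gamma (1 - \<delta>) \<noteq> 0" using \<delta> Gamma_real_pos[of "1 - \<delta>"] by linarith+
    have gen: "\<lbrakk>e \<noteq> 0; G \<noteq> 0\<rbrakk> \<Longrightarrow> \<delta> / G * (d * ((u / (\<delta> * e) - v / (\<delta> * e)) / s)) = d * ((u - v) / s / (e * G))"
      for e G d u v s :: real using \<delta> by (cases "s = 0") (simp_all add: field_simps)
    from gen[OF nz] show ?thesis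
      by (simp only: sum_distrib_left \<open>Gamma (2 - \<delta>) = (1 - \<delta>) * Gamma (1 - \<delta>)\<close>)
  qed
  finally show ?thesis .
qed

text \<open>For a single ramp this is \<open>integral_beta_ramps\<close> compared with \<open>integral_ramp_square\<close>; both sides are
linear in the interpolated function.\<close>

lemma integral_marchaud_interp:
  assumes \<delta>: "0 < \<delta>" "\<delta> < 1" and t: "0 < t" and n: "0 < n" and c: "0 \<le> c" "c \<le> t" and f0: "f 0 = 0"
  shows "(LINT x|lborel. indicator {0..t} x * (marchaud \<delta> (interp t n f) x * (max 0 (c - x)) powr \<delta>))
    = Gamma (1 + \<delta>) * (LINT x|lborel. indicator {0..c} x * interp t n f x)"
proof -
  let ?D = "\<lambda>i. f (node t n (Suc i)) - f (node t n i)"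
  let ?v = "\<lambda>a. (max 0 (c - a))\<^sup>2 / 2 :: real"
  have np: "0 \<le> node t n i" for i using t by (simp add: node_def)
  have g: "Gamma (2 - \<delta>) \<noteq> 0" using \<delta> Gamma_real_pos[of "2 - \<delta>"] by linarith
  have eq1: "indicator {0..t} x * (marchaud \<delta> (interp t n f) x * (max 0 (c - x)) powr \<delta>)
    = (\<Sum>i<n. ?D i * ((indicator {0..t} x * ((max 0 (x - node t n i)) powr (1 - \<delta>) * (max 0 (c - x)) powr \<delta>)
       - indicator {0..t} x * ((max 0 (x - node t n (Suc i))) powr (1 - \<delta>) * (max 0 (c - x)) powr \<delta>)) / (t / real n) / Gamma (2 - \<delta>)))" for x
  proof -
    have "I * (d * ((u - v) / s / G) * w) = d * ((I * (u * w) - I * (v * w)) / s / G)" for I d u v s G w :: real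
      by (cases "s = 0"; cases "G = 0") (simp_all add: field_simps)
    then show ?thesis unfolding marchaud_interp[OF \<delta>] by (simp only: sum_distrib_right sum_distrib_left)
  qed
  have "has_bochner_integral lborel (\<lambda>x. indicator {0..t} x * (marchaud \<delta> (interp t n f) x * (max 0 (c - x)) powr \<delta>))
    (\<Sum>i<n. ?D i * ((Gamma (2 - \<delta>) * Gamma (1 + \<delta>) * ?v (node t n i) - Gamma (2 - \<delta>) * Gamma (1 + \<delta>) * ?v (node t n (Suc i))) / (t / real n) / Gamma (2 - \<delta>)))"
    unfolding eq1
    by (intro has_bochner_integral_sum has_bochner_integral_mult_right has_bochner_integral_divide_zero
        has_bochner_integral_diff integral_beta_ramps \<delta> np c)
  then have 1: "(LINT x|lborel. indicator {0..t} x * (marchaud \<delta> (interp t n f) x * (max 0 (c - x)) powr \<delta>))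
    = (\<Sum>i<n. ?D i * ((Gamma (2 - \<delta>) * Gamma (1 + \<delta>) * ?v (node t n i) - Gamma (2 - \<delta>) * Gamma (1 + \<delta>) * ?v (node t n (Suc i))) / (t / real n) / Gamma (2 - \<delta>)))"
    by (rule has_bochner_integral_integral_eq)
  have eq2: "indicator {0..c} x * interp t n f x = (\<Sum>i<n. ?D i * ((indicator {0..c} x * max 0 (x - node t n i)
     - indicator {0..c} x * max 0 (x - node t n (Suc i))) / (t / real n)))" for x
  proof -
    have "I * (d * ((u - v) / s)) = d * ((I * u - I * v) / s)" for I d u v s :: real
      by (cases "s = 0") (simp_all add: field_simps)
    then show ?thesis by (simp only: interp_def f0 ramp_def sum_distrib_left add_0)
  qed
  have "has_bochner_integral lborel (\<lambda>x. indicator {0..c} x * interp t n f x)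
    (\<Sum>i<n. ?D i * ((?v (node t n i) - ?v (node t n (Suc i))) / (t / real n)))"
    unfolding eq2
    by (intro has_bochner_integral_sum has_bochner_integral_mult_right has_bochner_integral_divide_zero
        has_bochner_integral_diff integral_ramp_square np c)
  then have 2: "(LINT x|lborel. indicator {0..c} x * interp t n f x)
     = (\<Sum>i<n. ?D i * ((?v (node t n i) - ?v (node t n (Suc i))) / (t / real n)))"
    by (rule has_bochner_integral_integral_eq)
  have "d * ((Gamma (2 - \<delta>) * G * u - Gamma (2 - \<delta>) * G * v) / s / Gamma (2 - \<delta>)) = G * (d * ((u - v) / s))"
    for d u v s G :: real using g by (cases "s = 0") (simp_all add: field_simps)
  then show ?thesis unfolding 1 2 by (simp only: sum_distrib_left)
qed

lemma holder_continuous_on: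
  fixes f :: "real \<Rightarrow> real"
  assumes f: "\<And>u v. u \<in> S \<Longrightarrow> v \<in> S \<Longrightarrow> \<bar>f u - f v\<bar> \<le> C * \<bar>u - v\<bar> powr \<gamma>" and \<gamma>: "0 < \<gamma>" and C: "0 \<le> C"
  shows "continuous_on S f"
  unfolding continuous_on_iff
proof (intro ballI allI impI)
  fix x e :: real assume x: "x \<in> S" and "0 < e"
  define r where "r = (e / (C + 1)) powr (1 / \<gamma>)"
  have "0 < r" using \<open>0 < e\<close> C by (simp add: r_def)
  have "dist (f u) (f x) < e" if u: "u \<in> S" "dist u x < r" for u
  proof -
    have "\<bar>f u - f x\<bar> \<le> C * \<bar>u - x\<bar> powr \<gamma>" using f u x by simp
    also have "\<dots> \<le> C * r powr \<gamma>" using u C \<gamma> by (intro mult_left_mono powr_mono2) (auto simp: dist_real_def)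
    also have "r powr \<gamma> = e / (C + 1)" using \<gamma> \<open>0 < e\<close> C by (simp add: r_def powr_powr)
    also have "C * (e / (C + 1)) < e" using \<open>0 < e\<close> C by (simp add: field_simps)
    finally show ?thesis by (simp add: dist_real_def)
  qed
  then show "\<exists>d>0. \<forall>x'\<in>S. dist x' x < d \<longrightarrow> dist (f x') (f x) < e" using \<open>0 < r\<close> by blast
qed

lemma continuous_clamp_measurable:
  assumes "0 \<le> t" "continuous_on {0..t} f"
  shows "(\<lambda>x. f (clamp_to t x)) \<in> borel_measurable borel"
proof (rule borel_measurable_continuous_onI)
  have "continuous_on UNIV (clamp_to t)" unfolding clamp_to_def by (intro continuous_intros)
  then show "continuous_on UNIV (\<lambda>x. f (clamp_to t x))"
    using assms clamp_to_in[OF assms(1)] by (intro continuous_on_compose2[OF assms(2)]) auto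
qed

text \<open>Up to constants, the fractional integral of order \<open>1 + \<delta>\<close> of the derivative of order \<open>\<delta>\<close> is the
ordinary integral.  It holds for interpolations by the previous lemma, and both sides pass to the
limit: interpolation keeps the Hoelder constant up to the factor \<open>3\<close>, so a single integrable majorant
dominates all singular integrals because \<open>\<delta> < \<gamma>\<close>.\<close>

lemma integral_marchaud_ramp:
  assumes \<delta>: "0 < \<delta>" "\<delta> < \<gamma>" "\<gamma> \<le> 1" "\<delta> < 1" and t: "0 < t" and c: "0 \<le> c" "c \<le> t" and C: "0 \<le> C"
    and [measurable]: "f \<in> borel_measurable borel"
    and f0: "f 0 = 0" and fcl: "\<And>x. f x = f (clamp_to t x)"
    and f: "\<And>u v. u \<in> {0..t} \<Longrightarrow> v \<in> {0..t} \<Longrightarrow> \<bar>f u - f v\<bar> \<le> C * \<bar>u - v\<bar> powr \<gamma>"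
  shows "(LINT x|lborel. indicator {0..t} x * (marchaud \<delta> f x * (max 0 (c - x)) powr \<delta>))
    = Gamma (1 + \<delta>) * (LINT x|lborel. indicator {0..c} x * f x)"
proof -
  define F where "F n = interp t (Suc n) f" for n
  define J where "J = (LINT z|lborel. (min z t) powr \<gamma> * kernel \<delta> z)"
  have \<gamma>: "0 < \<gamma>" using \<delta> by simp
  have [measurable]: "F n \<in> borel_measurable borel" for n by (simp add: F_def)
  have Fh: "\<bar>F n u - F n v\<bar> \<le> 3 * C * (min \<bar>u - v\<bar> t) powr \<gamma>" for n u v
    unfolding F_def using f by (intro interp_holder[OF t \<gamma> \<delta>(3) C]) auto
  have cont: "continuous_on {0..t} f" using f \<gamma> C by (rule holder_continuous_on)
  have Flim: "(\<lambda>n. F n x) \<longlonglongrightarrow> f x" for x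
  proof -
    have "(\<lambda>n. F n (clamp_to t x)) \<longlonglongrightarrow> f (clamp_to t x)"
      unfolding F_def using t by (intro interp_tendsto cont clamp_to_in) auto
    moreover have "F n (clamp_to t x) = F n x" for n
      unfolding F_def using interp_clamp[of t "Suc n" f x] t by simp
    ultimately show ?thesis using fcl[of x] by simp
  qed
  have int: "integrable lborel (\<lambda>z. 3 * C * ((min z t) powr \<gamma> * kernel \<delta> z))"
    using integrable_min_powr_kernel[OF \<delta>(1,2) t] by simp
  have Mlim: "(\<lambda>n. marchaud \<delta> (F n) x) \<longlonglongrightarrow> marchaud \<delta> f x" for x
    unfolding marchaud_def
  proof (intro tendsto_mult tendsto_const)
    show "(\<lambda>n. LINT z|lborel. (F n x - F n (x - z)) * kernel \<delta> z) \<longlonglongrightarrow> (LINT z|lborel. (f x - f (x - z)) * kernel \<delta> z)"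
    proof (rule integral_dominated_convergence[OF _ _ int])
      show "AE z in lborel. (\<lambda>n. (F n x - F n (x - z)) * kernel \<delta> z) \<longlonglongrightarrow> (f x - f (x - z)) * kernel \<delta> z"
        by (intro AE_I2 tendsto_intros Flim)
      show "AE z in lborel. norm ((F n x - F n (x - z)) * kernel \<delta> z) \<le> 3 * C * ((min z t) powr \<gamma> * kernel \<delta> z)" for n
      proof (rule AE_I2)
        fix z
        show "norm ((F n x - F n (x - z)) * kernel \<delta> z) \<le> 3 * C * ((min z t) powr \<gamma> * kernel \<delta> z)"
        proof (cases "0 < z")
          case True
          then show ?thesis using mult_right_mono[OF Fh[of n x "x - z"], of "kernel \<delta> z"]
            by (simp add: abs_mult mult.assoc)
        qed (simp add: kernel_def)
      qed
    qed measurable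
  qed
  define K where "K = \<delta> / Gamma (1 - \<delta>) * (3 * C * J)"
  have Mb: "\<bar>marchaud \<delta> (F n) x\<bar> \<le> K" for n x
    unfolding K_def J_def using C by (intro marchaud_holder(2)[OF \<delta>(1,2,4) t _ _ Fh]) auto
  have "0 \<le> K" using Mb[of 0 0] by linarith
  have lim1: "(\<lambda>n. LINT x|lborel. indicator {0..t} x * (marchaud \<delta> (F n) x * (max 0 (c - x)) powr \<delta>))
      \<longlonglongrightarrow> (LINT x|lborel. indicator {0..t} x * (marchaud \<delta> f x * (max 0 (c - x)) powr \<delta>))"
  proof (rule integral_dominated_convergence[where w = "\<lambda>x. indicator {0..t} x * (K * c powr \<delta>)"])
    show "integrable lborel (\<lambda>x. indicator {0..t} x * (K * c powr \<delta>))"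
      using t by (auto intro!: integrable_real_indicator)
    show "AE x in lborel. (\<lambda>n. indicator {0..t} x * (marchaud \<delta> (F n) x * (max 0 (c - x)) powr \<delta>))
        \<longlonglongrightarrow> indicator {0..t} x * (marchaud \<delta> f x * (max 0 (c - x)) powr \<delta>)"
      by (intro AE_I2 tendsto_mult tendsto_const Mlim)
    show "AE x in lborel. norm (indicator {0..t} x * (marchaud \<delta> (F n) x * (max 0 (c - x)) powr \<delta>))
        \<le> indicator {0..t} x * (K * c powr \<delta>)" for n
    proof (rule AE_I2)
      fix x
      have "\<bar>marchaud \<delta> (F n) x\<bar> * (max 0 (c - x)) powr \<delta> \<le> K * c powr \<delta>" if "x \<in> {0..t}"
        using Mb[of n x] \<open>0 \<le> K\<close> that c \<delta> by (intro mult_mono powr_mono2) auto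
      then show "norm (indicator {0..t} x * (marchaud \<delta> (F n) x * (max 0 (c - x)) powr \<delta>))
        \<le> indicator {0..t} x * (K * c powr \<delta>)" by (simp add: indicator_def abs_mult)
    qed
  qed measurable
  have lim2: "(\<lambda>n. Gamma (1 + \<delta>) * (LINT x|lborel. indicator {0..c} x * F n x))
      \<longlonglongrightarrow> Gamma (1 + \<delta>) * (LINT x|lborel. indicator {0..c} x * f x)"
  proof (intro tendsto_mult tendsto_const integral_dominated_convergence[where w = "\<lambda>x. indicator {0..c} x * (3 * C * t powr \<gamma>)"])
    show "integrable lborel (\<lambda>x. indicator {0..c} x * (3 * C * t powr \<gamma>))"
      using c by (auto intro!: integrable_real_indicator)
    show "AE x in lborel. (\<lambda>n. indicator {0..c} x * F n x) \<longlonglongrightarrow> indicator {0..c} x * f x"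
      by (intro AE_I2 tendsto_mult tendsto_const Flim)
    show "AE x in lborel. norm (indicator {0..c} x * F n x) \<le> indicator {0..c} x * (3 * C * t powr \<gamma>)" for n
    proof (rule AE_I2)
      fix x
      have "F n 0 = 0" using interp_clamp[of t "Suc n" f 0] t f0 by (simp add: F_def interp_def ramp_def node_def)
      have "\<bar>F n x\<bar> \<le> 3 * C * (min \<bar>x - 0\<bar> t) powr \<gamma>" using Fh[of n x 0] \<open>F n 0 = 0\<close> by simp
      also have "\<dots> \<le> 3 * C * t powr \<gamma>" using C \<gamma> t by (intro mult_left_mono powr_mono2) auto
      finally show "norm (indicator {0..c} x * F n x) \<le> indicator {0..c} x * (3 * C * t powr \<gamma>)"
        by (simp add: indicator_def)
    qed
  qed measurable
  have eq: "(LINT x|lborel. indicator {0..t} x * (marchaud \<delta> (F n) x * (max 0 (c - x)) powr \<delta>))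
     = Gamma (1 + \<delta>) * (LINT x|lborel. indicator {0..c} x * F n x)" for n
    unfolding F_def by (rule integral_marchaud_interp[of \<delta> t "Suc n" c f, OF \<delta>(1,4) t zero_less_Suc c f0])
  show ?thesis
    using LIMSEQ_unique[OF lim1[unfolded eq] lim2] .
qed

text \<open>The right-sided Marchaud integral without its normalizing constant.\<close>

definition forward_integral :: "real \<Rightarrow> (real \<Rightarrow> real) \<Rightarrow> real \<Rightarrow> real" where
  "forward_integral \<delta> h x = (LINT z|lborel. (h x - h (x + z)) * kernel \<delta> z)"

lemma borel_measurable_forward_integral [measurable]:
  assumes [measurable]: "h \<in> borel_measurable borel"
  shows "forward_integral \<delta> h \<in> borel_measurable borel"
  unfolding forward_integral_def[abs_def] by measurable

text \<open>Reflection of \<open>has_integral_kernel_ramp\<close>: the positive parts of \<open>a - x\<close> replace those of \<open>x - a\<close>.\<close>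

lemma forward_integral_interp:
  assumes \<delta>: "0 < \<delta>" "\<delta> < 1" and t: "0 < t" and n: "0 < n"
  shows "has_bochner_integral lborel (\<lambda>z. (interp t n h x - interp t n h (x + z)) * kernel \<delta> z)
    (\<Sum>i<n. (h (node t n (Suc i)) - h (node t n i)) *
     (((max 0 (node t n i - x)) powr (1 - \<delta>) / (\<delta> * (1 - \<delta>)) - (max 0 (node t n (Suc i) - x)) powr (1 - \<delta>) / (\<delta> * (1 - \<delta>))) / (t / real n)))"
proof -
  let ?D = "\<lambda>i. h (node t n (Suc i)) - h (node t n i)"
  have k: "has_bochner_integral lborel (\<lambda>z. (max 0 (a - x) - max 0 (a - (x + z))) * kernel \<delta> z)
     ((max 0 (a - x)) powr (1 - \<delta>) / (\<delta> * (1 - \<delta>)))" for a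
    using has_integral_kernel_ramp[OF \<delta>, of "- x" "- a"] by (simp add: algebra_simps)
  have eq: "(interp t n h x - interp t n h (x + z)) * kernel \<delta> z = (\<Sum>i<n. ?D i *
     (((max 0 (node t n i - x) - max 0 (node t n i - (x + z))) * kernel \<delta> z
       - (max 0 (node t n (Suc i) - x) - max 0 (node t n (Suc i) - (x + z))) * kernel \<delta> z) / (t / real n)))" for z
  proof -
    have alg: "(d * (1 - (v - u) / s) - d * (1 - (v' - u') / s)) * w = d * (((u - u') * w - (v - v') * w) / s)"
      for d u v u' v' s w :: real by (cases "s = 0") (simp_all add: field_simps)
    have "interp t n h x - interp t n h (x + z) = (\<Sum>i<n. ?D i * ramp t n i x - ?D i * ramp t n i (x + z))"
      by (simp add: interp_def sum_subtractf)
    then show ?thesis by (simp only: sum_distrib_right ramp_right[OF t n] alg)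
  qed
  show ?thesis
    unfolding eq
    by (intro has_bochner_integral_sum has_bochner_integral_mult_right has_bochner_integral_divide_zero
        has_bochner_integral_diff k)
qed

section \<open>The fractional integral of a Hoelder function\<close>

lemma borel_measurable_weyl_deriv_left [measurable]:
  assumes [measurable]: "f \<in> borel_measurable borel"
  shows "weyl_deriv_left \<delta> f \<in> borel_measurable borel"
proof -
  have eq: "(LINT y|lebesgue_on {0..x}. (f x - f y) / (x - y) powr (\<delta> + 1))
     = (LINT y|lborel. (if 0 \<le> y \<and> y \<le> x then 1 else 0) * ((f x - f y) / (x - y) powr (\<delta> + 1)))" for x
    by (subst LINT_lebesgue_on_borel) (auto intro!: Bochner_Integration.integral_cong simp: indicator_def)
  show ?thesis unfolding weyl_deriv_left_def[abs_def] eq by measurable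
qed

lemma borel_measurable_weyl_deriv_right [measurable]:
  assumes [measurable]: "f \<in> borel_measurable borel"
  shows "weyl_deriv_right \<delta> t f \<in> borel_measurable borel"
proof -
  have "weyl_deriv_right \<delta> t f = (\<lambda>x. weyl_deriv_left \<delta> (\<lambda>s. f (t - s)) (t - x))"
    using weyl_deriv_right_reflect[of f \<delta> t] by auto
  also have "\<dots> \<in> borel_measurable borel" by measurable
  finally show ?thesis .
qed

lemma weyl_deriv_left_cong:
  assumes "\<And>y. y \<in> {0..x} \<Longrightarrow> f y = g y" "0 \<le> x"
  shows "weyl_deriv_left \<delta> f x = weyl_deriv_left \<delta> g x"
proof -
  have "(LINT y|lebesgue_on {0..x}. (f x - f y) / (x - y) powr (\<delta> + 1))
    = (LINT y|lebesgue_on {0..x}. (g x - g y) / (x - y) powr (\<delta> + 1))"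
    using assms by (intro Bochner_Integration.integral_cong) auto
  then show ?thesis using assms by (simp add: weyl_deriv_left_def)
qed

lemma weyl_deriv_right_cong:
  assumes "\<And>y. y \<in> {x..t} \<Longrightarrow> f y = g y" "x \<le> t"
  shows "weyl_deriv_right \<delta> t f x = weyl_deriv_right \<delta> t g x"
proof -
  have "(LINT y|lebesgue_on {x..t}. (f x - f y) / (y - x) powr (\<delta> + 1))
    = (LINT y|lebesgue_on {x..t}. (g x - g y) / (y - x) powr (\<delta> + 1))"
    using assms by (intro Bochner_Integration.integral_cong) auto
  then show ?thesis using assms by (simp add: weyl_deriv_right_def)
qed

text \<open>The exponent \<open>\<gamma>\<close> may be lowered at will as long as it exceeds \<open>\<epsilon>\<close>; \<open>\<gamma> \<le> 1\<close> is what interpolation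
requires.\<close>

locale holder_integrand =
  fixes \<epsilon> \<gamma> C t :: real and b :: "real \<Rightarrow> real"
  assumes eps: "0 < \<epsilon>" "\<epsilon> < 1" "\<epsilon> < \<gamma>" "\<gamma> \<le> 1" and C: "0 \<le> C" and t: "0 < t"
    and holder: "\<And>u v. u \<in> {0..t} \<Longrightarrow> v \<in> {0..t} \<Longrightarrow> \<bar>b u - b v\<bar> \<le> C * \<bar>u - v\<bar> powr \<gamma>"
begin

text \<open>The integrand minus its initial value, extended by constants, so that it vanishes on the negative half-line.\<close>

definition b_centered :: "real \<Rightarrow> real" where "b_centered s = b (clamp_to t s) - b 0"

definition left_deriv :: "real \<Rightarrow> real" where "left_deriv = marchaud \<epsilon> b_centered"

definition left_deriv_bound :: real where
  "left_deriv_bound = \<epsilon> / Gamma (1 - \<epsilon>) * (C * (LINT z|lborel. (min z t) powr \<gamma> * kernel \<epsilon> z))"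

lemma b_continuous: "continuous_on {0..t} b"
  using holder eps C by (intro holder_continuous_on[where C=C and \<gamma>=\<gamma>]) auto

lemma b_centered_measurable [measurable]: "b_centered \<in> borel_measurable borel"
proof -
  have [measurable]: "(\<lambda>x. b (clamp_to t x)) \<in> borel_measurable borel"
    using t by (intro continuous_clamp_measurable b_continuous) auto
  show ?thesis unfolding b_centered_def[abs_def] by (rule borel_measurable_diff) auto
qed

lemma left_deriv_measurable [measurable]: "left_deriv \<in> borel_measurable borel"
  unfolding left_deriv_def by measurable

lemma b_centered_holder: "\<bar>b_centered u - b_centered v\<bar> \<le> C * (min \<bar>u - v\<bar> t) powr \<gamma>"
proof -
  have "\<bar>b_centered u - b_centered v\<bar> \<le> C * \<bar>clamp_to t u - clamp_to t v\<bar> powr \<gamma>"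
    using holder[of "clamp_to t u" "clamp_to t v"] clamp_to_in[of t] t by (auto simp: b_centered_def simp del: atLeastAtMost_iff)
  also have "\<dots> \<le> C * (min \<bar>u - v\<bar> t) powr \<gamma>"
    using C eps t clamp_to_dist[of t u v] clamp_to_dist_t[of t u v] by (intro mult_left_mono powr_mono2) auto
  finally show ?thesis .
qed

lemma b_centered_integrable: "integrable lborel (\<lambda>z. (b_centered x - b_centered (x - z)) * kernel \<epsilon> z)"
  using eps C t by (intro marchaud_holder(1)[OF _ _ _ _ _ _ b_centered_holder]) auto

lemma abs_left_deriv_le: "\<bar>left_deriv x\<bar> \<le> left_deriv_bound"
  unfolding left_deriv_def left_deriv_bound_def using eps C t by (intro marchaud_holder(2)[OF _ _ _ _ _ _ b_centered_holder]) auto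

lemma left_deriv_bound_nonneg: "0 \<le> left_deriv_bound" using abs_left_deriv_le[of 0] by linarith

lemma left_deriv_eq: "0 < x \<Longrightarrow> weyl_deriv_left \<epsilon> b_centered x = left_deriv x"
  unfolding left_deriv_def
proof (rule weyl_deriv_left_eq_marchaud)
  show "b_centered s = 0" if "s \<le> 0" for s using that t by (simp add: b_centered_def clamp_to_def)
qed (use eps b_centered_integrable in auto)

text \<open>Both Weyl derivatives become singular integrals over the half-line.  The absolute convergence of the
one for \<open>h\<close> is assumed for almost every \<open>x\<close> only, because for random paths it is obtained from finite
expectations.\<close>

lemma fractional_integral_eq:
  assumes hm [measurable]: "(\<lambda>x. h (clamp_to t x)) \<in> borel_measurable borel"
    and int: "AE x in lborel. x \<in> {0..t} \<longrightarrow>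
      integrable lborel (\<lambda>z. (h (clamp_to t x) - h (clamp_to t (x + z))) * kernel (1 - \<epsilon>) z)"
  shows "fractional_integral \<epsilon> b h t = b 0 * (h t - h 0)
    - (1 - \<epsilon>) / Gamma \<epsilon> * (LINT x|lborel. indicator {0..t} x * (left_deriv x * forward_integral (1 - \<epsilon>) (\<lambda>x. h (clamp_to t x)) x))"
proof -
  define \<eta> where "\<eta> = 1 - \<epsilon>"
  have \<eta>: "0 < \<eta>" "\<eta> < 1" "1 - \<eta> = \<epsilon>" using eps by (auto simp: \<eta>_def)
  define k where "k s = h (clamp_to t s) - h t" for s
  have [measurable]: "k \<in> borel_measurable borel" unfolding k_def[abs_def] by measurable
  have 1: "(LINT x|lebesgue_on {0..t}. weyl_deriv_left \<epsilon> (\<lambda>s. b s - b 0) x * weyl_deriv_right (1 - \<epsilon>) t (\<lambda>s. h s - h t) x)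
    = (LINT x|lebesgue_on {0..t}. weyl_deriv_left \<epsilon> b_centered x * weyl_deriv_right \<eta> t k x)"
  proof (rule Bochner_Integration.integral_cong[OF refl])
    fix x assume "x \<in> space (lebesgue_on {0..t})"
    then have x: "0 \<le> x" "x \<le> t" by auto
    have "weyl_deriv_left \<epsilon> (\<lambda>s. b s - b 0) x = weyl_deriv_left \<epsilon> b_centered x"
      using x by (intro weyl_deriv_left_cong) (auto simp: b_centered_def clamp_to_id)
    moreover have "weyl_deriv_right (1 - \<epsilon>) t (\<lambda>s. h s - h t) x = weyl_deriv_right \<eta> t k x"
      unfolding \<eta>_def using x by (intro weyl_deriv_right_cong) (auto simp: k_def clamp_to_id)
    ultimately show "weyl_deriv_left \<epsilon> (\<lambda>s. b s - b 0) x * weyl_deriv_right (1 - \<epsilon>) t (\<lambda>s. h s - h t) x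
      = weyl_deriv_left \<epsilon> b_centered x * weyl_deriv_right \<eta> t k x" by simp
  qed
  have 2: "\<dots> = (LINT x|lborel. indicator {0..t} x * (weyl_deriv_left \<epsilon> b_centered x * weyl_deriv_right \<eta> t k x))"
    by (rule LINT_lebesgue_on_borel) measurable
  have 3: "\<dots> = (LINT x|lborel. \<eta> / Gamma \<epsilon> * (indicator {0..t} x * (left_deriv x * forward_integral \<eta> (\<lambda>x. h (clamp_to t x)) x)))"
  proof (rule Bochner_Integration.integral_cong_AE)
    show "AE x in lborel. indicator {0..t} x * (weyl_deriv_left \<epsilon> b_centered x * weyl_deriv_right \<eta> t k x)
      = \<eta> / Gamma \<epsilon> * (indicator {0..t} x * (left_deriv x * forward_integral \<eta> (\<lambda>x. h (clamp_to t x)) x))"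
      using int AE_lborel_singleton[of 0] AE_lborel_singleton[of t]
    proof eventually_elim
      case (elim x)
      show ?case
      proof (cases "x \<in> {0..t}")
        case True
        then have x: "0 < x" "x < t" using elim by auto
        have "weyl_deriv_right \<eta> t k x = weyl_deriv_left \<eta> (\<lambda>s. k (t - s)) (t - x)"
          by (rule weyl_deriv_right_reflect) measurable
        also have "\<dots> = marchaud \<eta> (\<lambda>s. k (t - s)) (t - x)"
        proof (rule weyl_deriv_left_eq_marchaud)
          show "k (t - s) = 0" if "s \<le> 0" for s using that t by (simp add: k_def clamp_to_def)
          have "t - (t - x - z) = x + z" for z by simp
          then show "integrable lborel (\<lambda>z. (k (t - (t - x)) - k (t - (t - x - z))) * kernel \<eta> z)"
            using elim True by (simp add: k_def \<eta>_def)
        qed (use \<eta> x in auto)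
        also have "\<dots> = \<eta> / Gamma \<epsilon> * forward_integral \<eta> (\<lambda>x. h (clamp_to t x)) x"
        proof -
          have "t - (t - x - z) = x + z" for z by simp
          then show ?thesis unfolding marchaud_def forward_integral_def \<eta>(3) by (simp add: k_def)
        qed
        finally show ?thesis using True left_deriv_eq[OF x(1)] by simp
      qed simp
    qed
  qed measurable
  show ?thesis unfolding fractional_integral_def 1 2 3 by (simp add: \<eta>_def)
qed

lemma interp_ends:
  assumes n: "0 < n"
  shows "interp t n h 0 = h 0" and "interp t n h t = h t"
    and "(\<Sum>i<n. h (node t n (Suc i)) - h (node t n i)) = h t - h 0"
proof -
  show s: "(\<Sum>i<n. h (node t n (Suc i)) - h (node t n i)) = h t - h 0"
    using n by (subst sum_lessThan_telescope) simp
  have "ramp t n i 0 = 0" for i using t by (simp add: ramp_def node_def)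
  then show "interp t n h 0 = h 0" by (simp add: interp_def)
  have "ramp t n i t = 1" if "i < n" for i
    using that node_in[of t n i] node_in[of t n "Suc i"] t n by (subst ramp_right) auto
  then show "interp t n h t = h t" using s by (simp add: interp_def)
qed

text \<open>The mean of \<open>b\<close> over the cell with number \<open>i\<close>, written as a difference of integrals from \<open>0\<close>.\<close>

definition cell_mean :: "nat \<Rightarrow> nat \<Rightarrow> real" where
  "cell_mean n i = ((LINT s|lborel. indicator {0..node t n (Suc i)} s * b (clamp_to t s))
     - (LINT s|lborel. indicator {0..node t n i} s * b (clamp_to t s))) / (t / real n)"

lemma integral_left_deriv_ramp:
  assumes "0 \<le> c" "c \<le> t"
  shows "(LINT x|lborel. indicator {0..t} x * (left_deriv x * (max 0 (c - x)) powr \<epsilon>))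
    = Gamma (1 + \<epsilon>) * (LINT x|lborel. indicator {0..c} x * b_centered x)"
  unfolding left_deriv_def
proof (rule integral_marchaud_ramp)
  show "b_centered x = b_centered (clamp_to t x)" for x
    using t clamp_to_in[of t x] by (simp add: b_centered_def clamp_to_id)
  show "\<bar>b_centered u - b_centered v\<bar> \<le> C * \<bar>u - v\<bar> powr \<gamma>" if "u \<in> {0..t}" "v \<in> {0..t}" for u v
    using that holder[OF that] by (simp add: b_centered_def clamp_to_id)
  show "b_centered 0 = 0" using t by (simp add: b_centered_def clamp_to_def)
qed (use eps t C assms in auto)

lemma integrable_left_deriv_ramp:
  assumes "0 \<le> c" "c \<le> t"
  shows "integrable lborel (\<lambda>x. indicator {0..t} x * (left_deriv x * (max 0 (c - x)) powr \<epsilon>))"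
proof (rule Bochner_Integration.integrable_bound)
  show "integrable lborel (\<lambda>x. indicator {0..t} x * (left_deriv_bound * c powr \<epsilon>))"
    using t by (auto intro!: integrable_real_indicator)
  show "AE x in lborel. norm (indicator {0..t} x * (left_deriv x * (max 0 (c - x)) powr \<epsilon>)) \<le> norm (indicator {0..t} x * (left_deriv_bound * c powr \<epsilon>))"
  proof (rule AE_I2)
    fix x
    have "\<bar>left_deriv x\<bar> * (max 0 (c - x)) powr \<epsilon> \<le> left_deriv_bound * c powr \<epsilon>" if "x \<in> {0..t}"
      using abs_left_deriv_le[of x] left_deriv_bound_nonneg that assms eps by (intro mult_mono powr_mono2) auto
    then show "norm (indicator {0..t} x * (left_deriv x * (max 0 (c - x)) powr \<epsilon>)) \<le> norm (indicator {0..t} x * (left_deriv_bound * c powr \<epsilon>))"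
      using left_deriv_bound_nonneg by (simp add: indicator_def abs_mult)
  qed
qed measurable

lemma left_deriv_forward_integral_interp:
  assumes n: "0 < n"
  shows "has_bochner_integral lborel (\<lambda>x. indicator {0..t} x * (left_deriv x * forward_integral (1 - \<epsilon>) (interp t n h) x))
    (\<Sum>i<n. (h (node t n (Suc i)) - h (node t n i)) * ((Gamma (1 + \<epsilon>) * (LINT x|lborel. indicator {0..node t n i} x * b_centered x) / ((1 - \<epsilon>) * \<epsilon>)
       - Gamma (1 + \<epsilon>) * (LINT x|lborel. indicator {0..node t n (Suc i)} x * b_centered x) / ((1 - \<epsilon>) * \<epsilon>)) / (t / real n)))"
proof -
  let ?D = "\<lambda>i. h (node t n (Suc i)) - h (node t n i)"
  have d: "0 < 1 - \<epsilon>" "1 - \<epsilon> < 1" "1 - (1 - \<epsilon>) = \<epsilon>" using eps by auto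
  have R: "forward_integral (1 - \<epsilon>) (interp t n h) x = (\<Sum>i<n. ?D i *
     (((max 0 (node t n i - x)) powr \<epsilon> / ((1 - \<epsilon>) * \<epsilon>) - (max 0 (node t n (Suc i) - x)) powr \<epsilon> / ((1 - \<epsilon>) * \<epsilon>)) / (t / real n)))" for x
    using forward_integral_interp[OF d(1,2) t n, of h x] unfolding forward_integral_def d(3) by (rule has_bochner_integral_integral_eq)
  have eq: "indicator {0..t} x * (left_deriv x * forward_integral (1 - \<epsilon>) (interp t n h) x) = (\<Sum>i<n. ?D i *
     ((indicator {0..t} x * (left_deriv x * (max 0 (node t n i - x)) powr \<epsilon>) / ((1 - \<epsilon>) * \<epsilon>)
      - indicator {0..t} x * (left_deriv x * (max 0 (node t n (Suc i) - x)) powr \<epsilon>) / ((1 - \<epsilon>) * \<epsilon>)) / (t / real n)))" for x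
  proof -
    have "I * (w * (D * ((u / e - v / e) / s))) = D * ((I * (w * u) / e - I * (w * v) / e) / s)" for I w D u v e s :: real
      by (cases "s = 0"; cases "e = 0") (simp_all add: field_simps)
    then show ?thesis unfolding R by (simp only: sum_distrib_left)
  qed
  have "has_bochner_integral lborel (\<lambda>x. indicator {0..t} x * (left_deriv x * (max 0 (node t n i - x)) powr \<epsilon>))
     (Gamma (1 + \<epsilon>) * (LINT x|lborel. indicator {0..node t n i} x * b_centered x))" if "i \<le> n" for i
    using node_in[of t n i] t n that integral_left_deriv_ramp[of "node t n i"] integrable_left_deriv_ramp[of "node t n i"]
    by (simp add: has_bochner_integral_iff)
  then show ?thesis
    unfolding eq by (intro has_bochner_integral_sum has_bochner_integral_mult_right has_bochner_integral_divide_zero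
        has_bochner_integral_diff) auto
qed

text \<open>The right-sided derivative of an interpolation is a combination of the functions
\<open>(max 0 (c - x)) powr \<epsilon>\<close> with nodes \<open>c\<close>; against the left-sided derivative of \<open>b\<close> they integrate to ordinary
integrals of \<open>b\<close> by \<open>integral_marchaud_ramp\<close>, and all Gamma factors cancel.\<close>

lemma fractional_integral_interp:
  assumes n: "0 < n"
  shows "fractional_integral \<epsilon> b (interp t n h) t
     = (\<Sum>i<n. (h (node t n (Suc i)) - h (node t n i)) * cell_mean n i)"
proof -
  let ?D = "\<lambda>i. h (node t n (Suc i)) - h (node t n i)"
  let ?P = "\<lambda>a. LINT x|lborel. indicator {0..a} x * b_centered x"
  let ?Q = "\<lambda>a. LINT s|lborel. indicator {0..a} s * b (clamp_to t s)"
  have ic: "interp t n h (clamp_to t x) = interp t n h x" for x using interp_clamp[of t n h x] t by simp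
  have d: "0 < 1 - \<epsilon>" "1 - \<epsilon> < 1" "1 - (1 - \<epsilon>) = \<epsilon>" using eps by auto
  have Q: "?Q a = ?P a + b 0 * a" if a: "0 \<le> a" for a
  proof -
    have "integrable lborel (\<lambda>x. indicator {0..a} x * b_centered x)"
    proof (rule Bochner_Integration.integrable_bound)
      show "integrable lborel (\<lambda>x. indicator {0..a} x * (C * t powr \<gamma>))"
        using a by (auto intro!: integrable_real_indicator)
      show "AE x in lborel. norm (indicator {0..a} x * b_centered x) \<le> norm (indicator {0..a} x * (C * t powr \<gamma>))"
      proof (rule AE_I2)
        fix x
        have "\<bar>b_centered x\<bar> \<le> C * (min \<bar>x - 0\<bar> t) powr \<gamma>" using b_centered_holder[of x 0] t by (simp add: b_centered_def clamp_to_def)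
        also have "\<dots> \<le> C * t powr \<gamma>" using C eps t by (intro mult_left_mono powr_mono2) auto
        finally show "norm (indicator {0..a} x * b_centered x) \<le> norm (indicator {0..a} x * (C * t powr \<gamma>))"
          using C by (simp add: indicator_def)
      qed
    qed measurable
    moreover have "integrable lborel (\<lambda>x. indicator {0..a} x * b 0)" using a by (auto intro!: integrable_real_indicator)
    moreover have "?Q a = (LINT x|lborel. indicator {0..a} x * b_centered x + indicator {0..a} x * b 0)"
      by (rule Bochner_Integration.integral_cong) (auto simp: b_centered_def indicator_def)
    ultimately show ?thesis using a by (simp add: mult.commute)
  qed
  have np: "0 \<le> node t n i" for i using t by (simp add: node_def)
  have "fractional_integral \<epsilon> b (interp t n h) t = b 0 * (h t - h 0)
    - (1 - \<epsilon>) / Gamma \<epsilon> * (LINT x|lborel. indicator {0..t} x * (left_deriv x * forward_integral (1 - \<epsilon>) (interp t n h) x))"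
  proof (subst fractional_integral_eq)
    show "(\<lambda>x. interp t n h (clamp_to t x)) \<in> borel_measurable borel" unfolding ic by measurable
    show "AE x in lborel. x \<in> {0..t} \<longrightarrow> integrable lborel
        (\<lambda>z. (interp t n h (clamp_to t x) - interp t n h (clamp_to t (x + z))) * kernel (1 - \<epsilon>) z)"
      unfolding ic using forward_integral_interp[OF d(1,2) t n, of h] by (auto simp: has_bochner_integral_iff)
  qed (simp add: ic interp_ends[OF n])
  also have "b 0 * (h t - h 0) = (\<Sum>i<n. ?D i * b 0)"
    unfolding interp_ends(3)[OF n, symmetric] by (simp add: sum_distrib_left mult.commute)
  also have "(LINT x|lborel. indicator {0..t} x * (left_deriv x * forward_integral (1 - \<epsilon>) (interp t n h) x)) =
     (\<Sum>i<n. ?D i * ((Gamma (1 + \<epsilon>) * ?P (node t n i) / ((1 - \<epsilon>) * \<epsilon>)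
       - Gamma (1 + \<epsilon>) * ?P (node t n (Suc i)) / ((1 - \<epsilon>) * \<epsilon>)) / (t / real n)))"
    by (rule has_bochner_integral_integral_eq[OF left_deriv_forward_integral_interp[OF n]])
  also have "(\<Sum>i<n. ?D i * b 0) - (1 - \<epsilon>) / Gamma \<epsilon> * \<dots> = (\<Sum>i<n. ?D i * cell_mean n i)"
    unfolding sum_distrib_left sum_subtractf[symmetric]
  proof (rule sum.cong[OF refl])
    fix i
    have "\<epsilon> \<notin> \<int>\<^sub>\<le>\<^sub>0" using eps by (auto elim!: nonpos_Ints_cases)
    from Gamma_plus1[OF this] have G: "Gamma (1 + \<epsilon>) = \<epsilon> * Gamma \<epsilon>" by (simp add: add.commute)
    have G0: "Gamma \<epsilon> \<noteq> 0" using eps Gamma_real_pos[of \<epsilon>] by linarith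
    have s: "t / real n \<noteq> 0" using t n by simp
    have alg: "D * b0 - e / G * (D * ((\<epsilon> * G * u / (e * \<epsilon>) - \<epsilon> * G * v / (e * \<epsilon>)) / s)) = D * ((v - u + b0 * s) / s)"
      if "e \<noteq> 0" "G \<noteq> 0" "s \<noteq> 0" for D b0 e G u v s :: real
      using that eps by (simp add: field_simps)
    have "cell_mean n i = (?P (node t n (Suc i)) - ?P (node t n i) + b 0 * (t / real n)) / (t / real n)"
      unfolding cell_mean_def Q[OF np] by (simp add: node_Suc algebra_simps)
    then show "?D i * b 0 - (1 - \<epsilon>) / Gamma \<epsilon> * (?D i * ((Gamma (1 + \<epsilon>) * ?P (node t n i) / ((1 - \<epsilon>) * \<epsilon>)
       - Gamma (1 + \<epsilon>) * ?P (node t n (Suc i)) / ((1 - \<epsilon>) * \<epsilon>)) / (t / real n))) = ?D i * cell_mean n i"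
      unfolding G using alg[of "1 - \<epsilon>" "Gamma \<epsilon>" "t / real n", OF _ G0 s] eps by simp
  qed
  finally show ?thesis .
qed

text \<open>The left-sided derivative of \<open>b\<close> is bounded, so the difference of the integrals is at most a multiple of
the integral of \<open>\<bar>forward_integral (1 - \<epsilon>) D x\<bar>\<close>, where \<open>D\<close> is the interpolation error.  If the double
integral on the right is finite, then the singular integrals for \<open>h\<close> converge for almost all \<open>x\<close>, as they
do for its interpolation.\<close>

lemma fractional_integral_stability:
  assumes hm [measurable]: "(\<lambda>x. h (clamp_to t x)) \<in> borel_measurable borel" and n: "0 < n"
  defines "D \<equiv> \<lambda>x. h (clamp_to t x) - interp t n h x"
  shows "ennreal \<bar>fractional_integral \<epsilon> b h t - fractional_integral \<epsilon> b (interp t n h) t\<bar>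
    \<le> ennreal ((1 - \<epsilon>) / Gamma \<epsilon> * left_deriv_bound + 1) *
      (\<integral>\<^sup>+x. (\<integral>\<^sup>+z. ennreal (indicator {0..t} x * (\<bar>D x - D (x + z)\<bar> * kernel (1 - \<epsilon>) z)) \<partial>lborel) \<partial>lborel)"
    (is "_ \<le> ennreal ?K * ?S")
proof (cases "?S < \<infinity>")
  case True
  let ?hc = "\<lambda>x. h (clamp_to t x)" and ?hn = "interp t n h"
  define \<eta> where "\<eta> = 1 - \<epsilon>"
  have \<eta>: "0 < \<eta>" "\<eta> < 1" using eps by (auto simp: \<eta>_def)
  have [measurable]: "D \<in> borel_measurable borel" unfolding D_def by measurable
  have ic: "?hn (clamp_to t x) = ?hn x" for x using interp_clamp[of t n h x] t by simp
  have G: "0 < Gamma \<epsilon>" using eps by simp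
  have fin: "AE x in lborel. (\<integral>\<^sup>+z. ennreal (indicator {0..t} x * (\<bar>D x - D (x + z)\<bar> * kernel \<eta> z)) \<partial>lborel) \<noteq> \<infinity>"
    using True unfolding \<eta>_def by (intro nn_integral_PInf_AE) auto
  have intn: "integrable lborel (\<lambda>z. (?hn x - ?hn (x + z)) * kernel \<eta> z)" for x
    using forward_integral_interp[OF \<eta> t n, of h x] by (auto simp: has_bochner_integral_iff)
  have intD: "AE x in lborel. x \<in> {0..t} \<longrightarrow> integrable lborel (\<lambda>z. (D x - D (x + z)) * kernel \<eta> z)"
    using fin
  proof eventually_elim
    case (elim x)
    show ?case
    proof
      assume "x \<in> {0..t}"
      then show "integrable lborel (\<lambda>z. (D x - D (x + z)) * kernel \<eta> z)"
        using elim by (intro integrableI_bounded) (auto simp: abs_mult less_top)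
    qed
  qed
  have split: "(?hc x - ?hc (x + z)) * kernel \<eta> z = (D x - D (x + z)) * kernel \<eta> z + (?hn x - ?hn (x + z)) * kernel \<eta> z" for x z
    by (simp add: D_def algebra_simps)
  have inth: "AE x in lborel. x \<in> {0..t} \<longrightarrow> integrable lborel (\<lambda>z. (?hc x - ?hc (x + z)) * kernel \<eta> z)"
    using intD unfolding split by eventually_elim (use intn in auto)
  have R: "AE x in lborel. x \<in> {0..t} \<longrightarrow> forward_integral \<eta> ?hc x = forward_integral \<eta> D x + forward_integral \<eta> ?hn x"
    using intD unfolding forward_integral_def split by eventually_elim (use intn in auto)
  have WD: "(\<integral>\<^sup>+x. ennreal \<bar>indicator {0..t} x * (left_deriv x * forward_integral \<eta> D x)\<bar> \<partial>lborel) \<le> ennreal left_deriv_bound * ?S"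
  proof -
    have "(\<integral>\<^sup>+x. ennreal \<bar>indicator {0..t} x * (left_deriv x * forward_integral \<eta> D x)\<bar> \<partial>lborel)
      \<le> (\<integral>\<^sup>+x. ennreal left_deriv_bound * (\<integral>\<^sup>+z. ennreal (indicator {0..t} x * (\<bar>D x - D (x + z)\<bar> * kernel \<eta> z)) \<partial>lborel) \<partial>lborel)"
    proof (intro nn_integral_mono_AE)
      show "AE x in lborel. ennreal \<bar>indicator {0..t} x * (left_deriv x * forward_integral \<eta> D x)\<bar>
        \<le> ennreal left_deriv_bound * (\<integral>\<^sup>+z. ennreal (indicator {0..t} x * (\<bar>D x - D (x + z)\<bar> * kernel \<eta> z)) \<partial>lborel)"
        using intD
      proof eventually_elim
        case (elim x)
        show ?case
        proof (cases "x \<in> {0..t}")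
          case True
          then have "ennreal \<bar>forward_integral \<eta> D x\<bar> \<le> (\<integral>\<^sup>+z. ennreal (norm ((D x - D (x + z)) * kernel \<eta> z)) \<partial>lborel)"
            unfolding forward_integral_def using elim integral_norm_bound_ennreal[of lborel "\<lambda>z. (D x - D (x + z)) * kernel \<eta> z"] by simp
          then have "ennreal \<bar>left_deriv x\<bar> * ennreal \<bar>forward_integral \<eta> D x\<bar> \<le> ennreal left_deriv_bound * (\<integral>\<^sup>+z. ennreal (norm ((D x - D (x + z)) * kernel \<eta> z)) \<partial>lborel)"
            using abs_left_deriv_le by (intro mult_mono ennreal_leI) auto
          then show ?thesis using True by (simp add: abs_mult ennreal_mult)
        qed simp
      qed
    qed
    also have "\<dots> = ennreal left_deriv_bound * ?S" unfolding \<eta>_def by (rule nn_integral_cmult) measurable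
    finally show ?thesis .
  qed
  have iWD: "integrable lborel (\<lambda>x. indicator {0..t} x * (left_deriv x * forward_integral \<eta> D x))"
  proof (rule integrableI_bounded)
    have "ennreal left_deriv_bound * ?S < \<infinity>" using True by (simp add: ennreal_mult_less_top)
    then show "(\<integral>\<^sup>+x. ennreal (norm (indicator {0..t} x * (left_deriv x * forward_integral \<eta> D x))) \<partial>lborel) < \<infinity>"
      using WD by (simp add: le_less_trans)
  qed measurable
  have iWn: "integrable lborel (\<lambda>x. indicator {0..t} x * (left_deriv x * forward_integral \<eta> ?hn x))"
    using left_deriv_forward_integral_interp[OF n, of h] by (auto simp: has_bochner_integral_iff \<eta>_def)
  have FIh: "fractional_integral \<epsilon> b h t = b 0 * (h t - h 0)
     - \<eta> / Gamma \<epsilon> * (LINT x|lborel. indicator {0..t} x * (left_deriv x * forward_integral \<eta> ?hc x))"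
    unfolding \<eta>_def by (rule fractional_integral_eq[OF hm]) (use inth in \<open>simp add: \<eta>_def\<close>)
  have FIn: "fractional_integral \<epsilon> b ?hn t = b 0 * (h t - h 0)
     - \<eta> / Gamma \<epsilon> * (LINT x|lborel. indicator {0..t} x * (left_deriv x * forward_integral \<eta> ?hn x))"
    using fractional_integral_eq[of ?hn] intn by (simp add: ic interp_ends[OF n] \<eta>_def)
  have "(LINT x|lborel. indicator {0..t} x * (left_deriv x * forward_integral \<eta> ?hc x))
     = (LINT x|lborel. indicator {0..t} x * (left_deriv x * forward_integral \<eta> D x) + indicator {0..t} x * (left_deriv x * forward_integral \<eta> ?hn x))"
  proof (rule Bochner_Integration.integral_cong_AE)
    show "AE x in lborel. indicator {0..t} x * (left_deriv x * forward_integral \<eta> ?hc x) = indicator {0..t} x * (left_deriv x * forward_integral \<eta> D x) + indicator {0..t} x * (left_deriv x * forward_integral \<eta> ?hn x)"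
      using R by eventually_elim (auto simp: indicator_def algebra_simps)
  qed measurable
  also have "\<dots> = (LINT x|lborel. indicator {0..t} x * (left_deriv x * forward_integral \<eta> D x)) + (LINT x|lborel. indicator {0..t} x * (left_deriv x * forward_integral \<eta> ?hn x))"
    using iWD iWn by (rule Bochner_Integration.integral_add)
  finally have "fractional_integral \<epsilon> b h t - fractional_integral \<epsilon> b ?hn t
     = - (\<eta> / Gamma \<epsilon> * (LINT x|lborel. indicator {0..t} x * (left_deriv x * forward_integral \<eta> D x)))"
    unfolding FIh FIn by (simp add: algebra_simps)
  then have "\<bar>fractional_integral \<epsilon> b h t - fractional_integral \<epsilon> b ?hn t\<bar>
     = \<eta> / Gamma \<epsilon> * \<bar>LINT x|lborel. indicator {0..t} x * (left_deriv x * forward_integral \<eta> D x)\<bar>"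
    using \<eta> G by (simp add: abs_mult)
  then have "ennreal \<bar>fractional_integral \<epsilon> b h t - fractional_integral \<epsilon> b ?hn t\<bar>
     = ennreal (\<eta> / Gamma \<epsilon>) * ennreal \<bar>LINT x|lborel. indicator {0..t} x * (left_deriv x * forward_integral \<eta> D x)\<bar>"
    using \<eta> G by (simp only:) (rule ennreal_mult; simp)
  also have "\<dots> \<le> ennreal (\<eta> / Gamma \<epsilon>) * (ennreal left_deriv_bound * ?S)"
    using integral_norm_bound_ennreal[OF iWD] WD by (intro mult_left_mono) auto
  also have "\<dots> = ennreal (\<eta> / Gamma \<epsilon> * left_deriv_bound) * ?S"
  proof -
    have "ennreal (\<eta> / Gamma \<epsilon> * left_deriv_bound) = ennreal (\<eta> / Gamma \<epsilon>) * ennreal left_deriv_bound"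
      using \<eta> G left_deriv_bound_nonneg by (intro ennreal_mult) auto
    then show ?thesis by (simp only: mult.assoc)
  qed
  also have "\<dots> \<le> ennreal ?K * ?S"
    by (intro mult_right_mono ennreal_leI) (auto simp: \<eta>_def)
  finally show ?thesis .
next
  case False
  then have "?S = \<infinity>" by (simp add: less_top[symmetric])
  moreover have "0 < ?K" using eps left_deriv_bound_nonneg by (intro add_nonneg_pos mult_nonneg_nonneg) auto
  ultimately show ?thesis by (simp add: ennreal_mult_top)
qed

end

lemma (in holder_integrand) b_clamp_measurable [measurable]: "(\<lambda>s. b (clamp_to t s)) \<in> borel_measurable borel"
  using t by (intro continuous_clamp_measurable b_continuous) auto

lemma (in holder_integrand) b_clamp_integrable:
  shows "integrable lborel (\<lambda>s. indicator {0..a} s * b (clamp_to t s))"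
    and "integrable lborel (\<lambda>s. indicator {0..a} s * (b (clamp_to t s))\<^sup>2)"
proof -
  have "bounded (b ` {0..t})"
    using b_continuous by (intro compact_imp_bounded compact_continuous_image) auto
  then obtain m where "\<forall>x\<in>b ` {0..t}. norm x \<le> m" unfolding bounded_iff by blast
  then have m: "\<bar>b s\<bar> \<le> m" if "s \<in> {0..t}" for s using that by auto
  have m': "\<bar>b (clamp_to t s)\<bar> \<le> m" for s using m clamp_to_in[of t s] t by auto
  have "0 \<le> m" using m'[of 0] by linarith
  have fin: "integrable lborel (\<lambda>s. indicator {0..a} s * k)" for k :: real
    by (intro integrable_mult_left integrable_real_indicator) (auto simp: emeasure_lborel_Icc_eq)
  show "integrable lborel (\<lambda>s. indicator {0..a} s * b (clamp_to t s))"
    by (rule Bochner_Integration.integrable_bound[OF fin[of m]]) (use m' \<open>0 \<le> m\<close> in \<open>auto simp: indicator_def\<close>)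
  have "(b (clamp_to t s))\<^sup>2 \<le> m\<^sup>2" for s using m'[of s] by (simp add: abs_le_square_iff[symmetric])
  then show "integrable lborel (\<lambda>s. indicator {0..a} s * (b (clamp_to t s))\<^sup>2)"
    by (intro Bochner_Integration.integrable_bound[OF fin[of "m\<^sup>2"]]) (auto simp: indicator_def)
qed

text \<open>Cauchy-Schwarz on every cell: the integral of the square of \<open>b\<close> minus its cell mean is nonnegative.\<close>

lemma (in holder_integrand) cell_mean_square:
  assumes n: "0 < n"
  shows "(\<Sum>i<n. (cell_mean n i)\<^sup>2 * (t / real n)) \<le> (LINT u|lebesgue_on {0..t}. (b u)\<^sup>2)"
proof -
  let ?bb = "\<lambda>s. b (clamp_to t s)"
  define Q where "Q a = (LINT s|lborel. indicator {0..a} s * ?bb s)" for a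
  define Q2 where "Q2 a = (LINT s|lborel. indicator {0..a} s * (?bb s)\<^sup>2)" for a
  have d: "0 < t / real n" using t n by simp
  have cell: "(cell_mean n i)\<^sup>2 * (t / real n) \<le> Q2 (node t n (Suc i)) - Q2 (node t n i)" for i
  proof -
    let ?x = "node t n i" and ?y = "node t n (Suc i)" and ?c = "cell_mean n i"
    have x: "0 \<le> ?x" "?x \<le> ?y" "?y - ?x = t / real n" using t d by (auto simp: node_def node_Suc algebra_simps add_divide_distrib)
    have int1: "integrable lborel (\<lambda>s. indicator {0..a} s * k)" for a k :: real
      by (intro integrable_mult_left integrable_real_indicator) (auto simp: emeasure_lborel_Icc_eq)
    have "0 \<le> (LINT s|lborel. (indicator {0..?y} s - indicator {0..?x} s) * (?bb s - ?c)\<^sup>2)"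
      using x by (intro Bochner_Integration.integral_nonneg mult_nonneg_nonneg) (auto simp: indicator_def)
    also have "\<dots> = (LINT s|lborel. (indicator {0..?y} s * (?bb s)\<^sup>2 - indicator {0..?x} s * (?bb s)\<^sup>2)
        - 2 * ?c * (indicator {0..?y} s * ?bb s - indicator {0..?x} s * ?bb s) + (indicator {0..?y} s * ?c\<^sup>2 - indicator {0..?x} s * ?c\<^sup>2))"
      by (intro Bochner_Integration.integral_cong refl) (simp add: power2_diff algebra_simps)
    also have "\<dots> = (Q2 ?y - Q2 ?x) - 2 * ?c * (Q ?y - Q ?x) + (?y * ?c\<^sup>2 - ?x * ?c\<^sup>2)"
      using b_clamp_integrable int1 x by (simp add: Q_def Q2_def)
    also have "Q ?y - Q ?x = ?c * (t / real n)"
      using t n by (simp add: cell_mean_def Q_def)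
    also have "?y * ?c\<^sup>2 - ?x * ?c\<^sup>2 = ?c\<^sup>2 * (t / real n)"
      using x(3) by (metis left_diff_distrib mult.commute)
    finally show ?thesis by (simp add: power2_eq_square algebra_simps)
  qed
  have "(\<Sum>i<n. (cell_mean n i)\<^sup>2 * (t / real n)) \<le> (\<Sum>i<n. Q2 (node t n (Suc i)) - Q2 (node t n i))"
    by (intro sum_mono cell)
  also have "\<dots> = Q2 t - Q2 0" using n by (subst sum_lessThan_telescope) simp
  also have "\<dots> \<le> Q2 t"
    unfolding Q2_def by (simp add: Bochner_Integration.integral_nonneg)
  also have "Q2 t = (LINT u|lebesgue_on {0..t}. (?bb u)\<^sup>2)"
    unfolding Q2_def by (rule LINT_lebesgue_on_borel[symmetric]) measurable
  also have "\<dots> = (LINT u|lebesgue_on {0..t}. (b u)\<^sup>2)"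
    by (rule Bochner_Integration.integral_cong) (auto simp: clamp_to_id)
  finally show ?thesis .
qed

section \<open>Increments of fractional Brownian motion\<close>

lemma powr_midpoint:
  fixes u v p :: real
  assumes "1 \<le> p" "0 \<le> u" "0 \<le> v"
  shows "((u + v) / 2) powr p \<le> (u powr p + v powr p) / 2"
proof -
  have half: "(w / 2) powr p \<le> w powr p / 2" if "0 \<le> w" for w :: real
  proof -
    have "2 powr 1 \<le> (2::real) powr p" using assms by (intro powr_mono) auto
    then have "w powr p / 2 powr p \<le> w powr p / 2" by (intro divide_left_mono) auto
    then show ?thesis using that by (simp only: powr_divide)
  qed
  consider "u = 0" | "v = 0" | "0 < u" "0 < v" using assms by linarith
  then show ?thesis
  proof cases
    case 3
    have "convex_on {0<..} (\<lambda>x::real. x powr p)" using assms by (intro powr_convex)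
    from convex_onD[OF this, of "1/2" u v] 3 show ?thesis by (simp add: field_simps)
  qed (use half assms in auto)
qed

text \<open>Convexity of \<open>\<bar>m\<bar> powr p\<close> for \<open>p \<ge> 1\<close>.  For \<open>p = 2 H\<close> the second difference is, up to scaling, twice
the covariance of two increments of fractional Brownian motion.\<close>

lemma abs_powr_second_difference:
  fixes m p :: real
  assumes "1 \<le> p"
  shows "2 * \<bar>m\<bar> powr p \<le> \<bar>m + 1\<bar> powr p + \<bar>m - 1\<bar> powr p"
proof -
  have "\<bar>m\<bar> powr p \<le> ((\<bar>m + 1\<bar> + \<bar>m - 1\<bar>) / 2) powr p"
    using assms by (intro powr_mono2) auto
  also have "\<dots> \<le> (\<bar>m + 1\<bar> powr p + \<bar>m - 1\<bar> powr p) / 2"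
    using assms by (intro powr_midpoint) auto
  finally show ?thesis by simp
qed

text \<open>The mean value theorem, with a separate argument at \<open>x = 0\<close>, where the derivative formula is unavailable.\<close>

lemma powr_diff_le:
  fixes x y p :: real
  assumes p: "1 \<le> p" and "0 \<le> x" "x \<le> y" "y \<le> t" "0 < t"
  shows "y powr p - x powr p \<le> p * t powr (p - 1) * (y - x)"
proof -
  have mono: "p * y powr (p - 1) * (y - x) \<le> p * t powr (p - 1) * (y - x)"
    using assms by (intro mult_right_mono mult_left_mono powr_mono2) auto
  have "y powr p - x powr p \<le> p * y powr (p - 1) * (y - x)"
  proof (cases "x = 0 \<or> x = y")
    case True
    have "y powr p = y powr (p - 1) * y"
      using assms powr_mult_base[of y "p - 1"] by (cases "y = 0") (auto simp: mult.commute)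
    moreover have "y powr (p - 1) * y \<le> p * (y powr (p - 1) * y)"
      using assms by (intro mult_right_mono[of 1 p, simplified]) auto
    ultimately show ?thesis using True by (auto simp: mult.assoc)
  next
    case False
    then have "0 < x" "x < y" using assms by auto
    have "((\<lambda>x. x powr p) has_real_derivative p * u powr (p - 1)) (at u)" if "x \<le> u" "u \<le> y" for u
      using that \<open>0 < x\<close> by (intro has_real_derivative_powr) auto
    then obtain z where z: "x < z" "z < y" "y powr p - x powr p = (y - x) * (p * z powr (p - 1))"
      using MVT2[of x y "\<lambda>x. x powr p" "\<lambda>x. p * x powr (p - 1)", OF \<open>x < y\<close>] by blast
    have "(y - x) * (p * z powr (p - 1)) \<le> (y - x) * (p * y powr (p - 1))"
      using z \<open>0 < x\<close> p by (intro mult_left_mono powr_mono2) auto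
    then show ?thesis using z by (simp add: ac_simps)
  qed
  then show ?thesis using mono by linarith
qed

text \<open>Replace \<open>c i * c j\<close> by the mean of the squares; this uses the nonnegativity of the entries.\<close>

lemma quadratic_form_le_row_sums:
  fixes r :: "nat \<Rightarrow> nat \<Rightarrow> real"
  assumes sym: "\<And>i j. r i j = r j i" and nn: "\<And>i j. 0 \<le> r i j"
  shows "(\<Sum>i<n. \<Sum>j<n. c i * c j * r i j) \<le> (\<Sum>i<n. (c i)\<^sup>2 * (\<Sum>j<n. r i j))"
proof -
  have "(\<Sum>i<n. \<Sum>j<n. c i * c j * r i j) \<le> (\<Sum>i<n. \<Sum>j<n. ((c i)\<^sup>2 * r i j) / 2 + ((c j)\<^sup>2 * r i j) / 2)"
  proof (intro sum_mono)
    fix i j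
    have "2 * c i * c j \<le> (c i)\<^sup>2 + (c j)\<^sup>2" by (rule sum_squares_bound)
    then have "(2 * c i * c j) * r i j \<le> ((c i)\<^sup>2 + (c j)\<^sup>2) * r i j" by (intro mult_right_mono nn)
    then show "c i * c j * r i j \<le> ((c i)\<^sup>2 * r i j) / 2 + ((c j)\<^sup>2 * r i j) / 2" by (simp add: algebra_simps)
  qed
  also have "\<dots> = (\<Sum>i<n. \<Sum>j<n. ((c i)\<^sup>2 * r i j) / 2) + (\<Sum>i<n. \<Sum>j<n. ((c j)\<^sup>2 * r i j) / 2)"
    by (simp add: sum.distrib)
  also have "(\<Sum>i<n. \<Sum>j<n. ((c j)\<^sup>2 * r i j) / 2) = (\<Sum>j<n. \<Sum>i<n. ((c j)\<^sup>2 * r j i) / 2)"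
    by (subst sum.swap) (simp add: sym)
  also have "(\<Sum>i<n. \<Sum>j<n. ((c i)\<^sup>2 * r i j) / 2) + (\<Sum>j<n. \<Sum>i<n. ((c j)\<^sup>2 * r j i) / 2)
     = (\<Sum>i<n. (c i)\<^sup>2 * (\<Sum>j<n. r i j))"
    by (simp add: sum_distrib_left sum_divide_distrib[symmetric] flip: sum.distrib)
  finally show ?thesis .
qed

context prob_space
begin

lemma centered_gaussian_square_integrable:
  assumes "centered_gaussian M X"
  shows "integrable M (\<lambda>\<omega>. (X \<omega>)\<^sup>2)"
proof -
  have [measurable]: "X \<in> borel_measurable M" using assms by (auto simp: centered_gaussian_def)
  consider "AE \<omega> in M. X \<omega> = 0" | \<sigma> where "\<sigma> > 0" "distributed M lborel X (normal_density 0 \<sigma>)"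
    using assms by (auto simp: centered_gaussian_def)
  then show ?thesis
  proof cases
    case 1
    have "AE \<omega> in M. (X \<omega>)\<^sup>2 = 0" using 1 by eventually_elim simp
    then show ?thesis by (subst integrable_cong_AE[where g="\<lambda>_. 0"]) auto
  next
    case 2
    then have "gaussian_rv M X (\<sigma>\<^sup>2)"
      using char_centered_normal[OF 2(2,1)] by (simp add: gaussian_rv_def)
    from gaussian_rv_second_moment[OF this] show ?thesis
      by (intro integrableI_bounded) auto
  qed
qed

lemma fbm_square_integrable:
  assumes "fractional_brownian_motion H M X" "0 \<le> t"
  shows "integrable M (\<lambda>\<omega>. (X t \<omega>)\<^sup>2)" and "X t \<in> borel_measurable M"
proof -
  have *: "\<forall>I c. finite I \<and> I \<subseteq> {0..} \<longrightarrow> centered_gaussian M (\<lambda>\<omega>. \<Sum>t\<in>I. c t * X t \<omega>)"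
    using assms(1) unfolding fractional_brownian_motion_def by (rule conjunct1)
  have g: "centered_gaussian M (X t)"
    using *[rule_format, of "{t}" "\<lambda>_. 1"] assms(2) by simp
  then show "integrable M (\<lambda>\<omega>. (X t \<omega>)\<^sup>2)" "X t \<in> borel_measurable M"
    using centered_gaussian_square_integrable by (auto simp: centered_gaussian_def)
qed

lemma square_integrable_product:
  fixes X Y :: "'a \<Rightarrow> real"
  assumes [measurable]: "X \<in> borel_measurable M" "Y \<in> borel_measurable M"
    and "integrable M (\<lambda>\<omega>. (X \<omega>)\<^sup>2)" "integrable M (\<lambda>\<omega>. (Y \<omega>)\<^sup>2)"
  shows "integrable M (\<lambda>\<omega>. X \<omega> * Y \<omega>)"
proof (rule Bochner_Integration.integrable_bound)
  show "integrable M (\<lambda>\<omega>. (X \<omega>)\<^sup>2 + (Y \<omega>)\<^sup>2)" using assms by simp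
  show "AE \<omega> in M. norm (X \<omega> * Y \<omega>) \<le> norm ((X \<omega>)\<^sup>2 + (Y \<omega>)\<^sup>2)"
  proof (rule AE_I2)
    fix \<omega>
    have "2 * \<bar>X \<omega>\<bar> * \<bar>Y \<omega>\<bar> \<le> \<bar>X \<omega>\<bar>\<^sup>2 + \<bar>Y \<omega>\<bar>\<^sup>2" by (rule sum_squares_bound)
    moreover have "0 \<le> \<bar>X \<omega>\<bar> * \<bar>Y \<omega>\<bar>" by simp
    ultimately have "\<bar>X \<omega>\<bar> * \<bar>Y \<omega>\<bar> \<le> (X \<omega>)\<^sup>2 + (Y \<omega>)\<^sup>2"
      unfolding power2_abs by linarith
    then show "norm (X \<omega> * Y \<omega>) \<le> norm ((X \<omega>)\<^sup>2 + (Y \<omega>)\<^sup>2)" by (simp add: abs_mult)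
  qed
qed measurable

lemma fbm_product:
  assumes X: "fractional_brownian_motion H M X" and "0 \<le> s" "0 \<le> t"
  shows "has_bochner_integral M (\<lambda>\<omega>. X s \<omega> * X t \<omega>) ((s powr (2 * H) + t powr (2 * H) - \<bar>t - s\<bar> powr (2 * H)) / 2)"
  using square_integrable_product[OF fbm_square_integrable(2)[OF X \<open>0 \<le> s\<close>] fbm_square_integrable(2)[OF X \<open>0 \<le> t\<close>]
      fbm_square_integrable(1)[OF X \<open>0 \<le> s\<close>] fbm_square_integrable(1)[OF X \<open>0 \<le> t\<close>]] X assms(2,3)
  by (simp add: has_bochner_integral_iff fractional_brownian_motion_def)

text \<open>Polarization of the covariance of \<open>X\<close>: the powers of \<open>s, s', t, t'\<close> themselves cancel and only those of their
differences remain.\<close>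

lemma fbm_increment_product:
  assumes X: "fractional_brownian_motion H M X" and "0 \<le> s" "0 \<le> s'" "0 \<le> t" "0 \<le> t'"
  shows "has_bochner_integral M (\<lambda>\<omega>. (X s' \<omega> - X s \<omega>) * (X t' \<omega> - X t \<omega>))
    ((\<bar>t' - s\<bar> powr (2 * H) + \<bar>t - s'\<bar> powr (2 * H) - \<bar>t' - s'\<bar> powr (2 * H) - \<bar>t - s\<bar> powr (2 * H)) / 2)"
proof -
  let ?R = "\<lambda>s t. (s powr (2 * H) + t powr (2 * H) - \<bar>t - s\<bar> powr (2 * H)) / 2"
  have "has_bochner_integral M (\<lambda>\<omega>. X s' \<omega> * X t' \<omega> - X s' \<omega> * X t \<omega> - X s \<omega> * X t' \<omega> + X s \<omega> * X t \<omega>)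
    (?R s' t' - ?R s' t - ?R s t' + ?R s t)"
    using assms by (intro has_bochner_integral_add has_bochner_integral_diff fbm_product) auto
  moreover have "(\<lambda>\<omega>. X s' \<omega> * X t' \<omega> - X s' \<omega> * X t \<omega> - X s \<omega> * X t' \<omega> + X s \<omega> * X t \<omega>)
    = (\<lambda>\<omega>. (X s' \<omega> - X s \<omega>) * (X t' \<omega> - X t \<omega>))" by (simp add: algebra_simps)
  moreover have "?R s' t' - ?R s' t - ?R s t' + ?R s t
    = (\<bar>t' - s\<bar> powr (2 * H) + \<bar>t - s'\<bar> powr (2 * H) - \<bar>t' - s'\<bar> powr (2 * H) - \<bar>t - s\<bar> powr (2 * H)) / 2"
    by (simp add: field_simps)
  ultimately show ?thesis by simp
qed

lemma fbm_L1_increment: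
  assumes X: "fractional_brownian_motion H M X" and "0 < H" "0 \<le> s" "0 \<le> t"
  shows "(\<integral>\<^sup>+\<omega>. ennreal \<bar>X t \<omega> - X s \<omega>\<bar> \<partial>M) \<le> ennreal (\<bar>t - s\<bar> powr H)"
proof -
  have [measurable]: "X t \<in> borel_measurable M" "X s \<in> borel_measurable M"
    using fbm_square_integrable(2)[OF X] assms by auto
  have "has_bochner_integral M (\<lambda>\<omega>. (X t \<omega> - X s \<omega>)\<^sup>2) (\<bar>t - s\<bar> powr (2 * H))"
    using fbm_increment_product[OF X, of s t s t] assms by (simp add: power2_eq_square abs_minus_commute)
  then have "(\<integral>\<^sup>+\<omega>. ennreal ((X t \<omega> - X s \<omega>)\<^sup>2) \<partial>M) = ennreal (\<bar>t - s\<bar> powr (2 * H))"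
    by (auto simp: has_bochner_integral_iff intro!: nn_integral_eq_integral[THEN trans])
  then have "(\<integral>\<^sup>+\<omega>. ennreal \<bar>X t \<omega> - X s \<omega>\<bar> \<partial>M) \<le> ennreal (sqrt (\<bar>t - s\<bar> powr (2 * H)))"
    by (intro nn_integral_abs_le_sqrt) auto
  also have "sqrt (\<bar>t - s\<bar> powr (2 * H)) = \<bar>t - s\<bar> powr H"
    by (simp add: powr_half_sqrt[symmetric] powr_powr)
  finally show ?thesis .
qed

text \<open>The covariances \<open>r i j\<close> of the increments are nonnegative by \<open>abs_powr_second_difference\<close>, and the row sum
of index \<open>i\<close> telescopes to the covariance of one increment with \<open>X t\<close>, which \<open>powr_diff_le\<close> bounds.\<close>

lemma fbm_linear_combination_variance:
  assumes X: "fractional_brownian_motion H M X" and H: "1/2 < H" and t: "0 < t" and n: "0 < n"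
  shows "integrable M (\<lambda>\<omega>. (\<Sum>i<n. (X (node t n (Suc i)) \<omega> - X (node t n i) \<omega>) * c i)\<^sup>2)"
    and "(LINT \<omega>|M. (\<Sum>i<n. (X (node t n (Suc i)) \<omega> - X (node t n i) \<omega>) * c i)\<^sup>2)
      \<le> 2 * H * t powr (2 * H - 1) * (\<Sum>i<n. (c i)\<^sup>2 * (t / real n))"
proof -
  define d where "d = t / real n"
  define p where "p = 2 * H"
  have p: "1 \<le> p" using H by (simp add: p_def)
  have d: "0 < d" using t n by (simp add: d_def)
  let ?\<Delta> = "\<lambda>i \<omega>. X (node t n (Suc i)) \<omega> - X (node t n i) \<omega>"
  have np: "0 \<le> node t n i" for i using t by (simp add: node_def)
  define r where "r i j = (\<bar>node t n (Suc j) - node t n i\<bar> powr p + \<bar>node t n j - node t n (Suc i)\<bar> powr p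
      - \<bar>node t n (Suc j) - node t n (Suc i)\<bar> powr p - \<bar>node t n j - node t n i\<bar> powr p) / 2" for i j
  have E: "has_bochner_integral M (\<lambda>\<omega>. ?\<Delta> i \<omega> * ?\<Delta> j \<omega>) (r i j)" for i j
    unfolding r_def p_def using fbm_increment_product[OF X np np np np] .
  have sq: "(\<Sum>i<n. ?\<Delta> i \<omega> * c i)\<^sup>2 = (\<Sum>i<n. \<Sum>j<n. c i * c j * (?\<Delta> i \<omega> * ?\<Delta> j \<omega>))" for \<omega>
    by (simp add: power2_eq_square sum_product ac_simps)
  have I: "has_bochner_integral M (\<lambda>\<omega>. (\<Sum>i<n. ?\<Delta> i \<omega> * c i)\<^sup>2) (\<Sum>i<n. \<Sum>j<n. c i * c j * r i j)"
    unfolding sq by (intro has_bochner_integral_sum has_bochner_integral_mult_right E)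
  then show "integrable M (\<lambda>\<omega>. (\<Sum>i<n. ?\<Delta> i \<omega> * c i)\<^sup>2)" by (simp add: has_bochner_integral_iff)
  have sym: "r i j = r j i" for i j by (simp add: r_def abs_minus_commute add.commute)
  have nn: "0 \<le> r i j" for i j
  proof -
    define m where "m = real j - real i"
    have e: "node t n (Suc j) - node t n i = d * (m + 1)" "node t n j - node t n (Suc i) = d * (m - 1)"
      "node t n (Suc j) - node t n (Suc i) = d * m" "node t n j - node t n i = d * m"
      by (simp_all add: node_def d_def m_def algebra_simps add_divide_distrib diff_divide_distrib)
    have "2 * r i j = d powr p * (\<bar>m + 1\<bar> powr p + \<bar>m - 1\<bar> powr p - 2 * \<bar>m\<bar> powr p)"
    proof -
      have pw: "\<bar>d * z\<bar> powr p = d powr p * \<bar>z\<bar> powr p" for z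
        using d by (simp add: abs_mult powr_mult)
      have "2 * ((P * x + P * y - P * z - P * z) / 2) = P * (x + y - 2 * z)" for P x y z :: real
        by (simp add: field_simps)
      then show ?thesis unfolding r_def e pw .
    qed
    also have "\<dots> \<ge> 0" using abs_powr_second_difference[OF p, of m] by (intro mult_nonneg_nonneg) auto
    finally show ?thesis by simp
  qed
  \<comment> \<open>\<open>?g u\<close> is the covariance of the increment with \<open>X u\<close>, up to a term that does not depend on \<open>u\<close>\<close>
  have row: "(\<Sum>j<n. r i j) \<le> p * t powr (p - 1) * d" if "i < n" for i
  proof -
    let ?g = "\<lambda>u. (\<bar>u - node t n i\<bar> powr p - \<bar>u - node t n (Suc i)\<bar> powr p) / 2"
    have "(\<Sum>j<n. r i j) = (\<Sum>j<n. ?g (node t n (Suc j)) - ?g (node t n j))"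
      by (intro sum.cong refl) (simp add: r_def field_simps)
    also have "\<dots> = ?g t - ?g 0" using n by (subst sum_lessThan_telescope) simp
    also have "\<dots> = (((t - node t n i) powr p - (t - node t n (Suc i)) powr p) + (node t n (Suc i) powr p - node t n i powr p)) / 2"
      using node_in[of t n i] node_in[of t n "Suc i"] t n that by (simp add: field_simps)
    also have "\<dots> \<le> (p * t powr (p - 1) * ((t - node t n i) - (t - node t n (Suc i))) + p * t powr (p - 1) * (node t n (Suc i) - node t n i)) / 2"
      using node_in[of t n i] node_in[of t n "Suc i"] t n that d
      by (intro divide_right_mono add_mono powr_diff_le p) (auto simp: node_Suc d_def)
    also have "\<dots> = p * t powr (p - 1) * d" by (simp add: node_Suc d_def algebra_simps)
    finally show ?thesis .
  qed
  have "(LINT \<omega>|M. (\<Sum>i<n. ?\<Delta> i \<omega> * c i)\<^sup>2) = (\<Sum>i<n. \<Sum>j<n. c i * c j * r i j)"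
    using I by (rule has_bochner_integral_integral_eq)
  also have "\<dots> \<le> (\<Sum>i<n. (c i)\<^sup>2 * (\<Sum>j<n. r i j))" using sym nn by (rule quadratic_form_le_row_sums)
  also have "\<dots> \<le> (\<Sum>i<n. (c i)\<^sup>2 * (p * t powr (p - 1) * d))" using row by (intro sum_mono mult_left_mono) auto
  also have "\<dots> = 2 * H * t powr (2 * H - 1) * (\<Sum>i<n. (c i)\<^sup>2 * (t / real n))"
    by (simp add: p_def d_def sum_distrib_left ac_simps)
  finally show "(LINT \<omega>|M. (\<Sum>i<n. ?\<Delta> i \<omega> * c i)\<^sup>2) \<le> 2 * H * t powr (2 * H - 1) * (\<Sum>i<n. (c i)\<^sup>2 * (t / real n))" .
qed

end

section \<open>Integration against fractional Brownian motion\<close>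

lemma nn_integral_interp_approx:
  fixes f :: "real \<Rightarrow> 'w \<Rightarrow> real"
  assumes t: "0 < t" and n: "0 < n" and \<gamma>: "0 < \<gamma>" and x: "x \<in> {0..t}"
    and [measurable]: "\<And>u. u \<in> {0..t} \<Longrightarrow> f u \<in> borel_measurable M"
    and f: "\<And>u v. u \<in> {0..t} \<Longrightarrow> v \<in> {0..t} \<Longrightarrow> (\<integral>\<^sup>+\<omega>. ennreal \<bar>f u \<omega> - f v \<omega>\<bar> \<partial>M) \<le> ennreal (\<bar>u - v\<bar> powr \<gamma>)"
  shows "(\<integral>\<^sup>+\<omega>. ennreal \<bar>f x \<omega> - interp t n (\<lambda>s. f s \<omega>) x\<bar> \<partial>M) \<le> ennreal (2 * (t / real n) powr \<gamma>)"
proof -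
  obtain \<theta> u v where \<theta>: "0 \<le> \<theta>" "\<theta> \<le> 1" and uv: "u \<in> {0..t}" "v \<in> {0..t}" "\<bar>u - x\<bar> \<le> t / real n" "\<bar>v - x\<bar> \<le> t / real n"
    and eq: "\<forall>f. interp t n f x - f x = (1 - \<theta>) * (f u - f x) + \<theta> * (f v - f x)"
    using interp_approx[OF t n x] by (elim exE conjE) (rule that)
  have [measurable]: "f u \<in> borel_measurable M" "f v \<in> borel_measurable M" "f x \<in> borel_measurable M" using uv x by auto
  have "(\<integral>\<^sup>+\<omega>. ennreal \<bar>f x \<omega> - interp t n (\<lambda>s. f s \<omega>) x\<bar> \<partial>M)
     \<le> (\<integral>\<^sup>+\<omega>. ennreal \<bar>f u \<omega> - f x \<omega>\<bar> + ennreal \<bar>f v \<omega> - f x \<omega>\<bar> \<partial>M)"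
  proof (intro nn_integral_mono ennreal_abs_triangle)
    fix \<omega>
    have "\<bar>f x \<omega> - interp t n (\<lambda>s. f s \<omega>) x\<bar> = \<bar>(1 - \<theta>) * (f u \<omega> - f x \<omega>) + \<theta> * (f v \<omega> - f x \<omega>)\<bar>"
      using eq[rule_format, of "\<lambda>s. f s \<omega>"] by (simp add: abs_minus_commute)
    also have "\<dots> \<le> (1 - \<theta>) * \<bar>f u \<omega> - f x \<omega>\<bar> + \<theta> * \<bar>f v \<omega> - f x \<omega>\<bar>"
      using \<theta> abs_triangle_ineq[of "(1 - \<theta>) * (f u \<omega> - f x \<omega>)" "\<theta> * (f v \<omega> - f x \<omega>)"] by (simp add: abs_mult)
    also have "\<dots> \<le> 1 * \<bar>f u \<omega> - f x \<omega>\<bar> + 1 * \<bar>f v \<omega> - f x \<omega>\<bar>"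
      using \<theta> by (intro add_mono mult_right_mono) auto
    finally show "\<bar>f x \<omega> - interp t n (\<lambda>s. f s \<omega>) x\<bar> \<le> \<bar>f u \<omega> - f x \<omega>\<bar> + \<bar>f v \<omega> - f x \<omega>\<bar>" by simp
  qed
  also have "\<dots> = (\<integral>\<^sup>+\<omega>. ennreal \<bar>f u \<omega> - f x \<omega>\<bar> \<partial>M) + (\<integral>\<^sup>+\<omega>. ennreal \<bar>f v \<omega> - f x \<omega>\<bar> \<partial>M)"
    by (rule nn_integral_add) measurable
  also have "\<dots> \<le> ennreal ((t / real n) powr \<gamma>) + ennreal ((t / real n) powr \<gamma>)"
  proof (intro add_mono)
    show "(\<integral>\<^sup>+\<omega>. ennreal \<bar>f u \<omega> - f x \<omega>\<bar> \<partial>M) \<le> ennreal ((t / real n) powr \<gamma>)"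
    proof (rule order_trans[OF f[OF uv(1) x]])
      show "ennreal (\<bar>u - x\<bar> powr \<gamma>) \<le> ennreal ((t / real n) powr \<gamma>)"
        using uv(3) \<gamma> by (intro ennreal_leI powr_mono2) auto
    qed
    show "(\<integral>\<^sup>+\<omega>. ennreal \<bar>f v \<omega> - f x \<omega>\<bar> \<partial>M) \<le> ennreal ((t / real n) powr \<gamma>)"
    proof (rule order_trans[OF f[OF uv(2) x]])
      show "ennreal (\<bar>v - x\<bar> powr \<gamma>) \<le> ennreal ((t / real n) powr \<gamma>)"
        using uv(4) \<gamma> by (intro ennreal_leI powr_mono2) auto
    qed
  qed
  also have "\<dots> = ennreal (2 * (t / real n) powr \<gamma>)" by (simp flip: ennreal_plus)
  finally show ?thesis .
qed

text \<open>The interpolations are finite sums of products of a random variable and a function of \<open>s\<close>, hence jointly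
measurable, and they converge pointwise.\<close>

lemma joint_measurable_continuous_paths:
  fixes X :: "real \<Rightarrow> 'w \<Rightarrow> real"
  assumes t: "0 < t" and Xm: "\<And>s. s \<in> {0..t} \<Longrightarrow> X s \<in> borel_measurable M"
    and c: "\<And>\<omega>. \<omega> \<in> space M \<Longrightarrow> continuous_on {0..t} (\<lambda>s. X s \<omega>)"
  shows "(\<lambda>(s, \<omega>). X (clamp_to t s) \<omega>) \<in> borel_measurable (lborel \<Otimes>\<^sub>M M)"
proof -
  have [measurable]: "X (node t (Suc n) i) \<in> borel_measurable M" if "i \<le> Suc n" for n i
    using node_in[of t "Suc n" i] t that by (intro Xm) auto
  have [measurable]: "X 0 \<in> borel_measurable M" using t by (intro Xm) auto
  have "(\<lambda>z. interp t (Suc n) (\<lambda>s. X s (snd z)) (fst z)) \<in> borel_measurable (lborel \<Otimes>\<^sub>M M)" for n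
    unfolding interp_def by measurable
  moreover have "(\<lambda>n. interp t (Suc n) (\<lambda>s. X s (snd z)) (fst z)) \<longlonglongrightarrow> X (clamp_to t (fst z)) (snd z)"
    if "z \<in> space (lborel \<Otimes>\<^sub>M M)" for z
  proof -
    have "snd z \<in> space M" using that by (auto simp: space_pair_measure)
    then have "(\<lambda>n. interp t (Suc n) (\<lambda>s. X s (snd z)) (clamp_to t (fst z))) \<longlonglongrightarrow> X (clamp_to t (fst z)) (snd z)"
      using t c by (intro interp_tendsto clamp_to_in) auto
    then show ?thesis using interp_clamp[of t _ "\<lambda>s. X s (snd z)" "fst z"] t by simp
  qed
  ultimately have "(\<lambda>z. X (clamp_to t (fst z)) (snd z)) \<in> borel_measurable (lborel \<Otimes>\<^sub>M M)"
    by (rule borel_measurable_LIMSEQ_real[rotated])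
  then show ?thesis by (simp add: case_prod_beta')
qed

text \<open>The condition \<open>1 - \<epsilon> < H\<close> makes the increments of \<open>BH\<close>, of size \<open>z powr H\<close> in mean, integrable against the
kernel of the derivative of order \<open>1 - \<epsilon>\<close>.\<close>

locale fbm_integral = prob_space M + holder_integrand \<epsilon> \<gamma> C t b
  for M :: "'w measure" and \<epsilon> \<gamma> C t b +
  fixes H :: real and BH :: "real \<Rightarrow> 'w \<Rightarrow> real"
  assumes H: "1/2 < H" "H < 1" "1 - H < \<epsilon>" and fbm: "fractional_brownian_motion H M BH"
begin

lemma BH_measurable: "0 \<le> s \<Longrightarrow> BH s \<in> borel_measurable M"
  using fbm_square_integrable(2)[OF fbm] .

text \<open>The fractional integral of \<open>b\<close> against the interpolated path.\<close>

definition riemann :: "nat \<Rightarrow> 'w \<Rightarrow> real" where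
  "riemann n \<omega> = (\<Sum>i<Suc n. (BH (node t (Suc n) (Suc i)) \<omega> - BH (node t (Suc n) i) \<omega>) * cell_mean (Suc n) i)"

lemma node_nonneg: "0 \<le> node t n i" using t by (simp add: node_def)

lemma riemann_measurable [measurable]: "riemann n \<in> borel_measurable M"
proof -
  have [measurable]: "BH (node t (Suc n) i) \<in> borel_measurable M" for i by (rule BH_measurable[OF node_nonneg])
  show ?thesis unfolding riemann_def[abs_def] by measurable
qed

lemma riemann_variance:
  "(\<integral>\<^sup>+\<omega>. ennreal ((riemann n \<omega>)\<^sup>2) \<partial>M) \<le> ennreal (2 * H * t powr (2 * H - 1) * (LINT u|lebesgue_on {0..t}. (b u)\<^sup>2))"
proof -
  note v = fbm_linear_combination_variance[OF fbm H(1) t zero_less_Suc, of n "cell_mean (Suc n)", folded riemann_def]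
  have "(\<integral>\<^sup>+\<omega>. ennreal ((riemann n \<omega>)\<^sup>2) \<partial>M) = ennreal (LINT \<omega>|M. (riemann n \<omega>)\<^sup>2)"
    using v(1) by (intro nn_integral_eq_integral) auto
  also have "\<dots> \<le> ennreal (2 * H * t powr (2 * H - 1) * (LINT u|lebesgue_on {0..t}. (b u)\<^sup>2))"
  proof (rule ennreal_leI, rule order_trans[OF v(2)])
    show "2 * H * t powr (2 * H - 1) * (\<Sum>i<Suc n. (cell_mean (Suc n) i)\<^sup>2 * (t / real (Suc n)))
      \<le> 2 * H * t powr (2 * H - 1) * (LINT u|lebesgue_on {0..t}. (b u)\<^sup>2)"
      using H cell_mean_square[of "Suc n"] by (intro mult_left_mono) auto
  qed
  finally show ?thesis .
qed

text \<open>By \<open>fractional_integral_stability\<close> the error is at most a multiple of the double integral \<open>S n\<close> of the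
increments of the interpolation error \<open>D n\<close>.  Tonelli's theorem moves the expectation inside, where the
increments of \<open>D n\<close> tend to \<open>0\<close> in mean and are dominated by \<open>4 * (min z t) powr H\<close>.\<close>

lemma riemann_L1_limit:
  assumes Y [measurable]: "Y \<in> borel_measurable M"
    and eq: "AE \<omega> in M. Y \<omega> = fractional_integral \<epsilon> b (\<lambda>s. BH s \<omega>) t"
  shows "(\<lambda>n. \<integral>\<^sup>+\<omega>. ennreal \<bar>riemann n \<omega> - Y \<omega>\<bar> \<partial>M) \<longlonglongrightarrow> 0"
proof -
  define \<eta> where "\<eta> = 1 - \<epsilon>"
  have \<eta>: "0 < \<eta>" "\<eta> < 1" "\<eta> < H" using eps H by (auto simp: \<eta>_def)
  have "AE \<omega> in M. continuous_on {0..} (\<lambda>s. BH s \<omega>)" using fbm by (simp add: fractional_brownian_motion_def)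
  then obtain N where N: "\<And>\<omega>. \<omega> \<in> space M - N \<Longrightarrow> continuous_on {0..} (\<lambda>s. BH s \<omega>)" "N \<in> null_sets M"
    by (rule AE_E3) blast
  have [measurable]: "N \<in> sets M" using N(2) by auto
  \<comment> \<open>a version all of whose paths are continuous, which makes it jointly measurable\<close>
  define X where "X s \<omega> = (if \<omega> \<in> N then 0 else BH s \<omega>)" for s \<omega>
  have [measurable]: "X s \<in> borel_measurable M" if "0 \<le> s" for s
    unfolding X_def[abs_def] using BH_measurable[OF that] by measurable
  have Xc: "continuous_on {0..t} (\<lambda>s. X s \<omega>)" if "\<omega> \<in> space M" for \<omega>
    using N(1)[of \<omega>] that by (cases "\<omega> \<in> N") (auto simp: X_def intro: continuous_on_subset)
  have XB: "AE \<omega> in M. \<forall>s. X s \<omega> = BH s \<omega>"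
    using AE_not_in[OF N(2)] by eventually_elim (auto simp: X_def)
  have joint [measurable]: "(\<lambda>(s, \<omega>). X (clamp_to t s) \<omega>) \<in> borel_measurable (lborel \<Otimes>\<^sub>M M)"
    using t Xc by (intro joint_measurable_continuous_paths) auto
  define D where "D n x \<omega> = X (clamp_to t x) \<omega> - interp t (Suc n) (\<lambda>s. X s \<omega>) x" for n x \<omega>
  have nodem [measurable]: "X (node t n i) \<in> borel_measurable M" for n i using node_nonneg by measurable
  have [measurable]: "X 0 \<in> borel_measurable M" by measurable
  have intm: "(\<lambda>z. interp t (Suc n) (\<lambda>s. X s (snd z)) (fst z)) \<in> borel_measurable (lborel \<Otimes>\<^sub>M M)" for n
    unfolding interp_def by measurable
  have Dm [measurable]: "(\<lambda>z. D n (fst z) (snd z)) \<in> borel_measurable (lborel \<Otimes>\<^sub>M M)" for n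
    unfolding D_def using joint intm[of n] by (simp add: case_prod_beta')
  have Xinc: "(\<integral>\<^sup>+\<omega>. ennreal \<bar>X u \<omega> - X v \<omega>\<bar> \<partial>M) \<le> ennreal (\<bar>u - v\<bar> powr H)" if "u \<in> {0..t}" "v \<in> {0..t}" for u v
  proof -
    have "(\<integral>\<^sup>+\<omega>. ennreal \<bar>X u \<omega> - X v \<omega>\<bar> \<partial>M) = (\<integral>\<^sup>+\<omega>. ennreal \<bar>BH u \<omega> - BH v \<omega>\<bar> \<partial>M)"
      using XB by (intro nn_integral_cong_AE) auto
    then show ?thesis using fbm_L1_increment[OF fbm, of v u] H that by auto
  qed
  define g where "g n x y = (\<integral>\<^sup>+\<omega>. ennreal \<bar>D n x \<omega> - D n y \<omega>\<bar> \<partial>M)" for n x y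
  have Dmx [measurable]: "D n x \<in> borel_measurable M" for n x
    using t unfolding D_def[abs_def] interp_def by (measurable; simp add: clamp_to_def)
  have g_le: "g n x y \<le> ennreal (4 * (min \<bar>x - y\<bar> t) powr H)" for n x y
  proof -
    have "g n x y \<le> (\<integral>\<^sup>+\<omega>. ennreal \<bar>X (clamp_to t x) \<omega> - X (clamp_to t y) \<omega>\<bar>
       + ennreal \<bar>interp t (Suc n) (\<lambda>s. X s \<omega>) x - interp t (Suc n) (\<lambda>s. X s \<omega>) y\<bar> \<partial>M)"
      unfolding g_def D_def by (intro nn_integral_mono ennreal_abs_triangle) linarith
    also have "\<dots> = (\<integral>\<^sup>+\<omega>. ennreal \<bar>X (clamp_to t x) \<omega> - X (clamp_to t y) \<omega>\<bar> \<partial>M)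
       + (\<integral>\<^sup>+\<omega>. ennreal \<bar>interp t (Suc n) (\<lambda>s. X s \<omega>) x - interp t (Suc n) (\<lambda>s. X s \<omega>) y\<bar> \<partial>M)"
      using t unfolding interp_def by (intro nn_integral_add) (measurable; simp add: clamp_to_def)+
    also have "\<dots> \<le> ennreal (\<bar>clamp_to t x - clamp_to t y\<bar> powr H) + ennreal (3 * 1 * \<bar>clamp_to t x - clamp_to t y\<bar> powr H)"
      using t H Xinc clamp_to_in[of t] by (intro add_mono nn_integral_interp_increment Xinc) auto
    also have "\<dots> = ennreal (4 * \<bar>clamp_to t x - clamp_to t y\<bar> powr H)" by (simp flip: ennreal_plus)
    also have "\<dots> \<le> ennreal (4 * (min \<bar>x - y\<bar> t) powr H)"
      using t H clamp_to_dist[of t x y] clamp_to_dist_t[of t x y] by (intro ennreal_leI mult_left_mono powr_mono2) auto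
    finally show ?thesis .
  qed
  have D_lim: "(\<lambda>n. \<integral>\<^sup>+\<omega>. ennreal \<bar>D n x \<omega>\<bar> \<partial>M) \<longlonglongrightarrow> 0" for x
  proof (rule tendsto_sandwich[OF _ _ tendsto_const])
    have "(\<lambda>n. t * (1 / real (Suc n))) \<longlonglongrightarrow> t * 0"
      by (intro tendsto_mult tendsto_const LIMSEQ_inverse_real_of_nat[unfolded inverse_eq_divide])
    then have "(\<lambda>n. t / real (Suc n)) \<longlonglongrightarrow> 0" by simp
    then have "(\<lambda>n. 2 * (t / real (Suc n)) powr H) \<longlonglongrightarrow> 2 * 0 powr H"
      using H t by (intro tendsto_mult tendsto_const tendsto_powr2) auto
    then have "(\<lambda>n. ennreal (2 * (t / real (Suc n)) powr H)) \<longlonglongrightarrow> ennreal 0"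
      by (intro tendsto_ennrealI) simp
    then show "(\<lambda>n. ennreal (2 * (t / real (Suc n)) powr H)) \<longlonglongrightarrow> 0" by simp
    have "(\<integral>\<^sup>+\<omega>. ennreal \<bar>D n x \<omega>\<bar> \<partial>M) \<le> ennreal (2 * (t / real (Suc n)) powr H)" for n
    proof -
      have "D n x \<omega> = X (clamp_to t x) \<omega> - interp t (Suc n) (\<lambda>s. X s \<omega>) (clamp_to t x)" for \<omega>
        unfolding D_def using interp_clamp[of t "Suc n" _ x] t by simp
      moreover have "(\<integral>\<^sup>+\<omega>. ennreal \<bar>X (clamp_to t x) \<omega> - interp t (Suc n) (\<lambda>s. X s \<omega>) (clamp_to t x)\<bar> \<partial>M)
        \<le> ennreal (2 * (t / real (Suc n)) powr H)"
        using t H Xinc clamp_to_in[of t x] by (intro nn_integral_interp_approx) auto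
      ultimately show ?thesis by simp
    qed
    then show "\<forall>\<^sub>F n in sequentially. (\<integral>\<^sup>+\<omega>. ennreal \<bar>D n x \<omega>\<bar> \<partial>M) \<le> ennreal (2 * (t / real (Suc n)) powr H)" by simp
  qed simp
  have g_lim: "(\<lambda>n. g n x y) \<longlonglongrightarrow> 0" for x y
  proof (rule tendsto_sandwich[OF _ _ tendsto_const])
    show "(\<lambda>n. (\<integral>\<^sup>+\<omega>. ennreal \<bar>D n x \<omega>\<bar> \<partial>M) + (\<integral>\<^sup>+\<omega>. ennreal \<bar>D n y \<omega>\<bar> \<partial>M)) \<longlonglongrightarrow> 0"
      using tendsto_add[OF D_lim[of x] D_lim[of y]] by simp
    have "g n x y \<le> (\<integral>\<^sup>+\<omega>. ennreal \<bar>D n x \<omega>\<bar> \<partial>M) + (\<integral>\<^sup>+\<omega>. ennreal \<bar>D n y \<omega>\<bar> \<partial>M)" for n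
    proof -
      have "g n x y \<le> (\<integral>\<^sup>+\<omega>. ennreal \<bar>D n x \<omega>\<bar> + ennreal \<bar>D n y \<omega>\<bar> \<partial>M)"
        unfolding g_def by (intro nn_integral_mono ennreal_abs_triangle) linarith
      also have "\<dots> = (\<integral>\<^sup>+\<omega>. ennreal \<bar>D n x \<omega>\<bar> \<partial>M) + (\<integral>\<^sup>+\<omega>. ennreal \<bar>D n y \<omega>\<bar> \<partial>M)"
        by (rule nn_integral_add) measurable
      finally show ?thesis .
    qed
    then show "\<forall>\<^sub>F n in sequentially. g n x y \<le> (\<integral>\<^sup>+\<omega>. ennreal \<bar>D n x \<omega>\<bar> \<partial>M) + (\<integral>\<^sup>+\<omega>. ennreal \<bar>D n y \<omega>\<bar> \<partial>M)" by simp
  qed simp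
  have gm [measurable]: "(\<lambda>(x, z). g n x (x + z)) \<in> borel_measurable (lborel \<Otimes>\<^sub>M lborel)" for n
  proof -
    have Dc: "(\<lambda>p. D n (f (fst p)) (snd p)) \<in> borel_measurable ((lborel \<Otimes>\<^sub>M lborel) \<Otimes>\<^sub>M M)"
      if [measurable]: "f \<in> borel_measurable (lborel \<Otimes>\<^sub>M lborel)" for f :: "real \<times> real \<Rightarrow> real"
      using measurable_compose[of "\<lambda>p. (f (fst p), snd p)" _ "lborel \<Otimes>\<^sub>M M", OF _ Dm[of n]] by simp
    have "(\<lambda>p. ennreal \<bar>D n (fst (fst p)) (snd p) - D n (fst (fst p) + snd (fst p)) (snd p)\<bar>) \<in> borel_measurable ((lborel \<Otimes>\<^sub>M lborel) \<Otimes>\<^sub>M M)"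
      using Dc[of fst] Dc[of "\<lambda>q. fst q + snd q"] by measurable
    then show ?thesis unfolding g_def
      by (simp add: case_prod_beta' borel_measurable_nn_integral)
  qed
  define S where "S n \<omega> = (\<integral>\<^sup>+x. (\<integral>\<^sup>+z. ennreal (indicator {0..t} x * (\<bar>D n x \<omega> - D n (x + z) \<omega>\<bar> * kernel \<eta> z)) \<partial>lborel) \<partial>lborel)" for n \<omega>
  have ker: "(\<lambda>p. ennreal (indicator {0..t} (fst (fst p)) * (\<bar>D n (fst (fst p)) (snd p) - D n (fst (fst p) + snd (fst p)) (snd p)\<bar> * kernel \<eta> (snd (fst p)))))
     \<in> borel_measurable ((lborel \<Otimes>\<^sub>M lborel) \<Otimes>\<^sub>M M)" for n
  proof -
    have Dc: "(\<lambda>p. D n (f (fst p)) (snd p)) \<in> borel_measurable ((lborel \<Otimes>\<^sub>M lborel) \<Otimes>\<^sub>M M)"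
      if [measurable]: "f \<in> borel_measurable (lborel \<Otimes>\<^sub>M lborel)" for f :: "real \<times> real \<Rightarrow> real"
      using measurable_compose[of "\<lambda>p. (f (fst p), snd p)" _ "lborel \<Otimes>\<^sub>M M", OF _ Dm[of n]] by simp
    show ?thesis using Dc[of fst] Dc[of "\<lambda>q. fst q + snd q"] by measurable
  qed
  interpret LL: pair_sigma_finite "lborel \<Otimes>\<^sub>M lborel :: (real \<times> real) measure" M
    by (intro pair_sigma_finite.intro sigma_finite_pair_measure lborel.sigma_finite_measure_axioms
        sigma_finite_measure_axioms)
  have S_eq: "S n \<omega> = (\<integral>\<^sup>+q. ennreal (indicator {0..t} (fst q) * (\<bar>D n (fst q) \<omega> - D n (fst q + snd q) \<omega>\<bar> * kernel \<eta> (snd q))) \<partial>(lborel \<Otimes>\<^sub>M lborel))"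
    if "\<omega> \<in> space M" for n \<omega>
    unfolding S_def using measurable_compose[OF measurable_Pair2'[OF that, of "lborel \<Otimes>\<^sub>M lborel"] ker[of n]]
    by (subst lborel.nn_integral_fst[symmetric]) auto
  have [measurable]: "S n \<in> borel_measurable M" for n
  proof -
    have [measurable]: "case_prod (D n) \<in> borel_measurable (lborel \<Otimes>\<^sub>M M)"
      using Dm[of n] by (simp add: case_prod_beta')
    show ?thesis unfolding S_def[abs_def] by measurable
  qed
  have ES: "(\<integral>\<^sup>+\<omega>. S n \<omega> \<partial>M) = (\<integral>\<^sup>+x. (\<integral>\<^sup>+z. ennreal (indicator {0..t} x * kernel \<eta> z) * g n x (x + z) \<partial>lborel) \<partial>lborel)" for n
  proof -
    have "(\<integral>\<^sup>+\<omega>. S n \<omega> \<partial>M) = (\<integral>\<^sup>+\<omega>. (\<integral>\<^sup>+q. ennreal (indicator {0..t} (fst q) * (\<bar>D n (fst q) \<omega> - D n (fst q + snd q) \<omega>\<bar> * kernel \<eta> (snd q))) \<partial>(lborel \<Otimes>\<^sub>M lborel)) \<partial>M)"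
      by (intro nn_integral_cong S_eq)
    also have "\<dots> = (\<integral>\<^sup>+q. (\<integral>\<^sup>+\<omega>. ennreal (indicator {0..t} (fst q) * (\<bar>D n (fst q) \<omega> - D n (fst q + snd q) \<omega>\<bar> * kernel \<eta> (snd q))) \<partial>M) \<partial>(lborel \<Otimes>\<^sub>M lborel))"
      using ker[of n] by (intro LL.Fubini') (simp add: case_prod_beta')
    also have "\<dots> = (\<integral>\<^sup>+q. ennreal (indicator {0..t} (fst q) * kernel \<eta> (snd q)) * g n (fst q) (fst q + snd q) \<partial>(lborel \<Otimes>\<^sub>M lborel))"
    proof (intro nn_integral_cong)
      fix q :: "real \<times> real"
      have "(\<integral>\<^sup>+\<omega>. ennreal (indicator {0..t} (fst q) * (\<bar>D n (fst q) \<omega> - D n (fst q + snd q) \<omega>\<bar> * kernel \<eta> (snd q))) \<partial>M)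
        = (\<integral>\<^sup>+\<omega>. ennreal (indicator {0..t} (fst q) * kernel \<eta> (snd q)) * ennreal \<bar>D n (fst q) \<omega> - D n (fst q + snd q) \<omega>\<bar> \<partial>M)"
        by (intro nn_integral_cong) (simp add: ac_simps flip: ennreal_mult)
      then show "(\<integral>\<^sup>+\<omega>. ennreal (indicator {0..t} (fst q) * (\<bar>D n (fst q) \<omega> - D n (fst q + snd q) \<omega>\<bar> * kernel \<eta> (snd q))) \<partial>M)
        = ennreal (indicator {0..t} (fst q) * kernel \<eta> (snd q)) * g n (fst q) (fst q + snd q)"
        by (simp add: g_def nn_integral_cmult)
    qed
    also have "\<dots> = (\<integral>\<^sup>+x. (\<integral>\<^sup>+z. ennreal (indicator {0..t} x * kernel \<eta> z) * g n x (x + z) \<partial>lborel) \<partial>lborel)"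
      using gm[of n] by (subst lborel.nn_integral_fst[symmetric]) (auto simp: case_prod_beta')
    finally show ?thesis .
  qed
  define w where "w x z = ennreal (indicator {0..t} x * (4 * ((min z t) powr H * kernel \<eta> z)))" for x z
  have wint: "(\<integral>\<^sup>+z. w x z \<partial>lborel) = ennreal (indicator {0..t} x * (4 * (LINT z|lborel. (min z t) powr H * kernel \<eta> z)))" for x
    unfolding w_def using integrable_min_powr_kernel[OF \<eta>(1,3) t]
    by (subst nn_integral_eq_integral) auto
  have dom: "ennreal (indicator {0..t} x * kernel \<eta> z) * g n x (x + z) \<le> w x z" for n x z
  proof (cases "0 < z")
    case True
    have "ennreal (indicator {0..t} x * kernel \<eta> z) * g n x (x + z) \<le> ennreal (indicator {0..t} x * kernel \<eta> z) * ennreal (4 * (min \<bar>x - (x + z)\<bar> t) powr H)"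
      by (intro mult_left_mono g_le) auto
    also have "\<dots> = w x z" using True by (simp add: w_def ac_simps flip: ennreal_mult)
    finally show ?thesis .
  qed (simp add: kernel_def)
  have inner_lim: "(\<lambda>n. \<integral>\<^sup>+z. ennreal (indicator {0..t} x * kernel \<eta> z) * g n x (x + z) \<partial>lborel) \<longlonglongrightarrow> 0" for x
  proof -
    have "(\<lambda>n. \<integral>\<^sup>+z. ennreal (indicator {0..t} x * kernel \<eta> z) * g n x (x + z) \<partial>lborel) \<longlonglongrightarrow> (\<integral>\<^sup>+z. 0 \<partial>(lborel :: real measure))"
    proof (rule nn_integral_dominated_convergence)
      show "(\<lambda>z. ennreal (indicator {0..t} x * kernel \<eta> z) * g n x (x + z)) \<in> borel_measurable lborel" for n
        using measurable_compose[OF measurable_Pair1'[of x lborel lborel] gm[of n]] by simp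
      show "AE z in lborel. (\<lambda>n. ennreal (indicator {0..t} x * kernel \<eta> z) * g n x (x + z)) \<longlonglongrightarrow> 0"
      proof (rule AE_I2)
        fix z
        show "(\<lambda>n. ennreal (indicator {0..t} x * kernel \<eta> z) * g n x (x + z)) \<longlonglongrightarrow> 0"
          using ennreal_tendsto_cmult[OF _ g_lim[of x "x + z"], of "ennreal (indicator {0..t} x * kernel \<eta> z)"] by simp
      qed
      show "(\<integral>\<^sup>+z. w x z \<partial>lborel) < \<infinity>" by (simp add: wint)
    qed (use dom in \<open>auto simp: w_def\<close>)
    then show ?thesis by simp
  qed
  have "(\<lambda>n. \<integral>\<^sup>+\<omega>. S n \<omega> \<partial>M) \<longlonglongrightarrow> (\<integral>\<^sup>+x. 0 \<partial>(lborel :: real measure))"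
    unfolding ES
  proof (rule nn_integral_dominated_convergence[where w = "\<lambda>x. \<integral>\<^sup>+z. w x z \<partial>lborel"])
    show "(\<lambda>x. \<integral>\<^sup>+z. ennreal (indicator {0..t} x * kernel \<eta> z) * g n x (x + z) \<partial>lborel) \<in> borel_measurable lborel" for n
      using gm[of n] by measurable
    show "(\<integral>\<^sup>+x. (\<integral>\<^sup>+z. w x z \<partial>lborel) \<partial>lborel) < \<infinity>"
    proof -
      have "integrable lborel (\<lambda>x. indicator {0..t} x * (4 * (LINT z|lborel. (min z t) powr H * kernel \<eta> z)))"
        using t by (auto intro!: integrable_real_indicator)
      then show ?thesis unfolding wint by (subst nn_integral_eq_integral) auto
    qed
    show "AE x in lborel. (\<integral>\<^sup>+z. ennreal (indicator {0..t} x * kernel \<eta> z) * g n x (x + z) \<partial>lborel) \<le> (\<integral>\<^sup>+z. w x z \<partial>lborel)" for n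
      by (intro AE_I2 nn_integral_mono dom)
    show "(\<lambda>x. \<integral>\<^sup>+z. w x z \<partial>lborel) \<in> borel_measurable lborel" unfolding wint by measurable
  qed (use inner_lim in auto)
  then have S_lim: "(\<lambda>n. \<integral>\<^sup>+\<omega>. S n \<omega> \<partial>M) \<longlonglongrightarrow> 0" by simp
  define K where "K = (1 - \<epsilon>) / Gamma \<epsilon> * left_deriv_bound + 1"
  have le: "(\<integral>\<^sup>+\<omega>. ennreal \<bar>riemann n \<omega> - Y \<omega>\<bar> \<partial>M) \<le> ennreal K * (\<integral>\<^sup>+\<omega>. S n \<omega> \<partial>M)" for n
  proof -
    have "AE \<omega> in M. ennreal \<bar>riemann n \<omega> - Y \<omega>\<bar> \<le> ennreal K * S n \<omega>"
      using eq XB AE_space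
    proof eventually_elim
      case (elim \<omega>)
      have m: "(\<lambda>x. X (clamp_to t x) \<omega>) \<in> borel_measurable borel"
        using t elim by (intro continuous_clamp_measurable Xc) auto
      have "fractional_integral \<epsilon> b (interp t (Suc n) (\<lambda>s. X s \<omega>)) t = riemann n \<omega>"
        unfolding fractional_integral_interp[OF zero_less_Suc] riemann_def using elim by simp
      moreover have "fractional_integral \<epsilon> b (\<lambda>s. X s \<omega>) t = Y \<omega>" using elim by simp
      ultimately show ?case
        using fractional_integral_stability[of "\<lambda>s. X s \<omega>", OF m zero_less_Suc, of n]
        by (simp add: K_def S_def D_def \<eta>_def abs_minus_commute)
    qed
    then have "(\<integral>\<^sup>+\<omega>. ennreal \<bar>riemann n \<omega> - Y \<omega>\<bar> \<partial>M) \<le> (\<integral>\<^sup>+\<omega>. ennreal K * S n \<omega> \<partial>M)"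
      by (rule nn_integral_mono_AE)
    also have "\<dots> = ennreal K * (\<integral>\<^sup>+\<omega>. S n \<omega> \<partial>M)" by (rule nn_integral_cmult) measurable
    finally show ?thesis .
  qed
  show ?thesis
  proof (rule tendsto_sandwich[OF _ _ tendsto_const])
    show "(\<lambda>n. ennreal K * (\<integral>\<^sup>+\<omega>. S n \<omega> \<partial>M)) \<longlonglongrightarrow> 0"
      using ennreal_tendsto_cmult[OF _ S_lim, of "ennreal K"] by simp
  qed (use le in auto)
qed

text \<open>The Riemann sums are finite combinations of values of \<open>BH\<close>, each of which is an Ito integral against \<open>B\<close>.\<close>

lemma fractional_integral_gaussian:
  assumes B: "brownian_motion M B" and ito: "\<And>s. 0 \<le> s \<Longrightarrow> has_ito_integral M B s (k s) (BH s)"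
    and Y [measurable]: "Y \<in> borel_measurable M"
    and eq: "AE \<omega> in M. Y \<omega> = fractional_integral \<epsilon> b (\<lambda>s. BH s \<omega>) t"
  shows "brownian_space M B Y"
    and "\<exists>v. gaussian_rv M Y v \<and> v \<le> 2 * H * t powr (2 * H - 1) * (LINT u|lebesgue_on {0..t}. (b u)\<^sup>2)"
proof -
  let ?V = "2 * H * t powr (2 * H - 1) * (LINT u|lebesgue_on {0..t}. (b u)\<^sup>2)"
  have V: "0 \<le> ?V" using H by simp
  have bs: "brownian_space M B (riemann n)" for n
  proof -
    have "brownian_space M B (\<lambda>\<omega>. \<Sum>i<Suc n. cell_mean (Suc n) i * (BH (node t (Suc n) (Suc i)) \<omega> + (-1) * BH (node t (Suc n) i) \<omega>))"
      by (intro brownian_space_sum brownian_space_scale brownian_space_add B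
          ito_integral_brownian_space[OF B ito] node_nonneg) auto
    then show ?thesis by (simp add: riemann_def[abs_def] mult.commute)
  qed
  show "brownian_space M B Y"
    by (rule brownian_space_limit[OF B bs Y riemann_L1_limit[OF Y eq]])
  have "\<exists>v. gaussian_rv M (riemann n) v" for n
    using brownian_space_gaussian[OF B bs] .
  then obtain v where v: "\<And>n. gaussian_rv M (riemann n) (v n)" by metis
  have "v n \<le> ?V" for n
    using riemann_variance[of n] gaussian_rv_second_moment[OF v[of n]] V by simp
  moreover obtain u where "v \<longlonglongrightarrow> u" "gaussian_rv M Y u"
    using gaussian_rv_limit[OF v Y riemann_L1_limit[OF Y eq]] by blast
  ultimately show "\<exists>v. gaussian_rv M Y v \<and> v \<le> ?V"
    using LIMSEQ_le_const2 by blast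
qed

end

section \<open>The tail of the exponential functional\<close>

text \<open>The tangent of \<open>c powr p\<close> at \<open>c = 1\<close> with \<open>c = exp u\<close>, obtained from Young's inequality.\<close>

lemma exp_tangent:
  fixes p u :: real
  assumes "1 \<le> p"
  shows "p * exp u \<le> exp (p * u) + (p - 1)"
proof -
  have "(exp (p * u)) powr (1 / p) * 1 powr (1 - 1 / p) \<le> (1 / p) * exp (p * u) + (1 - 1 / p) * 1"
    using assms by (intro Youngs_inequality_0) auto
  then have "exp u \<le> (1 / p) * exp (p * u) + (1 - 1 / p)"
    using assms by (simp add: exp_powr_real)
  then have "p * exp u \<le> p * ((1 / p) * exp (p * u) + (1 - 1 / p))"
    using assms by (intro mult_left_mono) auto
  also have "\<dots> = exp (p * u) + (p - 1)" using assms by (simp add: algebra_simps)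
  finally show ?thesis .
qed

lemma half_energy_mono:
  fixes k :: "real \<Rightarrow> real"
  assumes k: "integrable (lebesgue_on {0..t}) (\<lambda>r. (k r)\<^sup>2)" and "s \<le> t"
  shows "(LINT r|lebesgue_on {0..s}. (k r)\<^sup>2) \<le> (LINT r|lebesgue_on {0..t}. (k r)\<^sup>2)"
proof -
  have it: "integrable lebesgue (\<lambda>r. indicator {0..t} r * (k r)\<^sup>2)"
    using k by (subst (asm) integrable_restrict_space) auto
  have eq: "indicator {0..s} r *\<^sub>R (indicator {0..t} r * (k r)\<^sup>2) = indicator {0..s} r * (k r)\<^sup>2" for r
    using \<open>s \<le> t\<close> by (auto simp: indicator_def)
  have "{0..s} \<in> sets lebesgue" by simp
  from integrable_mult_indicator[OF this it]
  have i_s: "integrable lebesgue (\<lambda>r. indicator {0..s} r * (k r)\<^sup>2)" unfolding eq .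
  have "(LINT r|lebesgue. indicator {0..s} r * (k r)\<^sup>2) \<le> (LINT r|lebesgue. indicator {0..t} r * (k r)\<^sup>2)"
    using i_s it \<open>s \<le> t\<close> by (intro integral_mono) (auto simp: indicator_def)
  then show ?thesis by (simp add: integral_restrict_space)
qed

lemma half_energy_nonneg: "0 \<le> half_energy f t"
  by (simp add: half_energy_def)

lemma half_energy_clamp_measurable:
  assumes "0 \<le> R" and k: "\<forall>t\<ge>0. integrable (lebesgue_on {0..t}) (\<lambda>r. (k r)\<^sup>2)"
  shows "(\<lambda>r. half_energy k (clamp_to R r)) \<in> borel_measurable borel"
proof (rule borel_measurable_mono)
  show "mono (\<lambda>r. half_energy k (clamp_to R r))"
  proof (rule monoI)
    fix x y :: real assume "x \<le> y"
    then have "clamp_to R x \<le> clamp_to R y" "0 \<le> clamp_to R y" by (auto simp: clamp_to_def)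
    then show "half_energy k (clamp_to R x) \<le> half_energy k (clamp_to R y)"
      unfolding half_energy_def using k by (intro mult_left_mono half_energy_mono) auto
  qed
qed

lemma continuous_square_integrable:
  assumes "continuous_on {0..t} (f :: real \<Rightarrow> real)"
  shows "integrable (lebesgue_on {0..t}) (\<lambda>r. (f r)\<^sup>2)"
proof -
  have "continuous_on {0..t} (\<lambda>r. (f r)\<^sup>2)" using assms by (intro continuous_intros)
  then show ?thesis by (rule continuous_imp_integrable_real)
qed

locale weighted_path =
  fixes \<beta> lam\<^sub>0 :: real and k a :: "real \<Rightarrow> real"
  assumes \<beta>: "0 < \<beta>" and lam: "0 < lam\<^sub>0"
    and k: "\<forall>t\<ge>0. integrable (lebesgue_on {0..t}) (\<lambda>r. (k r)\<^sup>2)" and a: "continuous_on {0..} a"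
begin

definition weight :: "real \<Rightarrow> real" where
  "weight r = exp (- \<beta> * (lam\<^sub>0 * half_energy k r + half_energy a r))"

lemma a_square_integrable: "\<forall>t\<ge>0. integrable (lebesgue_on {0..t}) (\<lambda>r. (a r)\<^sup>2)"
  using a by (auto intro!: continuous_square_integrable elim: continuous_on_subset)

lemma weight_measurable: "0 \<le> R \<Longrightarrow> (\<lambda>r. weight (clamp_to R r)) \<in> borel_measurable borel"
proof -
  assume "0 \<le> R"
  note [measurable] = half_energy_clamp_measurable[OF this k] half_energy_clamp_measurable[OF this a_square_integrable]
  show ?thesis unfolding weight_def[abs_def] by measurable
qed

lemma weight_bounds: "0 < weight r" "weight r \<le> 1"
  using \<beta> lam half_energy_nonneg[of k r] half_energy_nonneg[of a r] by (auto simp: weight_def)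

lemma exp_functional_weight:
  "exp_functional \<beta> lam\<^sub>0 k a n t = (LINT r|lebesgue_on {0..t}. weight r * exp (\<beta> * n r))"
  by (simp add: exp_functional_def weight_def exp_add[symmetric] mult_exp_exp)

lemma exp_functional_lborel:
  assumes n: "continuous_on {0..R} n" and t: "0 \<le> t" "t \<le> R"
  shows "exp_functional \<beta> lam\<^sub>0 k a n t = (LINT r|lborel. indicator {0..t} r * (weight (clamp_to R r) * exp (\<beta> * n (clamp_to R r))))"
proof -
  have R: "0 \<le> R" using t by simp
  have [measurable]: "(\<lambda>r. weight (clamp_to R r)) \<in> borel_measurable borel" "(\<lambda>r. n (clamp_to R r)) \<in> borel_measurable borel"
    using weight_measurable[OF R] continuous_clamp_measurable[OF R n] by auto
  have "exp_functional \<beta> lam\<^sub>0 k a n t = (LINT r|lebesgue_on {0..t}. weight (clamp_to R r) * exp (\<beta> * n (clamp_to R r)))"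
    unfolding exp_functional_weight using t by (intro Bochner_Integration.integral_cong) (auto simp: clamp_to_id)
  also have "\<dots> = (LINT r|lborel. indicator {0..t} r * (weight (clamp_to R r) * exp (\<beta> * n (clamp_to R r))))"
    by (rule LINT_lebesgue_on_borel) measurable
  finally show ?thesis .
qed

text \<open>The integrand is bounded on \<open>[0,R]\<close>.  The one-sided Lipschitz estimate expresses monotonicity
(for \<open>t \<le> s\<close>) and continuity at once.\<close>

lemma exp_functional_growth:
  assumes n: "continuous_on {0..R} n" and R: "0 \<le> R"
  shows "\<exists>L>0. \<forall>s\<in>{0..R}. \<forall>t\<in>{0..R}. exp_functional \<beta> lam\<^sub>0 k a n t \<le> exp_functional \<beta> lam\<^sub>0 k a n s + L * max 0 (t - s)"
proof -
  define f where "f r = weight (clamp_to R r) * exp (\<beta> * n (clamp_to R r))" for r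
  have [measurable]: "f \<in> borel_measurable borel"
    using weight_measurable[OF R] continuous_clamp_measurable[OF R n] unfolding f_def[abs_def] by measurable
  have "bounded (n ` {0..R})" using n by (intro compact_imp_bounded compact_continuous_image) auto
  then obtain m where m: "\<forall>x\<in>n ` {0..R}. norm x \<le> m" unfolding bounded_iff by blast
  have f0: "0 \<le> f r" for r using weight_bounds by (simp add: f_def less_imp_le)
  have fL: "f r \<le> exp (\<beta> * m)" for r
  proof -
    have "n (clamp_to R r) \<le> m" using m clamp_to_in[OF R, of r] by force
    then have "weight (clamp_to R r) * exp (\<beta> * n (clamp_to R r)) \<le> 1 * exp (\<beta> * m)"
      using \<beta> weight_bounds by (intro mult_mono) auto
    then show ?thesis by (simp add: f_def)
  qed
  have fin: "integrable lborel (\<lambda>r. indicator {0..t} r * f r)" for t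
  proof (rule Bochner_Integration.integrable_bound)
    show "integrable lborel (\<lambda>r. indicator {0..t} r * exp (\<beta> * m))"
      by (intro integrable_mult_left integrable_real_indicator) (auto simp: emeasure_lborel_Icc_eq)
  qed (use f0 fL in \<open>auto simp: indicator_def\<close>)
  have iL: "integrable lborel (\<lambda>r. indicator {s..max s t} r * exp (\<beta> * m))" for s t :: real
    by (intro integrable_mult_left integrable_real_indicator) (auto simp: emeasure_lborel_Icc_eq)
  have "exp_functional \<beta> lam\<^sub>0 k a n t \<le> exp_functional \<beta> lam\<^sub>0 k a n s + exp (\<beta> * m) * max 0 (t - s)"
    if "s \<in> {0..R}" "t \<in> {0..R}" for s t
  proof -
    have "(LINT r|lborel. indicator {0..t} r * f r) \<le> (LINT r|lborel. indicator {0..s} r * f r + indicator {s..max s t} r * exp (\<beta> * m))"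
      using fin iL f0 fL by (intro integral_mono Bochner_Integration.integrable_add) (auto simp: indicator_def)
    also have "\<dots> = (LINT r|lborel. indicator {0..s} r * f r) + (LINT r|lborel. indicator {s..max s t} r * exp (\<beta> * m))"
      using fin iL by (rule Bochner_Integration.integral_add)
    also have "(LINT r|lborel. indicator {s..max s t} r * exp (\<beta> * m)) = exp (\<beta> * m) * max 0 (t - s)"
      by (simp add: max_def)
    finally show ?thesis
      using exp_functional_lborel[OF n, of t] exp_functional_lborel[OF n, of s] that by (simp add: f_def)
  qed
  then show ?thesis by (intro exI[of _ "exp (\<beta> * m)"]) auto
qed

text \<open>If the functional is below the threshold at time \<open>T\<close>, it stays below for a short while, so the infimum
exceeds \<open>T\<close>; otherwise \<open>T\<close> belongs to the set.\<close>

lemma tau_star_le_iff: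
  assumes n: "continuous_on {0..} n" and T: "0 < T" and q: "q \<noteq> 0"
  shows "tau_star C \<beta> lam\<^sub>0 k a q n \<le> ereal T \<longleftrightarrow> 1 / (C * \<beta>) * q powr (- \<beta>) \<le> exp_functional \<beta> lam\<^sub>0 k a n T"
proof
  let ?F = "exp_functional \<beta> lam\<^sub>0 k a n" and ?x = "1 / (C * \<beta>) * q powr (- \<beta>)"
  have th: "threshold C \<beta> q = ereal ?x" using q by (simp add: threshold_def)
  {
    assume "?x \<le> ?F T"
    then have "ereal T \<in> {ereal t | t. 0 < t \<and> ereal (?F t) \<ge> threshold C \<beta> q}"
      using T unfolding th by auto
    then show "tau_star C \<beta> lam\<^sub>0 k a q n \<le> ereal T" unfolding tau_star_def by (rule Inf_lower)
  }
  assume le: "tau_star C \<beta> lam\<^sub>0 k a q n \<le> ereal T"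
  show "?x \<le> ?F T"
  proof (rule ccontr)
    assume "\<not> ?x \<le> ?F T"
    then have less: "?F T < ?x" by simp
    have "continuous_on {0..T + 1} n" using n by (rule continuous_on_subset) auto
    then obtain L where L: "0 < L" "\<forall>s\<in>{0..T+1}. \<forall>t\<in>{0..T+1}. ?F t \<le> ?F s + L * max 0 (t - s)"
      using exp_functional_growth[of "T + 1" n] T by auto
    define \<delta> where "\<delta> = min 1 ((?x - ?F T) / (2 * L))"
    have \<delta>: "0 < \<delta>" "\<delta> \<le> 1" "L * \<delta> \<le> (?x - ?F T) / 2"
    proof -
      show "0 < \<delta>" "\<delta> \<le> 1" using less L by (auto simp: \<delta>_def)
      have "L * \<delta> \<le> L * ((?x - ?F T) / (2 * L))" unfolding \<delta>_def using L by (intro mult_left_mono) auto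
      then show "L * \<delta> \<le> (?x - ?F T) / 2" using L by simp
    qed
    have "ereal (T + \<delta>) \<le> ereal t" if "0 < t" "ereal (?F t) \<ge> threshold C \<beta> q" for t
    proof (rule ccontr)
      assume "\<not> ereal (T + \<delta>) \<le> ereal t"
      then have t: "t < T + \<delta>" by simp
      have "?F t \<le> ?F T + L * max 0 (t - T)" using L(2) that t T \<delta> by auto
      also have "L * max 0 (t - T) \<le> L * \<delta>" using t L \<delta> by (intro mult_left_mono) auto
      finally have "?F t < ?x" using \<delta>(3) less by simp
      then show False using that(2) unfolding th by simp
    qed
    then have "ereal (T + \<delta>) \<le> tau_star C \<beta> lam\<^sub>0 k a q n"
      unfolding tau_star_def by (intro Inf_greatest) auto
    then have "ereal (T + \<delta>) \<le> ereal T" using le by (rule order_trans)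
    then show False using \<delta> by simp
  qed
qed

end

text \<open>The tail estimate depends on the process through the variances \<open>v t\<close>; \<open>m\<close> is a common bound for the
variances of \<open>\<beta> * N t\<close> with \<open>0 < t \<le> T\<close>.\<close>

locale gaussian_path = weighted_path \<beta> lam\<^sub>0 k a + prob_space M
  for \<beta> lam\<^sub>0 k a and M :: "'w measure" +
  fixes N :: "real \<Rightarrow> 'w \<Rightarrow> real" and T m :: real and v :: "real \<Rightarrow> real"
  assumes T: "0 < T" and Nm: "\<forall>t\<ge>0. N t \<in> borel_measurable M"
    and Nc: "\<forall>\<omega>\<in>space M. continuous_on {0..} (\<lambda>t. N t \<omega>)"
    and gauss: "\<And>t. 0 < t \<Longrightarrow> t \<le> T \<Longrightarrow> gaussian_rv M (N t) (v t)"
    and vm: "\<And>t. 0 < t \<Longrightarrow> t \<le> T \<Longrightarrow> \<beta>\<^sup>2 * v t \<le> m"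
begin

text \<open>The weight is cut off outside \<open>[0,T]\<close>, and the process below is continued by constants there, so that all
integrals can be taken over the whole line.\<close>

definition cut_weight :: "real \<Rightarrow> real" where "cut_weight r = indicator {0..T} r * weight (clamp_to T r)"
definition cut_process :: "real \<Rightarrow> 'w \<Rightarrow> real" where "cut_process r \<omega> = N (clamp_to T r) \<omega>"
definition exp_mean :: "real \<Rightarrow> real" where "exp_mean r = (LINT \<omega>|M. exp (\<beta> * cut_process r \<omega>))"

lemma cut_weight_measurable [measurable]: "cut_weight \<in> borel_measurable borel"
proof -
  note [measurable] = weight_measurable[OF less_imp_le[OF T]]
  show ?thesis unfolding cut_weight_def[abs_def] by measurable
qed

lemma cut_weight_bounds: "0 \<le> cut_weight r" "cut_weight r \<le> indicator {0..T} r"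
  using weight_bounds(1)[of "clamp_to T r"] weight_bounds(2)[of "clamp_to T r"] by (auto simp: cut_weight_def indicator_def)

lemma cut_process_measurable [measurable]: "case_prod cut_process \<in> borel_measurable (lborel \<Otimes>\<^sub>M M)"
proof -
  have "(\<lambda>(s, \<omega>). N (clamp_to T s) \<omega>) \<in> borel_measurable (lborel \<Otimes>\<^sub>M M)"
    using T Nm Nc by (intro joint_measurable_continuous_paths) (auto intro: continuous_on_subset)
  then show ?thesis by (simp add: cut_process_def[abs_def])
qed

lemma cut_process_gauss: "r \<in> {0<..T} \<Longrightarrow> gaussian_rv M (cut_process r) (v r)"
  using gauss[of r] by (simp add: cut_process_def[abs_def] clamp_to_id)

lemma m_nonneg: "0 \<le> m"
proof -
  have "0 \<le> \<beta>\<^sup>2 * v T" using gauss[of T] T by (auto simp: gaussian_rv_def)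
  then show ?thesis using vm[of T] T by simp
qed

lemma exp_mean_measurable [measurable]: "exp_mean \<in> borel_measurable borel"
proof -
  have "exp_mean \<in> borel_measurable lborel" unfolding exp_mean_def[abs_def] by measurable
  then show ?thesis by simp
qed

lemma exp_mean_eq: assumes r: "r \<in> {0<..T}" shows "exp_mean r = exp (\<beta>\<^sup>2 * v r / 2)"
proof -
  have [measurable]: "cut_process r \<in> borel_measurable M" using cut_process_gauss[OF r] by measurable
  show ?thesis unfolding exp_mean_def
    using gaussian_rv_exp_moment[OF cut_process_gauss[OF r], of \<beta>] by (subst integral_eq_nn_integral) auto
qed

lemma exp_mean_bounds: assumes r: "r \<in> {0<..T}" shows "1 \<le> exp_mean r" "exp_mean r \<le> exp (m / 2)"
  using exp_mean_eq[OF r] vm[of r] cut_process_gauss[OF r] r by (auto simp: gaussian_rv_def)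

definition \<mu> :: real where "\<mu> = mu_T M \<beta> lam\<^sub>0 k a N T"

lemma \<mu>_eq: "(\<integral>\<^sup>+r. ennreal (cut_weight r * exp_mean r) \<partial>lborel) = ennreal \<mu>"
proof -
  have 1: "\<mu> = (LINT r|lebesgue_on {0..T}. weight (clamp_to T r) * exp_mean r)"
    unfolding \<mu>_def mu_T_def weight_def[symmetric] exp_mean_def cut_process_def
    by (intro Bochner_Integration.integral_cong refl) (auto simp: clamp_to_id)
  have [measurable]: "(\<lambda>r. weight (clamp_to T r)) \<in> borel_measurable borel" using weight_measurable T by simp
  have 2: "\<mu> = (LINT r|lborel. cut_weight r * exp_mean r)"
    unfolding 1 cut_weight_def by (subst LINT_lebesgue_on_borel) (auto simp: mult.assoc)
  have z: "AE r in lborel. r \<noteq> 0" by (rule AE_lborel_singleton)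
  have "integrable lborel (\<lambda>r. cut_weight r * exp_mean r)"
  proof (rule Bochner_Integration.integrable_bound)
    show "integrable lborel (\<lambda>r. indicator {0..T} r * exp (m / 2))"
      using T by (intro integrable_mult_left integrable_real_indicator) auto
    show "AE r in lborel. norm (cut_weight r * exp_mean r) \<le> norm (indicator {0..T} r * exp (m / 2))"
      using z
    proof eventually_elim
      case (elim r)
      show ?case
      proof (cases "r \<in> {0<..T}")
        case True
        then have "cut_weight r * exp_mean r \<le> 1 * exp (m / 2)"
          using exp_mean_bounds[OF True] cut_weight_bounds[of r] by (intro mult_mono) auto
        then show ?thesis using True exp_mean_bounds[OF True] cut_weight_bounds[of r] by (simp add: abs_mult)
      next
        case False
        then have "cut_weight r = 0" using elim by (auto simp: cut_weight_def)
        then show ?thesis by simp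
      qed
    qed
  qed measurable
  moreover have "AE r in lborel. 0 \<le> cut_weight r * exp_mean r"
    using cut_weight_bounds by (intro AE_I2 mult_nonneg_nonneg) (auto simp: exp_mean_def)
  ultimately show ?thesis unfolding 2 by (rule nn_integral_eq_integral)
qed

lemma \<mu>_pos: "0 < \<mu>"
proof (rule ccontr)
  assume "\<not> 0 < \<mu>"
  then have "(\<integral>\<^sup>+r. ennreal (cut_weight r * exp_mean r) \<partial>lborel) = 0" by (simp add: \<mu>_eq ennreal_neg)
  then have "AE r in lborel. ennreal (cut_weight r * exp_mean r) = 0" by (subst (asm) nn_integral_0_iff_AE) auto
  then have "AE r in lborel. r \<notin> {0<..T}"
  proof eventually_elim
    case (elim r)
    show ?case
    proof
      assume r: "r \<in> {0<..T}"
      then have "0 < cut_weight r" using weight_bounds by (simp add: cut_weight_def)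
      moreover have "0 < exp_mean r" using exp_mean_bounds(1)[OF r] by simp
      ultimately have "0 < cut_weight r * exp_mean r" by (rule mult_pos_pos)
      moreover have "cut_weight r * exp_mean r \<le> 0" using elim by (simp only: ennreal_eq_0_iff)
      ultimately show False by linarith
    qed
  qed
  then have "emeasure lborel {0<..T} = 0" by (subst (asm) AE_iff_measurable[of "{0<..T}"]) auto
  then show False using T by simp
qed

definition path_integral :: "'w \<Rightarrow> real" where "path_integral \<omega> = exp_functional \<beta> lam\<^sub>0 k a (\<lambda>t. N t \<omega>) T"

lemma path_integral_eq: "\<omega> \<in> space M \<Longrightarrow> path_integral \<omega> = (LINT r|lborel. cut_weight r * exp (\<beta> * cut_process r \<omega>))"
  unfolding path_integral_def using T Nc
  by (subst exp_functional_lborel[of T]) (auto simp: cut_weight_def cut_process_def mult.assoc intro: continuous_on_subset)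

lemma path_integral_measurable [measurable]: "path_integral \<in> borel_measurable M"
proof -
  have sw [measurable]: "case_prod (\<lambda>\<omega> r. cut_process r \<omega>) \<in> borel_measurable (M \<Otimes>\<^sub>M lborel)"
    by measurable
  have "(\<lambda>\<omega>. LINT r|lborel. cut_weight r * exp (\<beta> * cut_process r \<omega>)) \<in> borel_measurable M" by measurable
  then show ?thesis by (simp add: path_integral_eq cong: measurable_cong)
qed

lemma path_integral_le: "\<omega> \<in> space M \<Longrightarrow> ennreal (path_integral \<omega>) \<le> (\<integral>\<^sup>+r. ennreal (cut_weight r * exp (\<beta> * cut_process r \<omega>)) \<partial>lborel)"
proof -
  assume w: "\<omega> \<in> space M"
  show ?thesis
  proof (cases "integrable lborel (\<lambda>r. cut_weight r * exp (\<beta> * cut_process r \<omega>))")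
    case True
    then show ?thesis unfolding path_integral_eq[OF w] using cut_weight_bounds by (subst nn_integral_eq_integral) auto
  next
    case False
    then show ?thesis unfolding path_integral_eq[OF w] by (simp add: not_integrable_integral_eq)
  qed
qed

text \<open>The integral of the \<open>p\<close>-th power of \<open>exp (\<beta> N) / E exp (\<beta> N)\<close> against the density
\<open>cut_weight * exp_mean\<close>, whose total mass is \<open>\<mu>\<close>.\<close>

definition tilted_integral :: "real \<Rightarrow> 'w \<Rightarrow> ennreal" where
  "tilted_integral p \<omega> = (\<integral>\<^sup>+r. ennreal (cut_weight r * exp_mean r * exp (p * (\<beta> * cut_process r \<omega> - ln (exp_mean r)))) \<partial>lborel)"

lemma tilted_integral_measurable [measurable]: "tilted_integral p \<in> borel_measurable M"
proof -
  have sw [measurable]: "case_prod (\<lambda>\<omega> r. cut_process r \<omega>) \<in> borel_measurable (M \<Otimes>\<^sub>M lborel)"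
    by measurable
  show ?thesis unfolding tilted_integral_def[abs_def] by measurable
qed

text \<open>For a Gaussian variable \<open>Z\<close> of variance \<open>s\<close> the \<open>p\<close>-th moment of \<open>exp Z / E exp Z\<close> is
\<open>exp ((p\<^sup>2 - p) s / 2)\<close>.\<close>

lemma expectation_tilted_integral:
  assumes p: "1 \<le> p"
  shows "(\<integral>\<^sup>+\<omega>. tilted_integral p \<omega> \<partial>M) \<le> ennreal (exp ((p\<^sup>2 - p) * m / 2)) * ennreal \<mu>"
proof -
  interpret pair_sigma_finite lborel M
    by (intro pair_sigma_finite.intro lborel.sigma_finite_measure_axioms sigma_finite_measure_axioms)
  have "(\<integral>\<^sup>+\<omega>. tilted_integral p \<omega> \<partial>M) = (\<integral>\<^sup>+r. (\<integral>\<^sup>+\<omega>. ennreal (cut_weight r * exp_mean r * exp (p * (\<beta> * cut_process r \<omega> - ln (exp_mean r)))) \<partial>M) \<partial>lborel)"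
    unfolding tilted_integral_def by (rule Fubini') measurable
  also have "\<dots> \<le> (\<integral>\<^sup>+r. ennreal (exp ((p\<^sup>2 - p) * m / 2)) * ennreal (cut_weight r * exp_mean r) \<partial>lborel)"
  proof (rule nn_integral_mono_AE)
    show "AE r in lborel. (\<integral>\<^sup>+\<omega>. ennreal (cut_weight r * exp_mean r * exp (p * (\<beta> * cut_process r \<omega> - ln (exp_mean r)))) \<partial>M)
      \<le> ennreal (exp ((p\<^sup>2 - p) * m / 2)) * ennreal (cut_weight r * exp_mean r)"
      using AE_lborel_singleton[of 0]
    proof eventually_elim
      case (elim r)
      show ?case
      proof (cases "r \<in> {0<..T}")
        case True
        have [measurable]: "cut_process r \<in> borel_measurable M" using cut_process_gauss[OF True] by measurable
        have wm: "0 \<le> cut_weight r * exp_mean r" using cut_weight_bounds exp_mean_bounds(1)[OF True] by simp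
        have lm: "ln (exp_mean r) = \<beta>\<^sup>2 * v r / 2" by (simp add: exp_mean_eq[OF True])
        have "(\<integral>\<^sup>+\<omega>. ennreal (cut_weight r * exp_mean r * exp (p * (\<beta> * cut_process r \<omega> - ln (exp_mean r)))) \<partial>M)
          = (\<integral>\<^sup>+\<omega>. ennreal (cut_weight r * exp_mean r * exp (- (p * (\<beta>\<^sup>2 * v r / 2)))) * ennreal (exp ((p * \<beta>) * cut_process r \<omega>)) \<partial>M)"
        proof (intro nn_integral_cong)
          fix \<omega>
          have "p * (\<beta> * cut_process r \<omega> - ln (exp_mean r)) = - (p * (\<beta>\<^sup>2 * v r / 2)) + (p * \<beta>) * cut_process r \<omega>"
            unfolding lm by (simp add: algebra_simps)
          then have "cut_weight r * exp_mean r * exp (p * (\<beta> * cut_process r \<omega> - ln (exp_mean r)))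
            = (cut_weight r * exp_mean r * exp (- (p * (\<beta>\<^sup>2 * v r / 2)))) * exp ((p * \<beta>) * cut_process r \<omega>)"
            by (simp only: exp_add mult.assoc)
          then show "ennreal (cut_weight r * exp_mean r * exp (p * (\<beta> * cut_process r \<omega> - ln (exp_mean r))))
            = ennreal (cut_weight r * exp_mean r * exp (- (p * (\<beta>\<^sup>2 * v r / 2)))) * ennreal (exp ((p * \<beta>) * cut_process r \<omega>))"
            using wm by (simp only:) (rule ennreal_mult; simp)
        qed
        also have "\<dots> = ennreal (cut_weight r * exp_mean r * exp (- (p * (\<beta>\<^sup>2 * v r / 2)))) * ennreal (exp ((p * \<beta>)\<^sup>2 * v r / 2))"
          by (subst nn_integral_cmult) (auto simp: gaussian_rv_exp_moment[OF cut_process_gauss[OF True]])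
        also have "\<dots> = ennreal (cut_weight r * exp_mean r * exp ((p\<^sup>2 - p) * (\<beta>\<^sup>2 * v r) / 2))"
        proof -
          have "exp (- (p * (\<beta>\<^sup>2 * v r / 2))) * exp ((p * \<beta>)\<^sup>2 * v r / 2) = exp ((p\<^sup>2 - p) * (\<beta>\<^sup>2 * v r) / 2)"
            by (simp add: power_mult_distrib algebra_simps diff_divide_distrib flip: exp_add)
          moreover have "ennreal (cut_weight r * exp_mean r * exp (- (p * (\<beta>\<^sup>2 * v r / 2)))) * ennreal (exp ((p * \<beta>)\<^sup>2 * v r / 2))
            = ennreal (cut_weight r * exp_mean r * exp (- (p * (\<beta>\<^sup>2 * v r / 2))) * exp ((p * \<beta>)\<^sup>2 * v r / 2))"
            using wm by (intro ennreal_mult[symmetric]) auto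
          ultimately show ?thesis by (simp only: mult.assoc)
        qed
        also have "\<dots> \<le> ennreal (exp ((p\<^sup>2 - p) * m / 2) * (cut_weight r * exp_mean r))"
        proof -
          have "0 \<le> p\<^sup>2 - p" using p by (simp add: power2_eq_square)
          then have "(p\<^sup>2 - p) * (\<beta>\<^sup>2 * v r) / 2 \<le> (p\<^sup>2 - p) * m / 2"
            using vm[of r] True by (intro divide_right_mono mult_left_mono) auto
          then show ?thesis using wm by (subst mult.commute) (intro ennreal_leI mult_right_mono; simp)
        qed
        also have "\<dots> = ennreal (exp ((p\<^sup>2 - p) * m / 2)) * ennreal (cut_weight r * exp_mean r)"
          using wm by (intro ennreal_mult) auto
        finally show ?thesis .
      next
        case False
        then have "cut_weight r = 0" using elim by (auto simp: cut_weight_def)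
        then show ?thesis by simp
      qed
    qed
  qed
  also have "\<dots> = ennreal (exp ((p\<^sup>2 - p) * m / 2)) * ennreal \<mu>"
    by (subst nn_integral_cmult) (auto simp: \<mu>_eq)
  finally show ?thesis .
qed

text \<open>Jensen's inequality for the power \<open>p\<close>, in the form of the tangent inequality \<open>exp_tangent\<close> at the level
\<open>x / \<mu>\<close>, which is stated with both terms nonnegative so that it can be integrated in \<open>ennreal\<close>.\<close>

lemma tilted_integral_lower:
  assumes p: "1 \<le> p" and w: "\<omega> \<in> space M" and x: "\<mu> \<le> x" "x \<le> path_integral \<omega>"
  shows "ennreal (\<mu> * exp (p * ln (x / \<mu>))) \<le> tilted_integral p \<omega>"
proof -
  define y where "y = ln (x / \<mu>)"
  define c where "c = exp (p * y)"
  have x0: "0 < x" using x \<mu>_pos by simp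
  have ey: "exp y = x / \<mu>" using x0 \<mu>_pos by (simp add: y_def)
  have pw: "p * (c / exp y) * (cut_weight r * exp (\<beta> * cut_process r \<omega>))
     \<le> cut_weight r * exp_mean r * exp (p * (\<beta> * cut_process r \<omega> - ln (exp_mean r))) + (c * (p - 1)) * (cut_weight r * exp_mean r)" if "r \<noteq> 0" for r
  proof (cases "r \<in> {0<..T}")
    case True
    have m1: "0 < exp_mean r" using exp_mean_bounds(1)[OF True] by simp
    define u where "u = \<beta> * cut_process r \<omega> - ln (exp_mean r)"
    have "p * exp (u - y) \<le> exp (p * (u - y)) + (p - 1)" by (rule exp_tangent[OF p])
    then have ineq: "(cut_weight r * exp_mean r * c) * (p * exp (u - y)) \<le> (cut_weight r * exp_mean r * c) * (exp (p * (u - y)) + (p - 1))"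
      using cut_weight_bounds m1 by (intro mult_left_mono) (auto simp: c_def)
    have e1: "c * exp (p * (u - y)) = exp (p * u)" by (simp add: c_def right_diff_distrib flip: exp_add)
    have e2: "exp_mean r * exp (u - y) = exp (\<beta> * cut_process r \<omega>) / exp y"
      using m1 by (simp add: u_def exp_diff)
    have l: "(cut_weight r * exp_mean r * c) * (p * exp (u - y)) = p * c * cut_weight r * (exp_mean r * exp (u - y))"
      by (simp add: ac_simps)
    have rr: "(cut_weight r * exp_mean r * c) * (exp (p * (u - y)) + (p - 1))
      = cut_weight r * exp_mean r * (c * exp (p * (u - y))) + c * (p - 1) * (cut_weight r * exp_mean r)"
      by (simp add: algebra_simps)
    show ?thesis using ineq unfolding l rr e1 e2 u_def[symmetric] by simp
  next
    case False
    then have "cut_weight r = 0" using that by (auto simp: cut_weight_def)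
    then show ?thesis by simp
  qed
  have [measurable]: "(\<lambda>r. cut_process r \<omega>) \<in> borel_measurable borel"
    using measurable_compose[OF measurable_Pair2'[OF w, of lborel] cut_process_measurable] by simp
  have c0: "0 \<le> c * (p - 1)" "0 < c" using p by (auto simp: c_def)
  have d0: "0 \<le> p * (c / exp y)" using p c0 by simp
  have "p * (c / exp y) * x \<le> p * (c / exp y) * path_integral \<omega>" by (rule mult_left_mono[OF x(2) d0])
  then have "ennreal (p * (c / exp y) * x) \<le> ennreal (p * (c / exp y) * path_integral \<omega>)" by (rule ennreal_leI)
  also have "\<dots> = ennreal (p * (c / exp y)) * ennreal (path_integral \<omega>)"
    using d0 x x0 by (intro ennreal_mult) auto
  also have "\<dots> \<le> ennreal (p * (c / exp y)) * (\<integral>\<^sup>+r. ennreal (cut_weight r * exp (\<beta> * cut_process r \<omega>)) \<partial>lborel)"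
    by (intro mult_left_mono path_integral_le[OF w]) auto
  also have "\<dots> = (\<integral>\<^sup>+r. ennreal (p * (c / exp y) * (cut_weight r * exp (\<beta> * cut_process r \<omega>))) \<partial>lborel)"
  proof -
    have "ennreal (p * (c / exp y) * (cut_weight r * exp (\<beta> * cut_process r \<omega>)))
      = ennreal (p * (c / exp y)) * ennreal (cut_weight r * exp (\<beta> * cut_process r \<omega>))" for r
      using d0 cut_weight_bounds by (intro ennreal_mult) auto
    then show ?thesis by (simp only:) (rule nn_integral_cmult[symmetric], measurable)
  qed
  also have "\<dots> \<le> (\<integral>\<^sup>+r. ennreal (cut_weight r * exp_mean r * exp (p * (\<beta> * cut_process r \<omega> - ln (exp_mean r)))) + ennreal (c * (p - 1)) * ennreal (cut_weight r * exp_mean r) \<partial>lborel)"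
  proof (rule nn_integral_mono_AE)
    have mn: "0 \<le> exp_mean r" for r by (simp add: exp_mean_def)
    show "AE r in lborel. ennreal (p * (c / exp y) * (cut_weight r * exp (\<beta> * cut_process r \<omega>)))
      \<le> ennreal (cut_weight r * exp_mean r * exp (p * (\<beta> * cut_process r \<omega> - ln (exp_mean r)))) + ennreal (c * (p - 1)) * ennreal (cut_weight r * exp_mean r)"
      using AE_lborel_singleton[of 0]
    proof eventually_elim
      case (elim r)
      have "ennreal (p * (c / exp y) * (cut_weight r * exp (\<beta> * cut_process r \<omega>)))
        \<le> ennreal (cut_weight r * exp_mean r * exp (p * (\<beta> * cut_process r \<omega> - ln (exp_mean r))) + (c * (p - 1)) * (cut_weight r * exp_mean r))"
        by (intro ennreal_leI pw elim)
      also have "\<dots> = ennreal (cut_weight r * exp_mean r * exp (p * (\<beta> * cut_process r \<omega> - ln (exp_mean r)))) + ennreal ((c * (p - 1)) * (cut_weight r * exp_mean r))"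
        using cut_weight_bounds mn c0 p by (intro ennreal_plus mult_nonneg_nonneg) auto
      also have "ennreal ((c * (p - 1)) * (cut_weight r * exp_mean r)) = ennreal (c * (p - 1)) * ennreal (cut_weight r * exp_mean r)"
        using cut_weight_bounds mn c0 p by (intro ennreal_mult mult_nonneg_nonneg) auto
      finally show ?case .
    qed
  qed
  also have "\<dots> = tilted_integral p \<omega> + ennreal (c * (p - 1)) * ennreal \<mu>"
    unfolding tilted_integral_def by (subst nn_integral_add) (auto simp: nn_integral_cmult \<mu>_eq)
  also have "\<dots> = tilted_integral p \<omega> + ennreal (c * (p - 1) * \<mu>)"
    using c0 \<mu>_pos by (simp add: ennreal_mult)
  also have "p * (c / exp y) * x = \<mu> * c + c * (p - 1) * \<mu>"
    unfolding ey using x0 \<mu>_pos by (simp add: field_simps)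
  finally have "ennreal (\<mu> * c + c * (p - 1) * \<mu>) \<le> tilted_integral p \<omega> + ennreal (c * (p - 1) * \<mu>)" .
  moreover have "ennreal (\<mu> * c + c * (p - 1) * \<mu>) = ennreal (c * (p - 1) * \<mu>) + ennreal (\<mu> * c)"
    unfolding add.commute[of "\<mu> * c"] using c0 \<mu>_pos p by (intro ennreal_plus mult_nonneg_nonneg) auto
  ultimately have "ennreal (c * (p - 1) * \<mu>) + ennreal (\<mu> * c) \<le> ennreal (c * (p - 1) * \<mu>) + tilted_integral p \<omega>"
    by (simp only: add.commute[of "tilted_integral p \<omega>"])
  then have "ennreal (\<mu> * c) \<le> tilted_integral p \<omega>" by (simp only: ennreal_add_left_cancel_le) simp
  then show ?thesis by (simp only: c_def y_def)
qed

text \<open>Markov's inequality for \<open>tilted_integral p\<close>.\<close>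

lemma tail_exponent:
  assumes p: "1 \<le> p" and x: "\<mu> \<le> x"
  shows "measure M {\<omega> \<in> space M. x \<le> path_integral \<omega>} \<le> exp ((p\<^sup>2 - p) * m / 2 - p * ln (x / \<mu>))"
proof -
  let ?A = "{\<omega> \<in> space M. x \<le> path_integral \<omega>}" and ?c = "exp (p * ln (x / \<mu>))"
  have A [measurable]: "?A \<in> sets M" by measurable
  have "ennreal (\<mu> * ?c) * emeasure M ?A = (\<integral>\<^sup>+\<omega>. ennreal (\<mu> * ?c) * indicator ?A \<omega> \<partial>M)"
    by (simp add: nn_integral_cmult_indicator)
  also have "\<dots> \<le> (\<integral>\<^sup>+\<omega>. tilted_integral p \<omega> \<partial>M)"
    using tilted_integral_lower[OF p _ x] by (intro nn_integral_mono) (auto simp: indicator_def)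
  also have "\<dots> \<le> ennreal (exp ((p\<^sup>2 - p) * m / 2)) * ennreal \<mu>" by (rule expectation_tilted_integral[OF p])
  finally have "ennreal (\<mu> * ?c) * ennreal (measure M ?A) \<le> ennreal (exp ((p\<^sup>2 - p) * m / 2)) * ennreal \<mu>"
    by (simp only: emeasure_eq_measure)
  then have "\<mu> * ?c * measure M ?A \<le> exp ((p\<^sup>2 - p) * m / 2) * \<mu>"
    using \<mu>_pos by (simp flip: ennreal_mult)
  then have "?c * measure M ?A \<le> exp ((p\<^sup>2 - p) * m / 2)"
    using \<mu>_pos by (simp add: mult.assoc mult.commute[of _ \<mu>])
  then show ?thesis
    unfolding exp_diff by (subst pos_le_divide_eq) (simp_all only: exp_gt_zero mult.commute)
qed

lemma tail_gaussian:
  assumes x: "\<mu> < x"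
  shows "measure M {\<omega> \<in> space M. x \<le> path_integral \<omega>} \<le> (if m = 0 then 0 else exp (- ((ln (x / \<mu>))\<^sup>2 / (2 * m))))"
proof -
  define y where "y = ln (x / \<mu>)"
  have y: "0 < y" using x \<mu>_pos by (simp add: y_def)
  note tail = tail_exponent[OF _ less_imp_le[OF x], folded y_def]
  show ?thesis
  proof (cases "m = 0")
    case True
    have "measure M {\<omega> \<in> space M. x \<le> path_integral \<omega>} \<le> 0"
    proof (rule LIMSEQ_le_const)
      have "(\<lambda>n. (exp (- y)) ^ Suc n) \<longlonglongrightarrow> 0"
        using y by (intro LIMSEQ_Suc LIMSEQ_realpow_zero) auto
      then show "(\<lambda>n. exp (- (real (Suc n) * y))) \<longlonglongrightarrow> 0"
        by (simp only: exp_of_nat_mult[symmetric] mult_minus_right)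
      show "\<exists>N. \<forall>n\<ge>N. measure M {\<omega> \<in> space M. x \<le> path_integral \<omega>} \<le> exp (- (real (Suc n) * y))"
        using tail[of "real (Suc n)" for n] True by auto
    qed
    then show ?thesis using True by simp
  next
    case False
    then have m: "0 < m" using m_nonneg by simp
    \<comment> \<open>nearly the minimizer \<open>1/2 + y / m\<close> of the exponent, but always at least \<open>1\<close>\<close>
    define p where "p = 1 + y / m"
    have p: "1 \<le> p" using y m by (simp add: p_def)
    have "measure M {\<omega> \<in> space M. x \<le> path_integral \<omega>} \<le> exp ((p\<^sup>2 - p) * m / 2 - p * y)" by (rule tail[OF p])
    also have "(p\<^sup>2 - p) * m / 2 - p * y = - (y / 2) - y\<^sup>2 / (2 * m)"
      using m by (simp add: p_def power2_eq_square field_simps)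
    also have "exp (- (y / 2) - y\<^sup>2 / (2 * m)) \<le> exp (- (y\<^sup>2 / (2 * m)))" using y by simp
    finally show ?thesis using False by (simp add: y_def)
  qed
qed

end

section \<open>The bound for the blowup time\<close>

text \<open>Both integrals lie in the Gaussian space of \<open>B\<close>, hence so does their sum; its variance is at most twice the
sum of the variances, whatever their covariance.\<close>

lemma (in prob_space) driving_process_gaussian:
  assumes B: "brownian_motion M B" and fbm: "fractional_brownian_motion H M BH"
    and ito_BH: "\<forall>s\<ge>0. has_ito_integral M B s (K_H H s) (BH s)"
    and H: "1/2 < H" "H < 1" and a: "continuous_on {0..} a"
    and eps: "1 - H < \<epsilon>" "\<epsilon> < \<alpha>" "\<epsilon> < 1"
    and b: "\<forall>R\<ge>0. \<exists>c. \<forall>s\<in>{0..R}. \<forall>t\<in>{0..R}. \<bar>b s - b t\<bar> \<le> c * \<bar>s - t\<bar> powr \<alpha>"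
    and X [measurable]: "X \<in> borel_measurable M" and I: "has_ito_integral M B t a I"
    and eq: "AE \<omega> in M. X \<omega> = I \<omega> + fractional_integral \<epsilon> b (\<lambda>s. BH s \<omega>) t"
    and tT: "0 < t" "t \<le> T"
  shows "\<exists>v. gaussian_rv M X v \<and> \<beta>\<^sup>2 * v \<le> M_T \<beta> H a b T"
proof -
  have [measurable]: "I \<in> borel_measurable M" using I by (simp add: has_ito_integral_def)
  \<comment> \<open>on the bounded interval the Hoelder exponent may be lowered to one that interpolation preserves\<close>
  define \<gamma> where "\<gamma> = min \<alpha> 1"
  obtain c where c: "\<And>u v. u \<in> {0..T} \<Longrightarrow> v \<in> {0..T} \<Longrightarrow> \<bar>b u - b v\<bar> \<le> c * \<bar>u - v\<bar> powr \<alpha>"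
    using b tT by (meson less_le_trans less_imp_le)
  define C where "C = max 0 c * T powr (\<alpha> - \<gamma>)"
  have holderT: "\<bar>b u - b v\<bar> \<le> C * \<bar>u - v\<bar> powr \<gamma>" if "u \<in> {0..T}" "v \<in> {0..T}" for u v
  proof -
    have "\<bar>b u - b v\<bar> \<le> max 0 c * \<bar>u - v\<bar> powr \<alpha>"
      by (rule order_trans[OF c[OF that]]) (intro mult_right_mono; simp)
    also have "\<bar>u - v\<bar> powr \<alpha> = \<bar>u - v\<bar> powr (\<alpha> - \<gamma>) * \<bar>u - v\<bar> powr \<gamma>"
      by (simp flip: powr_add)
    also have "max 0 c * \<dots> \<le> max 0 c * (T powr (\<alpha> - \<gamma>) * \<bar>u - v\<bar> powr \<gamma>)"
      using that by (intro mult_left_mono mult_right_mono powr_mono2) (auto simp: \<gamma>_def)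
    finally show ?thesis by (simp add: C_def mult.assoc)
  qed
  interpret fbm_integral M \<epsilon> \<gamma> C t b H BH
    using eps H tT holderT fbm by unfold_locales (auto simp: \<gamma>_def C_def)
  define Y where "Y \<omega> = X \<omega> - I \<omega>" for \<omega>
  have Ym [measurable]: "Y \<in> borel_measurable M" unfolding Y_def[abs_def] by measurable
  have Yeq: "AE \<omega> in M. Y \<omega> = fractional_integral \<epsilon> b (\<lambda>s. BH s \<omega>) t"
    using eq by eventually_elim (simp add: Y_def)
  have ito: "has_ito_integral M B s (K_H H s) (BH s)" if "0 \<le> s" for s using ito_BH that by simp
  have bsI: "brownian_space M B I" by (rule ito_integral_brownian_space[OF B I])
  note Y = fractional_integral_gaussian[OF B ito Ym Yeq]
  obtain vY where vY: "gaussian_rv M Y vY" "vY \<le> 2 * H * t powr (2 * H - 1) * (LINT u|lebesgue_on {0..t}. (b u)\<^sup>2)"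
    using Y(2) by blast
  obtain vI where vI: "gaussian_rv M I vI" using brownian_space_gaussian[OF B bsI] by blast
  have aT: "continuous_on {0..T} a" "continuous_on {0..t} a" using a by (auto elim: continuous_on_subset)
  have bT: "continuous_on {0..T} b"
    using holderT eps H by (intro holder_continuous_on[where C=C and \<gamma>=\<gamma>]) (auto simp: C_def \<gamma>_def)
  have vI_le: "vI \<le> (LINT r|lebesgue_on {0..T}. (a r)\<^sup>2)"
    using ito_integral_variance_le[OF B I continuous_square_integrable[OF aT(2)] vI]
      half_energy_mono[OF continuous_square_integrable[OF aT(1)] tT(2)] by linarith
  have vY_le: "vY \<le> 2 * H * T powr (2 * H - 1) * (LINT u|lebesgue_on {0..T}. (b u)\<^sup>2)"
  proof (rule order_trans[OF vY(2)])
    show "2 * H * t powr (2 * H - 1) * (LINT u|lebesgue_on {0..t}. (b u)\<^sup>2) \<le> 2 * H * T powr (2 * H - 1) * (LINT u|lebesgue_on {0..T}. (b u)\<^sup>2)"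
      using H tT half_energy_mono[OF continuous_square_integrable[OF bT] tT(2)]
      by (intro mult_mono powr_mono2) auto
  qed
  have "brownian_space M B (\<lambda>\<omega>. I \<omega> + Y \<omega>)" by (rule brownian_space_add[OF B bsI Y(1)])
  then have "brownian_space M B X" by (simp add: Y_def)
  then obtain v where v: "gaussian_rv M X v" using brownian_space_gaussian[OF B] by blast
  have pos: "0 \<le> v" "0 \<le> vI" "0 \<le> vY" using v vI vY by (auto simp: gaussian_rv_def)
  have "ennreal v = (\<integral>\<^sup>+\<omega>. ennreal ((X \<omega>)\<^sup>2) \<partial>M)" by (rule gaussian_rv_second_moment[OF v, symmetric])
  also have "\<dots> \<le> (\<integral>\<^sup>+\<omega>. ennreal 2 * ennreal ((I \<omega>)\<^sup>2) + ennreal 2 * ennreal ((Y \<omega>)\<^sup>2) \<partial>M)"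
  proof (intro nn_integral_mono)
    fix \<omega>
    have "(X \<omega>)\<^sup>2 \<le> 2 * (I \<omega>)\<^sup>2 + 2 * (Y \<omega>)\<^sup>2"
      using sum_squares_bound[of "I \<omega>" "Y \<omega>"] by (simp add: Y_def power2_eq_square algebra_simps)
    then have "ennreal ((X \<omega>)\<^sup>2) \<le> ennreal (2 * (I \<omega>)\<^sup>2 + 2 * (Y \<omega>)\<^sup>2)" by (rule ennreal_leI)
    also have "\<dots> = ennreal (2 * (I \<omega>)\<^sup>2) + ennreal (2 * (Y \<omega>)\<^sup>2)" by (rule ennreal_plus) auto
    also have "\<dots> = ennreal 2 * ennreal ((I \<omega>)\<^sup>2) + ennreal 2 * ennreal ((Y \<omega>)\<^sup>2)"
      by (intro arg_cong2[where f="(+)"] ennreal_mult) auto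
    finally show "ennreal ((X \<omega>)\<^sup>2) \<le> ennreal 2 * ennreal ((I \<omega>)\<^sup>2) + ennreal 2 * ennreal ((Y \<omega>)\<^sup>2)" .
  qed
  also have "\<dots> = ennreal 2 * (\<integral>\<^sup>+\<omega>. ennreal ((I \<omega>)\<^sup>2) \<partial>M) + ennreal 2 * (\<integral>\<^sup>+\<omega>. ennreal ((Y \<omega>)\<^sup>2) \<partial>M)"
    by (subst nn_integral_add) (auto simp: nn_integral_cmult)
  also have "\<dots> = ennreal (2 * vI + 2 * vY)"
    unfolding gaussian_rv_second_moment[OF vI] gaussian_rv_second_moment[OF vY(1)]
    using pos by (simp add: ennreal_mult)
  finally have "ennreal v \<le> ennreal (2 * vI + 2 * vY)" .
  then have "v \<le> 2 * vI + 2 * vY" by (subst (asm) ennreal_le_iff) (use pos in auto)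
  then have "\<beta>\<^sup>2 * v \<le> \<beta>\<^sup>2 * (2 * (LINT r|lebesgue_on {0..T}. (a r)\<^sup>2)
      + 2 * (2 * H * T powr (2 * H - 1) * (LINT u|lebesgue_on {0..T}. (b u)\<^sup>2)))"
    using vI_le vY_le by (intro mult_left_mono) auto
  also have "\<dots> = M_T \<beta> H a b T" by (simp add: M_T_def algebra_simps)
  finally show ?thesis using v by blast
qed

lemma inner_D_nonneg:
  assumes "AE x in lebesgue_on D. 0 \<le> \<phi> x" and "\<forall>x\<in>D. 0 < \<phi>\<^sub>0 x" and "open D"
  shows "0 \<le> inner_D D \<phi> \<phi>\<^sub>0"
  unfolding inner_D_def
proof (rule integral_nonneg_AE)
  show "AE x in lebesgue_on D. 0 \<le> \<phi> x * \<phi>\<^sub>0 x"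
    using assms(1) AE_space
  proof eventually_elim
    case (elim x)
    then have "0 < \<phi>\<^sub>0 x" using assms(2) by (simp add: space_restrict_space)
    then show ?case using elim by simp
  qed
qed

theorem theorem4:
  fixes D :: "(real ^ 'd) set"
    and P Pstar :: "real \<Rightarrow> (real ^ 'd \<Rightarrow> real) \<Rightarrow> (real ^ 'd \<Rightarrow> real)"
    and DomL DomLstar :: "(real ^ 'd \<Rightarrow> real) set"
    and L Lstar :: "(real ^ 'd \<Rightarrow> real) \<Rightarrow> (real ^ 'd \<Rightarrow> real)"
    and p :: "real \<Rightarrow> real ^ 'd \<Rightarrow> real ^ 'd \<Rightarrow> real"
    and \<phi> \<psi>\<^sub>0 \<phi>\<^sub>0 :: "real ^ 'd \<Rightarrow> real"
    and g a b k :: "real \<Rightarrow> real"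
    and M :: "'w measure" and F :: "real \<Rightarrow> 'w measure"
    and B BH N :: "real \<Rightarrow> 'w \<Rightarrow> real"
    and H \<alpha> \<epsilon> lam\<^sub>0 C \<beta> T :: real
  assumes "lipschitz_domain D" and "bounded D"
    and "contraction_semigroup D P" and "infinitesimal_generator D P DomL L"
    and "adjoint_operator D DomL L DomLstar Lstar"
    and "contraction_semigroup D Pstar" and "infinitesimal_generator D Pstar DomLstar Lstar"
    and "\<forall>t\<ge>0. adjoint_operator D (L2_fun D) (P t) (L2_fun D) (Pstar t)"
    and "continuous_transition_densities D P p"
    and "\<phi> \<in> borel_measurable (lebesgue_on D)"
    and "\<exists>c. AE x in lebesgue_on D. \<bar>\<phi> x\<bar> \<le> c"
    and "AE x in lebesgue_on D. 0 \<le> \<phi> x"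
    and "\<forall>z. 0 \<le> g z"
    and "\<forall>z. \<exists>r>0. \<exists>c. c-lipschitz_on (cball z r) g"
    and "prob_space M" and "filtration (space M) F" and "\<forall>t. subalgebra M (F t)"
    and "brownian_motion M B" and "\<forall>t\<ge>0. B t \<in> borel_measurable (F t)"
    and "1/2 < H" and "H < 1"
    and "fractional_brownian_motion H M BH" and "\<forall>t\<ge>0. BH t \<in> borel_measurable (F t)"
    and "continuous_on {0..} a"
    and "1 - H < \<alpha>"
    and "\<forall>R\<ge>0. \<exists>c. \<forall>s\<in>{0..R}. \<forall>t\<in>{0..R}. \<bar>b s - b t\<bar> \<le> c * \<bar>s - t\<bar> powr \<alpha>"
    and "\<forall>t\<ge>0. integrable (lebesgue_on {0..t}) (\<lambda>r. (k r)\<^sup>2)"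
    and "1 - H < \<epsilon>" and "\<epsilon> < \<alpha>" and "\<epsilon> < 1"
    and "\<forall>t\<ge>0. N t \<in> borel_measurable M"
    and "\<forall>\<omega>\<in>space M. continuous_on {0..} (\<lambda>t. N t \<omega>)"
    and "\<forall>t\<ge>0. \<exists>I. has_ito_integral M B t a I \<and>
           (AE \<omega> in M. N t \<omega> = I \<omega> + fractional_integral \<epsilon> b (\<lambda>s. BH s \<omega>) t)"
    and "0 < lam\<^sub>0"
    and "\<psi>\<^sub>0 \<in> DomL" and "\<forall>x\<in>D. 0 < \<psi>\<^sub>0 x" and "(LINT x|lebesgue_on D. \<psi>\<^sub>0 x) = 1"
    and "\<phi>\<^sub>0 \<in> DomLstar" and "\<forall>x\<in>D. 0 < \<phi>\<^sub>0 x" and "(LINT x|lebesgue_on D. \<phi>\<^sub>0 x) = 1"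
    and "\<forall>t\<ge>0. AE x in lebesgue_on D. P t \<psi>\<^sub>0 x = exp (- lam\<^sub>0 * t) * \<psi>\<^sub>0 x"
    and "\<forall>t\<ge>0. AE x in lebesgue_on D. Pstar t \<phi>\<^sub>0 x = exp (- lam\<^sub>0 * t) * \<phi>\<^sub>0 x"
    and "\<forall>t\<ge>0. has_ito_integral M B t (K_H H t) (BH t)"
    and "0 < C" and "0 < \<beta>" and "\<forall>z>0. C * z powr (1 + \<beta>) \<le> g z"
    and "0 < T"
    and "threshold C \<beta> (inner_D D \<phi> \<phi>\<^sub>0) > ereal (mu_T M \<beta> lam\<^sub>0 k a N T)"
  shows "{\<omega> \<in> space M. tau_star C \<beta> lam\<^sub>0 k a (inner_D D \<phi> \<phi>\<^sub>0) (\<lambda>t. N t \<omega>) \<le> ereal T} \<in> sets M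
    \<and> measure M {\<omega> \<in> space M. tau_star C \<beta> lam\<^sub>0 k a (inner_D D \<phi> \<phi>\<^sub>0) (\<lambda>t. N t \<omega>) \<le> ereal T}
      \<le> tail_bound C \<beta> (inner_D D \<phi> \<phi>\<^sub>0) (mu_T M \<beta> lam\<^sub>0 k a N T) (M_T \<beta> H a b T)"
proof -
  let ?q = "inner_D D \<phi> \<phi>\<^sub>0" and ?m = "M_T \<beta> H a b T" and ?mu = "mu_T M \<beta> lam\<^sub>0 k a N T"
  let ?A = "{\<omega> \<in> space M. tau_star C \<beta> lam\<^sub>0 k a ?q (\<lambda>t. N t \<omega>) \<le> ereal T}"
  have "open D" using assms(1) by (simp add: lipschitz_domain_def)
  then have q: "0 \<le> ?q" using assms(12,39) by (intro inner_D_nonneg) auto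
  show ?thesis
  proof (cases "?q = 0")
    case True
    then have "tau_star C \<beta> lam\<^sub>0 k a ?q n = \<infinity>" for n
      by (simp add: tau_star_def threshold_def top_ereal_def)
    then have empty: "?A = {}" by simp
    show ?thesis unfolding empty using True by (simp add: tail_bound_def)
  next
    case False
    interpret prob_space M by (rule assms)
    have "\<exists>v. gaussian_rv M (N t) v \<and> \<beta>\<^sup>2 * v \<le> ?m" if t: "0 < t" "t \<le> T" for t
    proof -
      obtain I where I: "has_ito_integral M B t a I"
        and eq: "AE \<omega> in M. N t \<omega> = I \<omega> + fractional_integral \<epsilon> b (\<lambda>s. BH s \<omega>) t"
        using assms(33) t by (meson less_imp_le)
      have Nt: "N t \<in> borel_measurable M" using assms(31) t by simp
      show ?thesis
        by (rule driving_process_gaussian[OF assms(18,22,43,20,21,24,28,29,30,26) Nt I eq t])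
    qed
    then obtain v where v: "\<And>t. 0 < t \<Longrightarrow> t \<le> T \<Longrightarrow> gaussian_rv M (N t) (v t) \<and> \<beta>\<^sup>2 * v t \<le> ?m"
      by metis
    interpret gaussian_path \<beta> lam\<^sub>0 k a M N T ?m v
      using assms(24,27,31,32,34,45,47) v by unfold_locales auto
    define x where "x = 1 / (C * \<beta>) * ?q powr (- \<beta>)"
    have x: "\<mu> < x" using assms(48) False by (simp add: threshold_def x_def \<mu>_def)
    have A: "?A = {\<omega> \<in> space M. x \<le> path_integral \<omega>}"
      unfolding path_integral_def x_def using assms(32) T False by (auto simp: tau_star_le_iff)
    have "C * \<beta> * ?q powr \<beta> * ?mu = \<mu> / x"
      using assms(44,45) by (simp add: x_def \<mu>_def powr_minus field_simps)
    moreover have "ln (\<mu> / x) = - ln (x / \<mu>)"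
      using x \<mu>_pos by (simp add: ln_div)
    ultimately have "tail_bound C \<beta> ?q ?mu ?m = (if ?m = 0 then 0 else 2 * exp (- ((ln (x / \<mu>))\<^sup>2 / (2 * ?m))))"
      using False by (simp add: tail_bound_def)
    moreover have "measure M ?A \<le> (if ?m = 0 then 0 else exp (- ((ln (x / \<mu>))\<^sup>2 / (2 * ?m))))"
      unfolding A by (rule tail_gaussian[OF x])
    moreover have "exp (- ((ln (x / \<mu>))\<^sup>2 / (2 * ?m))) \<le> 2 * exp (- ((ln (x / \<mu>))\<^sup>2 / (2 * ?m)))" by simp
    moreover have "?A \<in> sets M" unfolding A by measurable
    ultimately show ?thesis by (auto split: if_splits intro: order_trans)
  qed
qed

end
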